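(* Let $f=f_1\cdots f_r\in\mathbb{C}[x_1,\dots,x_n]$ be a central, reduced and free hyperplane arrangement where the $f_k$ are not necessarily linear forms. Let $F=(f_1,\dots,f_r)$. If $A=(a_1,\dots,a_r)\in\mathbb{C}^r$ and $A-1:=(a_1-1,\dots,a_r-1)\in\mathrm{V}(B_{F,0})$, then $$\nabla_A:\frac{\mathscr{D}_{\mathbb{C}^n,0}[S]F^S}{(S-A)\mathscr{D}_{\mathbb{C}^n,0}[S]F^S}\to\frac{\mathscr{D}_{\mathbb{C}^n,0}[S]F^S}{(S-(A-1))\mathscr{D}_{\mathbb{C}^n,0}[S]F^S}$$ is not surjective.
   Context: A central arrangement is a product of homogeneous linear forms, reduced if these are pairwise non-proportional, and free if the module of derivations $\delta$ with $\delta\bullet f\in(f)$ is free. $\mathscr{D}_{\mathbb{C}^n,0}$ is the ring of germs at $0$ of analytic linear differential operators, $S=s_1,\dots,s_r$ central variables. $F^S=f_1^{s_1}\cdots f_r^{s_r}$ is the symbol generating a free $\mathscr{O}_{\mathbb{C}^n,0}[S][\frac1f]$-module with action $\delta\bullet(hF^S)=(\delta\bullet h)F^S+h\sum_k\frac{\delta\bullet f_k}{f_k}s_kF^S$ for derivations $\delta$, and $\mathscr{D}_{\mathbb{C}^n,0}[S]F^S$ is the submodule generated by $F^S$. $B_{F,0}=\{B(S)\in\mathbb{C}[S]:B(S)F^S\in\mathscr{D}_{\mathbb{C}^n,0}[S]fF^S\}$, and $\mathrm{V}(-)$ is the zero locus in $\mathbb{C}^r$. $S-A$ denotes the sequence $s_1-a_1,\dots,s_r-a_r$,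 and $(S-A)M=\sum_k(s_k-a_k)M$. The injective $\mathscr{D}_{\mathbb{C}^n,0}$-linear map $\nabla:\mathscr{D}_{\mathbb{C}^n,0}[S]F^S\to\mathscr{D}_{\mathbb{C}^n,0}[S]F^S$ is given by sending every $s_k$ to $s_k+1$ and identifying $F^{S+1}$ with $fF^S$, i.e. $P(S)F^S\mapsto P(S+1)fF^S$; $\nabla_A$ is the induced $\mathscr{D}_{\mathbb{C}^n,0}$-linear map on quotients. *)

theory Defs
  imports
    "HOL-Analysis.Analysis"
    "HOL-Library.Poly_Mapping"
    "HOL-Library.Function_Algebras"
    "HOL-Computational_Algebra.Fraction_Field"
begin

section \<open>Multivariate polynomials\<close>

text \<open>
  Polynomials in finitely many variables indexed by \<open>'v\<close>, with coefficients in \<open>'a\<close>: finitely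
  supported functions on exponent vectors, with the convolution product.
\<close>

type_synonym ('v, 'a) mpoly = "('v \<Rightarrow>\<^sub>0 nat) \<Rightarrow>\<^sub>0 'a"

definition const :: "'a::zero \<Rightarrow> ('v, 'a) mpoly" where
  "const c = Poly_Mapping.single 0 c"

definition var :: "'v \<Rightarrow> ('v, 'a::zero_neq_one) mpoly" where
  "var k = Poly_Mapping.single (Poly_Mapping.single k 1) 1"

text \<open>Apply \<open>\<phi>\<close> to the coefficients and substitute \<open>x k\<close> for the \<open>k\<close>-th variable.\<close>

definition mpoly_subst ::
    "('a::zero \<Rightarrow> 'b::comm_semiring_1) \<Rightarrow> ('v::finite \<Rightarrow> 'b) \<Rightarrow> ('v, 'a) mpoly \<Rightarrow> 'b" where
  "mpoly_subst \<phi> x p =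
     (\<Sum>\<beta>\<in>Poly_Mapping.keys p. \<phi> (Poly_Mapping.lookup p \<beta>) * (\<Prod>k\<in>UNIV. x k ^ Poly_Mapping.lookup \<beta> k))"

lemma const_0 [simp]: "const 0 = 0"
  by (simp add: const_def)

lemma const_1 [simp]: "const (1::'a::semiring_1) = 1"
  by (simp add: const_def)

lemma const_add: "const (a + b :: 'a::monoid_add) = const a + const b"
  by (simp add: const_def single_add)

lemma const_mult: "const (a * b :: 'a::semiring_0) = const a * const b"
  by (simp add: const_def mult_single)

lemma const_diff: "const (a - b :: 'a::ab_group_add) = const a - const b"
  by (simp add: const_def single_diff)

lemma monomial_induct [case_names add monom]:
  fixes p :: "('v, 'a::comm_monoid_add) mpoly"
  assumes "\<And>p q. P p \<Longrightarrow> P q \<Longrightarrow> P (p + q)" and "\<And>\<beta> c. P (Poly_Mapping.single \<beta> c)"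
  shows "P p"
proof -
  have *: "P (\<Sum>\<beta>\<in>A. Poly_Mapping.single \<beta> (Poly_Mapping.lookup p \<beta>))" if "finite A" for A
    using that
  proof (induction A)
    case empty
    show ?case using assms(2)[of 0 0] by simp
  qed (auto intro: assms)
  have "p = (\<Sum>\<beta>\<in>Poly_Mapping.keys p. Poly_Mapping.single \<beta> (Poly_Mapping.lookup p \<beta>))"
    by (rule poly_mapping_eqI)
      (auto simp: lookup_sum lookup_single when_def in_keys_iff)
  then show ?thesis using *[OF finite_keys] by metis
qed

lemma mpoly_subst_superset:
  assumes "finite A" "Poly_Mapping.keys p \<subseteq> A" "\<phi> 0 = 0"
  shows "mpoly_subst \<phi> x p =
     (\<Sum>\<beta>\<in>A. \<phi> (Poly_Mapping.lookup p \<beta>) * (\<Prod>k\<in>UNIV. x k ^ Poly_Mapping.lookup \<beta> k))"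
  unfolding mpoly_subst_def using assms
  by (intro sum.mono_neutral_left) (auto simp: in_keys_iff)

lemma mpoly_subst_single:
  assumes "\<phi> 0 = 0"
  shows "mpoly_subst \<phi> x (Poly_Mapping.single \<beta> c) =
     \<phi> c * (\<Prod>k\<in>UNIV. x k ^ Poly_Mapping.lookup \<beta> k)"
  using mpoly_subst_superset[of "{\<beta>}" "Poly_Mapping.single \<beta> c" \<phi> x] assms by simp

locale coeff_hom =
  fixes \<phi> :: "'a::comm_semiring_1 \<Rightarrow> 'b::comm_semiring_1"
  assumes hom_0: "\<phi> 0 = 0" and hom_1: "\<phi> 1 = 1"
    and hom_add: "\<phi> (a + b) = \<phi> a + \<phi> b" and hom_mult: "\<phi> (a * b) = \<phi> a * \<phi> b"
begin

lemma subst_add: "mpoly_subst \<phi> x (p + q) = mpoly_subst \<phi> x p + mpoly_subst \<phi> x q"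
proof -
  let ?A = "Poly_Mapping.keys p \<union> Poly_Mapping.keys q"
  have "Poly_Mapping.keys (p + q) \<subseteq> ?A" by (rule Poly_Mapping.keys_add)
  then show ?thesis
    by (simp add: mpoly_subst_superset[where A = ?A] hom_0 lookup_add hom_add algebra_simps
        sum.distrib)
qed

lemma subst_0: "mpoly_subst \<phi> x 0 = 0"
  by (simp add: mpoly_subst_def)

lemma subst_const: "mpoly_subst \<phi> x (const c) = \<phi> c"
  by (simp add: const_def mpoly_subst_single hom_0)

lemma subst_1: "mpoly_subst \<phi> x 1 = 1"
  using subst_const[of x 1] by (simp add: hom_1)

lemma subst_var: "mpoly_subst \<phi> x (var k) = x k"
proof -
  have "(\<Prod>j\<in>UNIV. x j ^ Poly_Mapping.lookup (Poly_Mapping.single k 1) j) =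
        (\<Prod>j\<in>UNIV. if j = k then x j else 1)"
    by (intro prod.cong) (auto simp: lookup_single when_def)
  then show ?thesis
    by (simp add: var_def mpoly_subst_single hom_0 hom_1)
qed

lemma subst_mult: "mpoly_subst \<phi> x (p * q) = mpoly_subst \<phi> x p * mpoly_subst \<phi> x q"
proof (induction p rule: monomial_induct)
  case (add p p')
  then show ?case by (simp add: algebra_simps subst_add)
next
  case (monom \<beta> c)
  show ?case
  proof (induction q rule: monomial_induct)
    case (add q q')
    then show ?case by (simp add: algebra_simps subst_add)
  next
    case (monom \<gamma> d)
    show ?case
      by (simp add: mult_single mpoly_subst_single hom_0 hom_mult lookup_add power_add
          prod.distrib mult_ac)
  qed
qed

end


section \<open>Analytic germs at the origin\<close>

text \<open>
  An analytic germ at the origin of \<open>\<complex>\<^sup>n\<close> is its Taylor series there, so that \<open>'n germ\<close> is the ring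
  of power series in the coordinates (indexed by \<open>'n\<close>) that converge absolutely on some polydisc
  around the origin.
\<close>

definition mdeg :: "('n::finite \<Rightarrow>\<^sub>0 nat) \<Rightarrow> nat" where
  "mdeg \<alpha> = (\<Sum>i\<in>UNIV. Poly_Mapping.lookup \<alpha> i)"

definition convergent_series :: "(('n::finite \<Rightarrow>\<^sub>0 nat) \<Rightarrow> complex) \<Rightarrow> bool" where
  "convergent_series a \<longleftrightarrow> (\<exists>\<rho>>0. (\<lambda>\<alpha>. norm (a \<alpha>) * \<rho> ^ mdeg \<alpha>) summable_on UNIV)"

lemma mdeg_add: "mdeg (\<alpha> + \<beta>) = mdeg \<alpha> + mdeg \<beta>"
  by (simp add: mdeg_def lookup_add sum.distrib)

lemma mdeg_0 [simp]: "mdeg 0 = 0"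
  by (simp add: mdeg_def)

lemma lookup_le_mdeg: "Poly_Mapping.lookup \<alpha> i \<le> mdeg \<alpha>"
  unfolding mdeg_def by (rule member_le_sum) auto

lemma mdeg_single: "mdeg (Poly_Mapping.single i m) = m"
  by (simp add: mdeg_def lookup_single when_def)

lemma summable_bound_iff:
  fixes g :: "'a \<Rightarrow> real"
  assumes "\<And>x. g x \<ge> 0"
  shows "g summable_on UNIV \<longleftrightarrow> (\<exists>C. \<forall>A. finite A \<longrightarrow> sum g A \<le> C)"
proof -
  have "g summable_on UNIV \<longleftrightarrow> (\<lambda>x. norm (g x)) summable_on UNIV"
    using assms by simp
  then show ?thesis
    unfolding abs_summable_iff_bdd_above bdd_above_def using assms by auto
qed

lemma convergent_series_bound:
  "convergent_series a \<longleftrightarrow>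
     (\<exists>\<rho>>0. \<exists>C. \<forall>A. finite A \<longrightarrow> (\<Sum>\<alpha>\<in>A. norm (a \<alpha>) * \<rho> ^ mdeg \<alpha>) \<le> C)"
proof -
  have "(\<lambda>\<alpha>. norm (a \<alpha>) * \<rho> ^ mdeg \<alpha>) summable_on UNIV \<longleftrightarrow>
      (\<exists>C. \<forall>A. finite A \<longrightarrow> (\<Sum>\<alpha>\<in>A. norm (a \<alpha>) * \<rho> ^ mdeg \<alpha>) \<le> C)" if "\<rho> > 0" for \<rho>
    using that by (intro summable_bound_iff) auto
  then show ?thesis unfolding convergent_series_def by meson
qed

lemma convergent_seriesE2:
  fixes a b :: "('n::finite \<Rightarrow>\<^sub>0 nat) \<Rightarrow> complex"
  assumes "convergent_series a" "convergent_series b"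
  obtains \<rho> C D where "\<rho> > 0" "\<And>A. finite A \<Longrightarrow> (\<Sum>\<alpha>\<in>A. norm (a \<alpha>) * \<rho> ^ mdeg \<alpha>) \<le> C"
    "\<And>A. finite A \<Longrightarrow> (\<Sum>\<alpha>\<in>A. norm (b \<alpha>) * \<rho> ^ mdeg \<alpha>) \<le> D"
proof -
  from assms obtain r C s D where
    r: "r > 0" "\<And>A. finite A \<Longrightarrow> (\<Sum>\<alpha>\<in>A. norm (a \<alpha>) * r ^ mdeg \<alpha>) \<le> C" and
    s: "s > 0" "\<And>A. finite A \<Longrightarrow> (\<Sum>\<alpha>\<in>A. norm (b \<alpha>) * s ^ mdeg \<alpha>) \<le> D"
    unfolding convergent_series_bound by meson
  show ?thesis
  proof (rule that[of "min r s"])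
    show "min r s > 0" using r s by simp
    fix A :: "('n \<Rightarrow>\<^sub>0 nat) set" assume A: "finite A"
    have "(\<Sum>\<alpha>\<in>A. norm (a \<alpha>) * min r s ^ mdeg \<alpha>) \<le> (\<Sum>\<alpha>\<in>A. norm (a \<alpha>) * r ^ mdeg \<alpha>)"
      using r s by (intro sum_mono mult_left_mono power_mono) auto
    with r(2)[OF A] show "(\<Sum>\<alpha>\<in>A. norm (a \<alpha>) * min r s ^ mdeg \<alpha>) \<le> C" by linarith
    have "(\<Sum>\<alpha>\<in>A. norm (b \<alpha>) * min r s ^ mdeg \<alpha>) \<le> (\<Sum>\<alpha>\<in>A. norm (b \<alpha>) * s ^ mdeg \<alpha>)"
      using r s by (intro sum_mono mult_left_mono power_mono) auto
    with s(2)[OF A] show "(\<Sum>\<alpha>\<in>A. norm (b \<alpha>) * min r s ^ mdeg \<alpha>) \<le> D" by linarith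
  qed
qed

definition splits :: "('n::finite \<Rightarrow>\<^sub>0 nat) \<Rightarrow> (('n \<Rightarrow>\<^sub>0 nat) \<times> ('n \<Rightarrow>\<^sub>0 nat)) set" where
  "splits \<gamma> = {(\<alpha>, \<beta>). \<alpha> + \<beta> = \<gamma>}"

lemma finite_mdeg_le: "finite {\<alpha> :: 'n::finite \<Rightarrow>\<^sub>0 nat. mdeg \<alpha> \<le> d}"
proof (rule finite_imageD)
  show "inj_on Poly_Mapping.lookup {\<alpha> :: 'n \<Rightarrow>\<^sub>0 nat. mdeg \<alpha> \<le> d}"
    by (auto intro: inj_onI poly_mapping_eqI)
  have "Poly_Mapping.lookup ` {\<alpha> :: 'n \<Rightarrow>\<^sub>0 nat. mdeg \<alpha> \<le> d} \<subseteq> (UNIV \<rightarrow>\<^sub>E {..d})"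
    by (auto simp: PiE_def intro: order_trans[OF lookup_le_mdeg])
  then show "finite (Poly_Mapping.lookup ` {\<alpha> :: 'n \<Rightarrow>\<^sub>0 nat. mdeg \<alpha> \<le> d})"
    by (rule finite_subset) (auto intro: finite_PiE)
qed

lemma finite_splits [simp]: "finite (splits \<gamma>)"
proof (rule finite_subset)
  show "splits \<gamma> \<subseteq> {\<alpha>. mdeg \<alpha> \<le> mdeg \<gamma>} \<times> {\<alpha>. mdeg \<alpha> \<le> mdeg \<gamma>}"
    by (auto simp: splits_def mdeg_add)
qed (auto intro: finite_mdeg_le)

lemma splits_0: "splits 0 = {(0, 0)}"
proof -
  have "\<alpha> = 0 \<and> \<beta> = 0" if "\<alpha> + \<beta> = 0" for \<alpha> \<beta> :: "'n::finite \<Rightarrow>\<^sub>0 nat"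
  proof -
    have "Poly_Mapping.lookup \<alpha> i = 0 \<and> Poly_Mapping.lookup \<beta> i = 0" for i
      using arg_cong[OF that, of "\<lambda>p. Poly_Mapping.lookup p i"] by (simp add: lookup_add)
    then show ?thesis by (auto intro: poly_mapping_eqI)
  qed
  then show ?thesis by (auto simp: splits_def)
qed

lemma convergent_series_add:
  assumes "convergent_series a" "convergent_series b"
  shows "convergent_series (\<lambda>\<alpha>. a \<alpha> + b \<alpha>)"
proof -
  obtain \<rho> C D where \<rho>: "\<rho> > 0" "\<And>A. finite A \<Longrightarrow> (\<Sum>\<alpha>\<in>A. norm (a \<alpha>) * \<rho> ^ mdeg \<alpha>) \<le> C"
    "\<And>A. finite A \<Longrightarrow> (\<Sum>\<alpha>\<in>A. norm (b \<alpha>) * \<rho> ^ mdeg \<alpha>) \<le> D"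
    using assms by (rule convergent_seriesE2) auto
  have "(\<Sum>\<alpha>\<in>A. norm (a \<alpha> + b \<alpha>) * \<rho> ^ mdeg \<alpha>) \<le> C + D" if "finite A" for A
  proof -
    have "(\<Sum>\<alpha>\<in>A. norm (a \<alpha> + b \<alpha>) * \<rho> ^ mdeg \<alpha>) \<le>
        (\<Sum>\<alpha>\<in>A. norm (a \<alpha>) * \<rho> ^ mdeg \<alpha> + norm (b \<alpha>) * \<rho> ^ mdeg \<alpha>)"
      using \<rho>(1) by (intro sum_mono) (simp add: norm_triangle_ineq mult_right_mono
          flip: distrib_right)
    then show ?thesis using \<rho>(2,3)[OF that] by (simp add: sum.distrib)
  qed
  then show ?thesis unfolding convergent_series_bound using \<rho>(1) by blast
qed

lemma convergent_series_uminus: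
  "convergent_series a \<Longrightarrow> convergent_series (\<lambda>\<alpha>. - a \<alpha>)"
  by (simp add: convergent_series_def)

lemma convergent_series_mult:
  assumes "convergent_series a" "convergent_series b"
  shows "convergent_series (\<lambda>\<gamma>. \<Sum>(\<alpha>, \<beta>)\<in>splits \<gamma>. a \<alpha> * b \<beta>)"
proof -
  obtain \<rho> C D where \<rho>: "\<rho> > 0" "\<And>A. finite A \<Longrightarrow> (\<Sum>\<alpha>\<in>A. norm (a \<alpha>) * \<rho> ^ mdeg \<alpha>) \<le> C"
    "\<And>A. finite A \<Longrightarrow> (\<Sum>\<alpha>\<in>A. norm (b \<alpha>) * \<rho> ^ mdeg \<alpha>) \<le> D"
    using assms by (rule convergent_seriesE2) auto
  let ?a = "\<lambda>\<alpha>. norm (a \<alpha>) * \<rho> ^ mdeg \<alpha>" and ?b = "\<lambda>\<alpha>. norm (b \<alpha>) * \<rho> ^ mdeg \<alpha>"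
  have "(\<Sum>\<gamma>\<in>A. norm (\<Sum>(\<alpha>, \<beta>)\<in>splits \<gamma>. a \<alpha> * b \<beta>) * \<rho> ^ mdeg \<gamma>) \<le> C * D" if A: "finite A" for A
  proof -
    let ?T = "Sigma A splits"
    let ?L = "(fst \<circ> snd) ` ?T" and ?R = "(snd \<circ> snd) ` ?T"
    have fin: "finite ?T" using A by auto
    have "(\<Sum>\<gamma>\<in>A. norm (\<Sum>(\<alpha>, \<beta>)\<in>splits \<gamma>. a \<alpha> * b \<beta>) * \<rho> ^ mdeg \<gamma>) \<le>
        (\<Sum>\<gamma>\<in>A. \<Sum>(\<alpha>, \<beta>)\<in>splits \<gamma>. ?a \<alpha> * ?b \<beta>)"
    proof (rule sum_mono)
      fix \<gamma>
      have "norm (\<Sum>(\<alpha>, \<beta>)\<in>splits \<gamma>. a \<alpha> * b \<beta>) * \<rho> ^ mdeg \<gamma> \<le>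
          (\<Sum>x\<in>splits \<gamma>. norm (case x of (\<alpha>, \<beta>) \<Rightarrow> a \<alpha> * b \<beta>)) * \<rho> ^ mdeg \<gamma>"
        using \<rho>(1) by (intro mult_right_mono norm_sum) auto
      also have "\<dots> = (\<Sum>(\<alpha>, \<beta>)\<in>splits \<gamma>. ?a \<alpha> * ?b \<beta>)"
        unfolding sum_distrib_right
        by (intro sum.cong) (auto simp: splits_def mdeg_add power_add norm_mult)
      finally show "norm (\<Sum>(\<alpha>, \<beta>)\<in>splits \<gamma>. a \<alpha> * b \<beta>) * \<rho> ^ mdeg \<gamma> \<le> \<dots>" .
    qed
    also have "\<dots> = (\<Sum>(\<gamma>, \<alpha>, \<beta>)\<in>?T. ?a \<alpha> * ?b \<beta>)"
      using A by (subst sum.Sigma) auto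
    also have "\<dots> = (\<Sum>(\<alpha>, \<beta>)\<in>snd ` ?T. ?a \<alpha> * ?b \<beta>)"
      by (subst sum.reindex) (auto simp: inj_on_def splits_def case_prod_unfold)
    also have "\<dots> \<le> (\<Sum>(\<alpha>, \<beta>)\<in>?L \<times> ?R. ?a \<alpha> * ?b \<beta>)"
      using fin \<rho>(1) by (intro sum_mono2) (force simp: image_iff)+
    also have "\<dots> = sum ?a ?L * sum ?b ?R"
      by (simp add: sum_product sum.cartesian_product)
    also have "\<dots> \<le> C * D"
      using \<rho> fin order_trans[OF sum_nonneg \<rho>(2)[OF finite.emptyI]] \<rho>(2)[of "{}"]
      by (intro mult_mono sum_nonneg) auto
    finally show ?thesis .
  qed
  then show ?thesis unfolding convergent_series_bound using \<rho>(1) by blast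
qed

lemma convergent_series_lookup: "convergent_series (Poly_Mapping.lookup p)"
proof -
  have "(\<lambda>\<alpha>. norm (Poly_Mapping.lookup p \<alpha>) * 1 ^ mdeg \<alpha>) summable_on Poly_Mapping.keys p"
    by (intro summable_on_finite) auto
  then have "(\<lambda>\<alpha>. norm (Poly_Mapping.lookup p \<alpha>) * 1 ^ mdeg \<alpha>) summable_on UNIV"
    by (rule summable_on_cong_neutral[THEN iffD1, rotated -1]) (auto simp: in_keys_iff)
  then show ?thesis unfolding convergent_series_def by (intro exI[of _ 1]) auto
qed

lemma convergent_series_partial:
  assumes "convergent_series a"
  shows "convergent_series (\<lambda>\<alpha>. of_nat (Poly_Mapping.lookup \<alpha> i + 1) * a (\<alpha> + Poly_Mapping.single i 1))"
proof -
  obtain \<rho> C where \<rho>: "\<rho> > 0" "\<And>A. finite A \<Longrightarrow> (\<Sum>\<alpha>\<in>A. norm (a \<alpha>) * \<rho> ^ mdeg \<alpha>) \<le> C"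
    using assms unfolding convergent_series_bound by blast
  let ?e = "Poly_Mapping.single i (1::nat)"
  have *: "(\<Sum>\<alpha>\<in>A. norm (of_nat (Poly_Mapping.lookup \<alpha> i + 1) * a (\<alpha> + ?e)) * (\<rho> / 2) ^ mdeg \<alpha>)
      \<le> 2 / \<rho> * C" if A: "finite A" for A
  proof -
    have "(\<Sum>\<alpha>\<in>A. norm (of_nat (Poly_Mapping.lookup \<alpha> i + 1) * a (\<alpha> + ?e)) * (\<rho> / 2) ^ mdeg \<alpha>) \<le>
        (\<Sum>\<alpha>\<in>A. 2 / \<rho> * (norm (a (\<alpha> + ?e)) * \<rho> ^ mdeg (\<alpha> + ?e)))"
    proof (rule sum_mono)
      fix \<alpha>
      have "Poly_Mapping.lookup \<alpha> i + 1 < 2 ^ (mdeg \<alpha> + 1)"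
        using lookup_le_mdeg[of \<alpha> i] less_exp[of "mdeg \<alpha> + 1"] by linarith
      then have "real (Poly_Mapping.lookup \<alpha> i + 1) \<le> 2 ^ (mdeg \<alpha> + 1)"
        by (metis less_imp_le of_nat_le_iff of_nat_numeral of_nat_power)
      then have "real (Poly_Mapping.lookup \<alpha> i + 1) * norm (a (\<alpha> + ?e)) * (\<rho> / 2) ^ mdeg \<alpha> \<le>
          2 ^ (mdeg \<alpha> + 1) * norm (a (\<alpha> + ?e)) * (\<rho> / 2) ^ mdeg \<alpha>"
        using \<rho>(1) by (intro mult_right_mono) auto
      also have "\<dots> = 2 / \<rho> * (norm (a (\<alpha> + ?e)) * \<rho> ^ mdeg (\<alpha> + ?e))"
        using \<rho>(1) by (simp add: mdeg_add mdeg_single power_divide field_simps)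
      finally show "norm (of_nat (Poly_Mapping.lookup \<alpha> i + 1) * a (\<alpha> + ?e)) * (\<rho> / 2) ^ mdeg \<alpha> \<le> \<dots>"
        by (simp only: norm_mult norm_of_nat)
    qed
    also have "\<dots> = 2 / \<rho> * (\<Sum>\<alpha>\<in>(\<lambda>\<alpha>. \<alpha> + ?e) ` A. norm (a \<alpha>) * \<rho> ^ mdeg \<alpha>)"
      by (subst sum.reindex) (auto simp: inj_on_def sum_distrib_left)
    also have "\<dots> \<le> 2 / \<rho> * C"
      using \<rho> A by (intro mult_left_mono \<rho>(2)) auto
    finally show ?thesis .
  qed
  show ?thesis unfolding convergent_series_bound
    using \<rho>(1) * by (intro exI[of _ "\<rho> / 2"] conjI exI[of _ "2 / \<rho> * C"]) auto
qed

typedef (overloaded) 'n::finite germ = "{a :: ('n \<Rightarrow>\<^sub>0 nat) \<Rightarrow> complex. convergent_series a}"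
  morphisms gcoeff Abs_germ
  by (rule exI[of _ "Poly_Mapping.lookup 0"]) (simp only: mem_Collect_eq convergent_series_lookup)

setup_lifting type_definition_germ

definition germ_of_mpoly :: "('n::finite, complex) mpoly \<Rightarrow> 'n germ" where
  "germ_of_mpoly p = Abs_germ (Poly_Mapping.lookup p)"

lemma gcoeff_germ_of_mpoly [simp]: "gcoeff (germ_of_mpoly p) = Poly_Mapping.lookup p"
  by (simp add: germ_of_mpoly_def Abs_germ_inverse convergent_series_lookup)

text \<open>The partial derivative of a germ, term by term.\<close>

lift_definition partial :: "'n::finite \<Rightarrow> 'n germ \<Rightarrow> 'n germ" is
  "\<lambda>i a \<alpha>. of_nat (Poly_Mapping.lookup \<alpha> i + 1) * a (\<alpha> + Poly_Mapping.single i 1)"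
  by (rule convergent_series_partial)

instantiation germ :: (finite) comm_ring_1
begin

lift_definition zero_germ :: "'a germ" is "\<lambda>_. 0"
  using convergent_series_lookup[of 0] by (simp add: zero_poly_mapping.rep_eq)

lift_definition one_germ :: "'a germ" is "\<lambda>\<alpha>. 1 when \<alpha> = 0"
  using convergent_series_lookup[of 1] by (simp add: one_poly_mapping.rep_eq)

lift_definition plus_germ :: "'a germ \<Rightarrow> 'a germ \<Rightarrow> 'a germ" is "\<lambda>a b \<alpha>. a \<alpha> + b \<alpha>"
  by (rule convergent_series_add)

lift_definition uminus_germ :: "'a germ \<Rightarrow> 'a germ" is "\<lambda>a \<alpha>. - a \<alpha>"
  by (rule convergent_series_uminus)

lift_definition minus_germ :: "'a germ \<Rightarrow> 'a germ \<Rightarrow> 'a germ" is "\<lambda>a b \<alpha>. a \<alpha> - b \<alpha>"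
  using convergent_series_add[OF _ convergent_series_uminus] by (simp add: fun_eq_iff)

lift_definition times_germ :: "'a germ \<Rightarrow> 'a germ \<Rightarrow> 'a germ" is
  "\<lambda>a b \<gamma>. \<Sum>(\<alpha>, \<beta>)\<in>splits \<gamma>. a \<alpha> * b \<beta>"
  by (rule convergent_series_mult)

instance
proof
  fix a b c :: "'a germ"
  show "a * b * c = a * (b * c)"
  proof (transfer, rule ext)
    fix a b c :: "('a \<Rightarrow>\<^sub>0 nat) \<Rightarrow> complex" and \<gamma>
    have "(\<Sum>(\<delta>, \<zeta>)\<in>splits \<gamma>. (\<Sum>(\<alpha>, \<beta>)\<in>splits \<delta>. a \<alpha> * b \<beta>) * c \<zeta>) =
        (\<Sum>(p, q)\<in>Sigma (splits \<gamma>) (\<lambda>p. splits (fst p)). a (fst q) * b (snd q) * c (snd p))"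
      by (subst sum.Sigma[symmetric]) (auto simp: sum_distrib_right case_prod_unfold)
    also have "\<dots> = (\<Sum>(p, q)\<in>Sigma (splits \<gamma>) (\<lambda>p. splits (snd p)). a (fst p) * (b (fst q) * c (snd q)))"
      by (rule sum.reindex_bij_witness[where
            i = "\<lambda>(p, q). ((fst p + fst q, snd q), (fst p, fst q))" and
            j = "\<lambda>(p, q). ((fst q, snd q + snd p), (snd q, snd p))"])
        (auto simp: splits_def add.assoc)
    also have "\<dots> = (\<Sum>(\<alpha>, \<delta>)\<in>splits \<gamma>. a \<alpha> * (\<Sum>(\<beta>, \<zeta>)\<in>splits \<delta>. b \<beta> * c \<zeta>))"
      by (subst sum.Sigma[symmetric]) (auto simp: sum_distrib_left case_prod_unfold)
    finally show "(\<Sum>(\<delta>, \<zeta>)\<in>splits \<gamma>. (\<Sum>(\<alpha>, \<beta>)\<in>splits \<delta>. a \<alpha> * b \<beta>) * c \<zeta>) = \<dots>" .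
  qed
  show "a * b = b * a"
  proof (transfer, rule ext)
    fix a b :: "('a \<Rightarrow>\<^sub>0 nat) \<Rightarrow> complex" and \<gamma>
    show "(\<Sum>(\<alpha>, \<beta>)\<in>splits \<gamma>. a \<alpha> * b \<beta>) = (\<Sum>(\<alpha>, \<beta>)\<in>splits \<gamma>. b \<alpha> * a \<beta>)"
      by (rule sum.reindex_bij_witness[where i = prod.swap and j = prod.swap])
        (auto simp: splits_def add.commute mult.commute)
  qed
  show "1 * a = a"
  proof (transfer, rule ext)
    fix a :: "('a \<Rightarrow>\<^sub>0 nat) \<Rightarrow> complex" and \<gamma>
    have "(\<Sum>(\<alpha>, \<beta>)\<in>splits \<gamma>. (1 when \<alpha> = 0) * a \<beta>) = (\<Sum>(\<alpha>, \<beta>)\<in>{(0 :: 'a \<Rightarrow>\<^sub>0 nat, \<gamma>)}. (1 when \<alpha> = 0) * a \<beta>)"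
      by (rule sum.mono_neutral_right[OF finite_splits]) (auto simp: splits_def when_def split: if_splits)
    then show "(\<Sum>(\<alpha>, \<beta>)\<in>splits \<gamma>. (1 when \<alpha> = 0) * a \<beta>) = a \<gamma>" by simp
  qed
  show "(a + b) * c = a * c + b * c"
    by transfer (auto simp: distrib_right case_prod_unfold sum.distrib)
  show "0 \<noteq> (1 :: 'a germ)"
    by transfer (auto simp: fun_eq_iff when_def)
qed (transfer; auto simp: fun_eq_iff)+

end

text \<open>
  For the absence of zero divisors, exponents are compared first by degree and then
  lexicographically, after numbering the coordinates.
\<close>

definition renumber :: "('n::finite \<Rightarrow> nat) \<Rightarrow> ('n \<Rightarrow>\<^sub>0 nat) \<Rightarrow> nat \<Rightarrow>\<^sub>0 nat" where
  "renumber h \<alpha> = (\<Sum>i\<in>UNIV. Poly_Mapping.single (h i) (Poly_Mapping.lookup \<alpha> i))"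

lemma renumber_add: "renumber h (\<alpha> + \<beta>) = renumber h \<alpha> + renumber h \<beta>"
  by (simp add: renumber_def lookup_add single_add sum.distrib)

lemma inj_renumber:
  assumes "inj h"
  shows "inj (renumber h)"
proof (rule injI)
  fix \<alpha> \<beta> assume eq: "renumber h \<alpha> = renumber h \<beta>"
  have *: "Poly_Mapping.lookup (renumber h \<gamma>) (h j) = Poly_Mapping.lookup \<gamma> j" for \<gamma> j
  proof -
    have "Poly_Mapping.lookup (renumber h \<gamma>) (h j) =
        (\<Sum>i\<in>UNIV. if i = j then Poly_Mapping.lookup \<gamma> i else 0)"
      unfolding renumber_def lookup_sum
      by (intro sum.cong) (auto simp: lookup_single when_def inj_eq[OF assms])
    then show ?thesis by simp
  qed
  show "\<alpha> = \<beta>" by (rule poly_mapping_eqI) (metis * eq)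
qed

lemma lowest_exponent:
  assumes "inj h" "a \<noteq> 0"
  obtains \<alpha> where "gcoeff a \<alpha> \<noteq> 0" "\<And>\<beta>. gcoeff a \<beta> \<noteq> 0 \<Longrightarrow> mdeg \<alpha> \<le> mdeg \<beta>"
    "\<And>\<beta>. gcoeff a \<beta> \<noteq> 0 \<Longrightarrow> mdeg \<beta> = mdeg \<alpha> \<Longrightarrow> renumber h \<alpha> \<le> renumber h \<beta>"
proof -
  define d where "d = (LEAST d. \<exists>\<beta>. gcoeff a \<beta> \<noteq> 0 \<and> mdeg \<beta> = d)"
  define M where "M = {\<beta>. gcoeff a \<beta> \<noteq> 0 \<and> mdeg \<beta> = d}"
  have "\<exists>\<beta>. gcoeff a \<beta> \<noteq> 0" using assms(2) by transfer (auto simp: fun_eq_iff)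
  then have "\<exists>d \<beta>. gcoeff a \<beta> \<noteq> 0 \<and> mdeg \<beta> = d" by blast
  then have "\<exists>\<beta>. gcoeff a \<beta> \<noteq> 0 \<and> mdeg \<beta> = d" unfolding d_def by (rule LeastI_ex)
  then have "M \<noteq> {}" by (auto simp: M_def)
  have "finite M" by (rule finite_subset[OF _ finite_mdeg_le[of d]]) (auto simp: M_def)
  let ?m = "Min (renumber h ` M)"
  have "?m \<in> renumber h ` M" using \<open>M \<noteq> {}\<close> \<open>finite M\<close> by (intro Min_in) auto
  then obtain \<alpha> where \<alpha>: "\<alpha> \<in> M" "renumber h \<alpha> = ?m" by auto
  show ?thesis
  proof (rule that[of \<alpha>])
    show "gcoeff a \<alpha> \<noteq> 0" using \<alpha> by (simp add: M_def)
    show "mdeg \<alpha> \<le> mdeg \<beta>" if "gcoeff a \<beta> \<noteq> 0" for \<beta>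
    proof -
      have "d \<le> mdeg \<beta>" unfolding d_def using that by (auto intro: Least_le)
      then show ?thesis using \<alpha> by (simp add: M_def)
    qed
    show "renumber h \<alpha> \<le> renumber h \<beta>" if "gcoeff a \<beta> \<noteq> 0" "mdeg \<beta> = mdeg \<alpha>" for \<beta>
    proof -
      have "\<beta> \<in> M" using that \<alpha> by (simp add: M_def)
      then show ?thesis unfolding \<alpha>(2) using \<open>finite M\<close> by (intro Min_le) auto
    qed
  qed
qed

instance germ :: (finite) idom
proof
  fix a b :: "'a germ"
  assume "a \<noteq> 0" "b \<noteq> 0"
  obtain h :: "'a \<Rightarrow> nat" where h: "inj h"
    using finite_imp_inj_to_nat_seg[OF finite[of UNIV]] by blast
  obtain \<alpha> where \<alpha>: "gcoeff a \<alpha> \<noteq> 0" "\<And>\<beta>. gcoeff a \<beta> \<noteq> 0 \<Longrightarrow> mdeg \<alpha> \<le> mdeg \<beta>"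
    "\<And>\<beta>. gcoeff a \<beta> \<noteq> 0 \<Longrightarrow> mdeg \<beta> = mdeg \<alpha> \<Longrightarrow> renumber h \<alpha> \<le> renumber h \<beta>"
    using lowest_exponent[OF h \<open>a \<noteq> 0\<close>] by blast
  obtain \<beta> where \<beta>: "gcoeff b \<beta> \<noteq> 0" "\<And>\<gamma>. gcoeff b \<gamma> \<noteq> 0 \<Longrightarrow> mdeg \<beta> \<le> mdeg \<gamma>"
    "\<And>\<gamma>. gcoeff b \<gamma> \<noteq> 0 \<Longrightarrow> mdeg \<gamma> = mdeg \<beta> \<Longrightarrow> renumber h \<beta> \<le> renumber h \<gamma>"
    using lowest_exponent[OF h \<open>b \<noteq> 0\<close>] by blast
  have uniq: "\<gamma> = \<alpha> \<and> \<delta> = \<beta>"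
    if eq: "\<gamma> + \<delta> = \<alpha> + \<beta>" and nz: "gcoeff a \<gamma> \<noteq> 0" "gcoeff b \<delta> \<noteq> 0" for \<gamma> \<delta>
  proof -
    have "mdeg \<gamma> + mdeg \<delta> = mdeg \<alpha> + mdeg \<beta>" by (metis eq mdeg_add)
    then have d: "mdeg \<gamma> = mdeg \<alpha>" "mdeg \<delta> = mdeg \<beta>"
      using \<alpha>(2)[OF nz(1)] \<beta>(2)[OF nz(2)] by linarith+
    have le: "renumber h \<alpha> \<le> renumber h \<gamma>" "renumber h \<beta> \<le> renumber h \<delta>"
      using \<alpha>(3)[OF nz(1) d(1)] \<beta>(3)[OF nz(2) d(2)] by auto
    have sum: "renumber h \<gamma> + renumber h \<delta> = renumber h \<alpha> + renumber h \<beta>"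
      by (metis eq renumber_add)
    have "renumber h \<gamma> = renumber h \<alpha>"
    proof (rule ccontr)
      assume "renumber h \<gamma> \<noteq> renumber h \<alpha>"
      then have "renumber h \<alpha> + renumber h \<beta> < renumber h \<gamma> + renumber h \<delta>"
        using le by (intro add_less_le_mono) auto
      then show False using sum by simp
    qed
    then have "\<gamma> = \<alpha>" using inj_renumber[OF h] by (simp add: inj_eq)
    then show ?thesis using eq by simp
  qed
  have "gcoeff (a * b) (\<alpha> + \<beta>) = (\<Sum>(\<gamma>, \<delta>)\<in>splits (\<alpha> + \<beta>). gcoeff a \<gamma> * gcoeff b \<delta>)"
    by (simp add: times_germ.rep_eq)
  also have "\<dots> = (\<Sum>(\<gamma>, \<delta>)\<in>{(\<alpha>, \<beta>)}. gcoeff a \<gamma> * gcoeff b \<delta>)"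
    by (rule sum.mono_neutral_right[OF finite_splits]) (auto simp: splits_def dest: uniq)
  finally have "gcoeff (a * b) (\<alpha> + \<beta>) \<noteq> 0" using \<alpha>(1) \<beta>(1) by simp
  then show "a * b \<noteq> 0" by (auto simp: zero_germ.rep_eq)
qed


lemma gcoeff_eqI: "(\<And>\<alpha>. gcoeff a \<alpha> = gcoeff b \<alpha>) \<Longrightarrow> a = b"
  by (simp add: gcoeff_inject[symmetric] fun_eq_iff)

lemma partial_add: "partial i (a + b) = partial i a + partial i b"
  by transfer (simp add: fun_eq_iff algebra_simps)

lemma partial_uminus: "partial i (- a) = - partial i a"
  by transfer (simp add: fun_eq_iff)

lemma partial_mult: "partial i (a * b) = partial i a * b + a * partial i b"
proof (rule gcoeff_eqI)
  fix \<gamma>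
  let ?e = "Poly_Mapping.single i (1::nat)"
  let ?l = "\<lambda>\<alpha>. complex_of_nat (Poly_Mapping.lookup \<alpha> i)"
  have shift: "(\<Sum>(\<alpha>, \<beta>)\<in>splits (\<gamma> + ?e). ?l \<alpha> * (c \<alpha> * d \<beta>)) =
      (\<Sum>(\<alpha>, \<beta>)\<in>splits \<gamma>. ((?l \<alpha> + 1) * c (\<alpha> + ?e)) * d \<beta>)" for c d
  proof -
    let ?T = "{x \<in> splits (\<gamma> + ?e). Poly_Mapping.lookup (fst x) i \<noteq> 0}"
    have "(\<Sum>(\<alpha>, \<beta>)\<in>splits (\<gamma> + ?e). ?l \<alpha> * (c \<alpha> * d \<beta>)) = (\<Sum>(\<alpha>, \<beta>)\<in>?T. ?l \<alpha> * (c \<alpha> * d \<beta>))"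
      by (rule sum.mono_neutral_right) auto
    also have "\<dots> = (\<Sum>(\<alpha>, \<beta>)\<in>splits \<gamma>. ((?l \<alpha> + 1) * c (\<alpha> + ?e)) * d \<beta>)"
    proof (rule sum.reindex_bij_witness[where i = "\<lambda>(\<alpha>, \<beta>). (\<alpha> + ?e, \<beta>)" and
          j = "\<lambda>(\<alpha>, \<beta>). (\<alpha> - ?e, \<beta>)"])
      fix x assume x: "x \<in> ?T"
      have e: "fst x - ?e + ?e = fst x"
        using x by (intro poly_mapping_eqI) (auto simp: lookup_add lookup_minus lookup_single when_def)
      then show "(case (case x of (\<alpha>, \<beta>) \<Rightarrow> (\<alpha> - ?e, \<beta>)) of (\<alpha>, \<beta>) \<Rightarrow> (\<alpha> + ?e, \<beta>)) = x"
        by (simp add: case_prod_unfold)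
      have "fst x - ?e + snd x + ?e = \<gamma> + ?e"
      proof -
        have "fst x - ?e + snd x + ?e = (fst x - ?e + ?e) + snd x" by (simp only: add_ac)
        also have "\<dots> = fst x + snd x" by (simp only: e)
        finally show ?thesis using x by (simp add: splits_def case_prod_unfold)
      qed
      then show "(case x of (\<alpha>, \<beta>) \<Rightarrow> (\<alpha> - ?e, \<beta>)) \<in> splits \<gamma>"
        by (simp add: splits_def case_prod_unfold)
      have "?l (fst x - ?e) + 1 = ?l (fst x)"
        using x by (simp add: lookup_minus)
      with e show "(case (case x of (\<alpha>, \<beta>) \<Rightarrow> (\<alpha> - ?e, \<beta>)) of (\<alpha>, \<beta>) \<Rightarrow>
          (?l \<alpha> + 1) * c (\<alpha> + ?e) * d \<beta>) = (case x of (\<alpha>, \<beta>) \<Rightarrow> ?l \<alpha> * (c \<alpha> * d \<beta>))"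
        by (simp add: case_prod_unfold)
    next
      fix x assume "x \<in> splits \<gamma>"
      then show "(case x of (\<alpha>, \<beta>) \<Rightarrow> (\<alpha> + ?e, \<beta>)) \<in> ?T"
        by (auto simp: splits_def lookup_add add_ac)
    qed auto
    finally show ?thesis .
  qed
  have swap: "(\<Sum>(\<alpha>, \<beta>)\<in>splits \<delta>. g \<alpha> \<beta>) = (\<Sum>(\<alpha>, \<beta>)\<in>splits \<delta>. g \<beta> \<alpha>)" for g :: "('a \<Rightarrow>\<^sub>0 nat) \<Rightarrow> ('a \<Rightarrow>\<^sub>0 nat) \<Rightarrow> complex" and \<delta>
    by (rule sum.reindex_bij_witness[where i = prod.swap and j = prod.swap])
      (auto simp: splits_def add.commute)
  let ?a = "gcoeff a" and ?b = "gcoeff b"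
  have "gcoeff (partial i (a * b)) \<gamma> =
      (\<Sum>(\<alpha>, \<beta>)\<in>splits (\<gamma> + ?e). ?l (\<gamma> + ?e) * (?a \<alpha> * ?b \<beta>))"
    by (simp add: partial.rep_eq times_germ.rep_eq sum_distrib_left case_prod_unfold lookup_add add_ac)
  also have "\<dots> = (\<Sum>(\<alpha>, \<beta>)\<in>splits (\<gamma> + ?e). ?l \<alpha> * (?a \<alpha> * ?b \<beta>) + ?l \<beta> * (?b \<beta> * ?a \<alpha>))"
  proof (rule sum.cong[OF refl], clarify)
    fix \<alpha> \<beta> assume "(\<alpha>, \<beta>) \<in> splits (\<gamma> + ?e)"
    then have "\<gamma> + ?e = \<alpha> + \<beta>" by (simp add: splits_def)
    then have "?l (\<gamma> + ?e) = ?l \<alpha> + ?l \<beta>" by (simp only: lookup_add of_nat_add)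
    then show "?l (\<gamma> + ?e) * (?a \<alpha> * ?b \<beta>) = ?l \<alpha> * (?a \<alpha> * ?b \<beta>) + ?l \<beta> * (?b \<beta> * ?a \<alpha>)"
      by (simp only: distrib_right mult.commute[of "?b \<beta>"])
  qed
  also have "\<dots> = (\<Sum>(\<alpha>, \<beta>)\<in>splits (\<gamma> + ?e). ?l \<alpha> * (?a \<alpha> * ?b \<beta>)) +
      (\<Sum>(\<alpha>, \<beta>)\<in>splits (\<gamma> + ?e). ?l \<alpha> * (?b \<alpha> * ?a \<beta>))"
    using swap[of "\<lambda>\<alpha> \<beta>. ?l \<beta> * (?b \<beta> * ?a \<alpha>)" "\<gamma> + ?e"]
    by (simp add: case_prod_unfold sum.distrib)
  also have "\<dots> = (\<Sum>(\<alpha>, \<beta>)\<in>splits \<gamma>. ((?l \<alpha> + 1) * ?a (\<alpha> + ?e)) * ?b \<beta>) +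
      (\<Sum>(\<alpha>, \<beta>)\<in>splits \<gamma>. ((?l \<beta> + 1) * ?b (\<beta> + ?e)) * ?a \<alpha>)"
    by (simp only: shift swap[of "\<lambda>\<alpha> \<beta>. (?l \<alpha> + 1) * ?b (\<alpha> + ?e) * ?a \<beta>" \<gamma>])
  also have "\<dots> = gcoeff (partial i a * b + a * partial i b) \<gamma>"
    by (simp add: partial.rep_eq times_germ.rep_eq plus_germ.rep_eq add.commute
        mult.commute[of _ "gcoeff a _"])
  finally show "gcoeff (partial i (a * b)) \<gamma> = gcoeff (partial i a * b + a * partial i b) \<gamma>" .
qed

text \<open>Quotient rule.\<close>

lift_definition partial_fract :: "'n::finite \<Rightarrow> 'n germ fract \<Rightarrow> 'n germ fract" is
  "\<lambda>i (a, b). (partial i a * b - a * partial i b, b * b)"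
proof -
  fix i :: 'n and x y :: "'n germ \<times> 'n germ"
  assume xy: "fractrel x y"
  obtain a b c d where eq: "x = (a, b)" "y = (c, d)" by fastforce
  have nz: "b \<noteq> 0" "d \<noteq> 0" and e: "a * d = c * b" using xy eq by auto
  have "partial i (a * d) = partial i (c * b)" using e by simp
  then have e': "partial i a * d + a * partial i d = partial i c * b + c * partial i b"
    by (simp add: partial_mult)
  have "(partial i a * b - a * partial i b) * (d * d) =
      (partial i a * d + a * partial i d) * (b * d) - (a * d) * (partial i d * b + partial i b * d)"
    by (simp add: algebra_simps)
  also have "\<dots> = (partial i c * b + c * partial i b) * (b * d) - (c * b) * (partial i d * b + partial i b * d)"
    by (simp only: e e')
  also have "\<dots> = (partial i c * d - c * partial i d) * (b * b)"
    by (simp add: algebra_simps)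
  finally show "fractrel (case x of (a, b) \<Rightarrow> (partial i a * b - a * partial i b, b * b))
      (case y of (a, b) \<Rightarrow> (partial i a * b - a * partial i b, b * b))"
    using nz by (simp add: eq)
qed

lemma partial_fract_Fract:
  "b \<noteq> 0 \<Longrightarrow> partial_fract i (Fract a b) = Fract (partial i a * b - a * partial i b) (b * b)"
  by transfer (simp only: if_False prod.case fractrel_iff fst_conv snd_conv mult_eq_0_iff simp_thms)

lemma partial_fract_add: "partial_fract i (p + q) = partial_fract i p + partial_fract i q"
  by (cases p; cases q)
    (simp add: partial_fract_Fract eq_fract partial_add partial_mult algebra_simps)

lemma partial_fract_mult: "partial_fract i (p * q) = partial_fract i p * q + p * partial_fract i q"
  by (cases p; cases q)
    (simp add: partial_fract_Fract eq_fract partial_mult algebra_simps)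

lemma partial_fract_0 [simp]: "partial_fract i 0 = 0"
  by (metis add_cancel_right_right partial_fract_add)

lemma partial_fract_1 [simp]: "partial_fract i 1 = 0"
  by (metis add_cancel_right_right mult.left_neutral mult.right_neutral partial_fract_mult)

definition germ_fract :: "'n::finite germ \<Rightarrow> 'n germ fract" where
  "germ_fract a = Fract a 1"

definition mpoly_fract :: "('n::finite, complex) mpoly \<Rightarrow> 'n germ fract" where
  "mpoly_fract p = germ_fract (germ_of_mpoly p)"


lemma germ_of_mpoly_add: "germ_of_mpoly (p + q) = germ_of_mpoly p + germ_of_mpoly q"
  by (rule gcoeff_eqI) (simp add: plus_germ.rep_eq lookup_add)

lemma germ_of_mpoly_mult: "germ_of_mpoly (p * q) = germ_of_mpoly p * germ_of_mpoly q"
proof (induction p rule: monomial_induct)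
  case (add p p')
  then show ?case by (simp add: distrib_right germ_of_mpoly_add)
next
  case (monom \<alpha> c)
  show ?case
  proof (induction q rule: monomial_induct)
    case (add q q')
    then show ?case by (simp add: distrib_left germ_of_mpoly_add)
  next
    case (monom \<beta> d)
    show ?case
    proof (rule gcoeff_eqI)
      fix \<gamma>
      let ?T = "{(\<alpha>, \<beta>)} \<inter> splits \<gamma>"
      have "(\<Sum>(\<alpha>', \<beta>')\<in>splits \<gamma>. (c when \<alpha> = \<alpha>') * (d when \<beta> = \<beta>')) =
          (\<Sum>(\<alpha>', \<beta>')\<in>?T. (c when \<alpha> = \<alpha>') * (d when \<beta> = \<beta>'))"
        by (rule sum.mono_neutral_right[OF finite_splits]) (auto simp: when_def split: if_splits)
      also have "\<dots> = (c * d when \<alpha> + \<beta> = \<gamma>)"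
        by (cases "\<alpha> + \<beta> = \<gamma>") (auto simp: splits_def when_def)
      finally show "gcoeff (germ_of_mpoly (Poly_Mapping.single \<alpha> c * Poly_Mapping.single \<beta> d)) \<gamma> =
          gcoeff (germ_of_mpoly (Poly_Mapping.single \<alpha> c) * germ_of_mpoly (Poly_Mapping.single \<beta> d)) \<gamma>"
        by (simp add: mult_single times_germ.rep_eq lookup_single)
    qed
  qed
qed

lemma germ_of_mpoly_0: "germ_of_mpoly 0 = 0"
  by (rule gcoeff_eqI) (simp add: zero_germ.rep_eq)

lemma germ_of_mpoly_1: "germ_of_mpoly 1 = 1"
  by (rule gcoeff_eqI) (simp add: one_germ.rep_eq lookup_one)

lemma germ_of_mpoly_eq_0_iff: "germ_of_mpoly p = 0 \<longleftrightarrow> p = 0"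
  by (metis gcoeff_germ_of_mpoly germ_of_mpoly_0 lookup_inject)

lemma germ_fract_add: "germ_fract (a + b) = germ_fract a + germ_fract b"
  by (simp add: germ_fract_def)

lemma germ_fract_mult: "germ_fract (a * b) = germ_fract a * germ_fract b"
  by (simp add: germ_fract_def)

lemma mpoly_fract_0 [simp]: "mpoly_fract 0 = 0"
  by (simp add: mpoly_fract_def germ_fract_def germ_of_mpoly_0 Zero_fract_def)

lemma mpoly_fract_1 [simp]: "mpoly_fract 1 = 1"
  by (simp add: mpoly_fract_def germ_fract_def germ_of_mpoly_1 One_fract_def)

lemma mpoly_fract_add: "mpoly_fract (p + q) = mpoly_fract p + mpoly_fract q"
  by (simp add: mpoly_fract_def germ_fract_add germ_of_mpoly_add)

lemma mpoly_fract_mult: "mpoly_fract (p * q) = mpoly_fract p * mpoly_fract q"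
  by (simp add: mpoly_fract_def germ_fract_mult germ_of_mpoly_mult)

lemma mpoly_fract_prod: "mpoly_fract (\<Prod>k\<in>A. p k) = (\<Prod>k\<in>A. mpoly_fract (p k))"
  by (induction A rule: infinite_finite_induct) (simp_all add: mpoly_fract_mult)

lemma mpoly_fract_eq_0_iff: "mpoly_fract p = 0 \<longleftrightarrow> p = 0"
  by (simp add: mpoly_fract_def germ_fract_def Zero_fract_def eq_fract germ_of_mpoly_eq_0_iff)

lemma partial_fract_const: "partial_fract i (mpoly_fract (const c)) = 0"
proof -
  have "partial i (germ_of_mpoly (const c)) = 0"
  proof (rule gcoeff_eqI)
    fix \<alpha> :: "'a \<Rightarrow>\<^sub>0 nat"
    have "\<alpha> + Poly_Mapping.single i 1 \<noteq> 0"
    proof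
      assume "\<alpha> + Poly_Mapping.single i 1 = 0"
      then have "Poly_Mapping.lookup (\<alpha> + Poly_Mapping.single i 1) i = 0" by simp
      then show False by (simp add: lookup_add)
    qed
    then show "gcoeff (partial i (germ_of_mpoly (const c))) \<alpha> = gcoeff 0 \<alpha>"
      by (simp add: partial.rep_eq zero_germ.rep_eq const_def lookup_single when_def)
  qed
  moreover have "partial i 1 = (0 :: 'a germ)"
    by (metis add_cancel_right_right mult.left_neutral mult.right_neutral partial_mult)
  ultimately show ?thesis
    by (simp add: mpoly_fract_def germ_fract_def partial_fract_Fract Zero_fract_def)
qed

lemma partial_fract_prod:
  assumes "finite A" "\<And>k. k \<in> A \<Longrightarrow> q k \<noteq> 0"
  shows "partial_fract i (\<Prod>k\<in>A. q k) = (\<Prod>k\<in>A. q k) * (\<Sum>k\<in>A. partial_fract i (q k) / q k)"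
  using assms
proof (induction A)
  case (insert x A)
  then have "partial_fract i (\<Prod>k\<in>insert x A. q k) = partial_fract i (q x) * (\<Prod>k\<in>A. q k) +
      q x * ((\<Prod>k\<in>A. q k) * (\<Sum>k\<in>A. partial_fract i (q k) / q k))"
    by (simp add: partial_fract_mult)
  also have "partial_fract i (q x) = q x * (partial_fract i (q x) / q x)"
    using insert.prems by simp
  finally show ?case using insert.hyps by (simp only: prod.insert sum.insert) (simp add: algebra_simps)
qed simp


section \<open>Free central arrangements\<close>

definition linear_form :: "complex ^ 'n::finite \<Rightarrow> ('n, complex) mpoly" where
  "linear_form v = (\<Sum>i\<in>UNIV. const (v $ i) * var i)"

definition central_reduced_arrangement :: "('n::finite, complex) mpoly \<Rightarrow> bool" where
  "central_reduced_arrangement f \<longleftrightarrow>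
     (\<exists>vs. f = (\<Prod>v\<leftarrow>vs. linear_form v) \<and> 0 \<notin> set vs \<and>
        (\<forall>i<length vs. \<forall>j<length vs. i \<noteq> j \<longrightarrow> \<not> (\<exists>c. vs ! i = c *s vs ! j)))"

text \<open>The \<open>\<complex>\<close>-derivations of the polynomial ring that preserve the ideal generated by \<open>f\<close>.\<close>

definition log_derivations ::
    "('n::finite, complex) mpoly \<Rightarrow> (('n, complex) mpoly \<Rightarrow> ('n, complex) mpoly) set" where
  "log_derivations f =
     {\<delta>. (\<forall>p q. \<delta> (p + q) = \<delta> p + \<delta> q) \<and> (\<forall>c p. \<delta> (const c * p) = const c * \<delta> p) \<and>
         (\<forall>p q. \<delta> (p * q) = \<delta> p * q + p * \<delta> q) \<and> f dvd \<delta> f}"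

definition der_scale ::
    "('n::finite, complex) mpoly \<Rightarrow> (('n, complex) mpoly \<Rightarrow> ('n, complex) mpoly) \<Rightarrow>
     ('n, complex) mpoly \<Rightarrow> ('n, complex) mpoly" where
  "der_scale p \<delta> = (\<lambda>q. p * \<delta> q)"

lemma module_der_scale: "module der_scale"
  by unfold_locales (simp_all add: der_scale_def fun_eq_iff algebra_simps)

lemma subspace_log_derivations: "module.subspace der_scale (log_derivations f)"
  unfolding module.subspace_def[OF module_der_scale] log_derivations_def der_scale_def
  by (auto simp: algebra_simps)

definition free_arrangement :: "('n::finite, complex) mpoly \<Rightarrow> bool" where
  "free_arrangement f \<longleftrightarrow>
     (\<exists>E. \<not> module.dependent der_scale E \<and> module.span der_scale E = log_derivations f)"


section \<open>The module generated by the symbol \<open>F\<^sup>S\<close>\<close>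

text \<open>
  The variables \<open>s\<^sub>k\<close> are indexed by \<open>'r\<close>. An element \<open>h F\<^sup>S\<close> is encoded by its coefficient \<open>h\<close>, so
  that \<open>F\<^sup>S\<close> itself is \<open>1\<close>. For convenience \<open>h\<close> is allowed to have arbitrary germs of meromorphic
  functions as coefficients. This contains the germs with a power of \<open>f\<close> as denominator as a
  submodule, and that submodule contains everything generated below.
\<close>

type_synonym ('n, 'r) FS = "('r, 'n germ fract) mpoly"

definition partial_coeffs :: "'n::finite \<Rightarrow> ('n, 'r) FS \<Rightarrow> ('n, 'r) FS" where
  "partial_coeffs i h = Poly_Mapping.map (partial_fract i) h"

definition partial_FS ::
    "('r::finite \<Rightarrow> ('n::finite, complex) mpoly) \<Rightarrow> 'n \<Rightarrow> ('n, 'r) FS \<Rightarrow> ('n, 'r) FS" where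
  "partial_FS F i h = partial_coeffs i h +
     h * (\<Sum>k\<in>UNIV. const (partial_fract i (mpoly_fract (F k)) / mpoly_fract (F k)) * var k)"

text \<open>
  The operators by which elements of \<open>\<D>[S]\<close> act: \<open>\<D>[S]\<close> is generated as a ring by the analytic
  germs, the partial derivatives and the variables \<open>s\<^sub>k\<close>.
\<close>

inductive_set diffops ::
    "('r::finite \<Rightarrow> ('n::finite, complex) mpoly) \<Rightarrow> (('n, 'r) FS \<Rightarrow> ('n, 'r) FS) set"
  for F where
  germ: "(\<lambda>h. const (germ_fract a) * h) \<in> diffops F"
| partial: "partial_FS F i \<in> diffops F"
| var: "(\<lambda>h. var k * h) \<in> diffops F"
| add: "P \<in> diffops F \<Longrightarrow> Q \<in> diffops F \<Longrightarrow> (\<lambda>h. P h + Q h) \<in> diffops F"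
| comp: "P \<in> diffops F \<Longrightarrow> Q \<in> diffops F \<Longrightarrow> (\<lambda>h. P (Q h)) \<in> diffops F"

definition generated_by ::
    "('r::finite \<Rightarrow> ('n::finite, complex) mpoly) \<Rightarrow> ('n, 'r) FS \<Rightarrow> ('n, 'r) FS set" where
  "generated_by F g = {P g |P. P \<in> diffops F}"

abbreviation DFS :: "('r::finite \<Rightarrow> ('n::finite, complex) mpoly) \<Rightarrow> ('n, 'r) FS set" where
  "DFS F \<equiv> generated_by F 1"

definition prod_F :: "('r::finite \<Rightarrow> ('n::finite, complex) mpoly) \<Rightarrow> ('n, complex) mpoly" where
  "prod_F F = (\<Prod>k\<in>UNIV. F k)"

definition f_FS :: "('r::finite \<Rightarrow> ('n::finite, complex) mpoly) \<Rightarrow> ('n, 'r) FS" where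
  "f_FS F = const (mpoly_fract (prod_F F))"

definition scalar :: "complex \<Rightarrow> ('n::finite, 'r) FS" where
  "scalar c = const (mpoly_fract (const c))"

definition bernstein_sato_ideal ::
    "('r::finite \<Rightarrow> ('n::finite, complex) mpoly) \<Rightarrow> ('r, complex) mpoly set" where
  "bernstein_sato_ideal F = {B. mpoly_subst scalar var B \<in> generated_by F (f_FS F)}"

definition zero_locus :: "('r::finite, complex) mpoly set \<Rightarrow> (complex ^ 'r) set" where
  "zero_locus I = {a. \<forall>B\<in>I. mpoly_subst (\<lambda>c. c) (\<lambda>k. a $ k) B = 0}"


section \<open>Specialization and the map \<open>\<nabla>\<close>\<close>

definition S_minus :: "complex ^ 'r \<Rightarrow> ('n::finite, 'r::finite) FS set \<Rightarrow> ('n, 'r) FS set" where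
  "S_minus A M = {\<Sum>k\<in>UNIV. (var k - scalar (A $ k)) * m k |m. \<forall>k. m k \<in> M}"

definition cong_S_minus ::
    "complex ^ 'r \<Rightarrow> ('n::finite, 'r::finite) FS set \<Rightarrow> (('n, 'r) FS \<times> ('n, 'r) FS) set" where
  "cong_S_minus A M = {(u, v). u \<in> M \<and> v \<in> M \<and> u - v \<in> S_minus A M}"

text \<open>The quotient of \<open>\<D>[S]F\<^sup>S\<close> by \<open>(S - A)\<D>[S]F\<^sup>S\<close>, as a set of residue classes.\<close>

definition specialization ::
    "('r::finite \<Rightarrow> ('n::finite, complex) mpoly) \<Rightarrow> complex ^ 'r \<Rightarrow> ('n, 'r) FS set set" where
  "specialization F A = DFS F // cong_S_minus A (DFS F)"

text \<open>\<open>h(S) F\<^sup>S\<close> is sent to \<open>h(S + 1) F\<^bsup>S + 1\<^esup> = h(S + 1) f F\<^sup>S\<close>.\<close>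
definition nabla :: "('r::finite \<Rightarrow> ('n::finite, complex) mpoly) \<Rightarrow> ('n, 'r) FS \<Rightarrow> ('n, 'r) FS" where
  "nabla F h = mpoly_subst const (\<lambda>k. var k + 1) h * f_FS F"

definition nabla_spec ::
    "('r::finite \<Rightarrow> ('n::finite, complex) mpoly) \<Rightarrow> complex ^ 'r \<Rightarrow> ('n, 'r) FS set \<Rightarrow> ('n, 'r) FS set" where
  "nabla_spec F A X = (\<Union>u\<in>X. cong_S_minus (A - 1) (DFS F) `` {nabla F u})"


text \<open>
  The operators in \<open>\<D>[S]\<close> commute with the \<open>s\<^sub>k\<close>, and \<open>\<nabla>\<close> induces a map on the quotients.
\<close>

lemma partial_coeffs_lookup:
  "Poly_Mapping.lookup (partial_coeffs i h) \<beta> = partial_fract i (Poly_Mapping.lookup h \<beta>)"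
  by (simp add: partial_coeffs_def Poly_Mapping.map.rep_eq when_def)

lemma partial_coeffs_add: "partial_coeffs i (g + h) = partial_coeffs i g + partial_coeffs i h"
  by (rule poly_mapping_eqI) (simp add: partial_coeffs_lookup lookup_add partial_fract_add)

lemma partial_coeffs_0: "partial_coeffs i 0 = 0"
  by (rule poly_mapping_eqI) (simp add: partial_coeffs_lookup)

lemma partial_coeffs_single:
  "partial_coeffs i (Poly_Mapping.single \<beta> c) = Poly_Mapping.single \<beta> (partial_fract i c)"
  by (rule poly_mapping_eqI) (simp add: partial_coeffs_lookup lookup_single when_def)

lemma partial_coeffs_mult:
  "partial_coeffs i (g * h) = partial_coeffs i g * h + g * partial_coeffs i h"
proof (induction g rule: monomial_induct)
  case (add p p')
  then show ?case by (simp add: distrib_right partial_coeffs_add)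
next
  case (monom \<alpha> c)
  show ?case
  proof (induction h rule: monomial_induct)
    case (add q q')
    then show ?case by (simp add: distrib_left partial_coeffs_add)
  next
    case (monom \<beta> d)
    show ?case
      by (simp add: mult_single partial_coeffs_single partial_fract_mult single_add)
  qed
qed

lemma partial_coeffs_const: "partial_coeffs i (const c) = const (partial_fract i c)"
  by (simp add: const_def partial_coeffs_single)

lemma partial_coeffs_var: "partial_coeffs i (var k) = 0"
  by (simp add: var_def partial_coeffs_single)

lemma partial_coeffs_1: "partial_coeffs i 1 = 0"
  using partial_coeffs_const[of i 1] by simp

lemma partial_coeffs_scalar: "partial_coeffs i (scalar c) = 0"
  by (simp add: scalar_def partial_coeffs_const partial_fract_const)

lemma partial_coeffs_var_diff: "partial_coeffs i (var k - scalar c) = 0"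
proof -
  have "partial_coeffs i (var k - scalar c) + partial_coeffs i (scalar c) = partial_coeffs i (var k)"
    by (simp only: diff_add_cancel flip: partial_coeffs_add)
  then show ?thesis by (simp add: partial_coeffs_var partial_coeffs_scalar)
qed

lemma partial_coeffs_power: "partial_coeffs i h = 0 \<Longrightarrow> partial_coeffs i (h ^ m) = 0"
  by (induction m) (simp_all add: partial_coeffs_1 partial_coeffs_mult)

lemma partial_coeffs_prod:
  "(\<And>k. k \<in> A \<Longrightarrow> partial_coeffs i (h k) = 0) \<Longrightarrow> partial_coeffs i (\<Prod>k\<in>A. h k) = 0"
  by (induction A rule: infinite_finite_induct) (simp_all add: partial_coeffs_1 partial_coeffs_mult)

interpretation const_hom: coeff_hom "const :: 'a::comm_semiring_1 \<Rightarrow> ('v::finite, 'a) mpoly"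
  by unfold_locales (simp_all add: const_add const_mult)

lemma partial_coeffs_shift:
  "partial_coeffs i (mpoly_subst const (\<lambda>k. var k + 1) h) =
     mpoly_subst const (\<lambda>k. var k + 1) (partial_coeffs i h)"
proof (induction h rule: monomial_induct)
  case (add p q)
  then show ?case by (simp add: const_hom.subst_add partial_coeffs_add)
next
  case (monom \<beta> c)
  have "partial_coeffs i (\<Prod>k\<in>UNIV. (var k + 1) ^ Poly_Mapping.lookup \<beta> k) = 0"
    by (intro partial_coeffs_prod partial_coeffs_power)
      (simp add: partial_coeffs_add partial_coeffs_var partial_coeffs_1)
  then show ?case
    by (simp add: mpoly_subst_single partial_coeffs_single partial_coeffs_mult partial_coeffs_const)
qed

lemma partial_FS_add: "partial_FS F i (g + h) = partial_FS F i g + partial_FS F i h"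
  by (simp add: partial_FS_def partial_coeffs_add algebra_simps)

lemma partial_FS_mult:
  "partial_coeffs i c = 0 \<Longrightarrow> partial_FS F i (c * h) = c * partial_FS F i h"
  by (simp add: partial_FS_def partial_coeffs_mult algebra_simps)

lemma diffops_add: "P \<in> diffops F \<Longrightarrow> P (g + h) = P g + P h"
  by (induction arbitrary: g h rule: diffops.induct) (simp_all add: partial_FS_add algebra_simps)

lemma diffops_mult:
  assumes "P \<in> diffops F" "\<And>i. partial_coeffs i c = 0"
  shows "P (c * h) = c * P h"
  using assms(1)
  by (induction arbitrary: h rule: diffops.induct)
    (simp_all add: partial_FS_mult assms(2) distrib_left mult.left_commute)

lemma generated_by_diffop: "P \<in> diffops F \<Longrightarrow> h \<in> generated_by F g \<Longrightarrow> P h \<in> generated_by F g"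
  unfolding generated_by_def by (auto dest: diffops.comp)

lemma generated_by_add:
  "u \<in> generated_by F g \<Longrightarrow> v \<in> generated_by F g \<Longrightarrow> u + v \<in> generated_by F g"
  unfolding generated_by_def by (auto dest: diffops.add)

lemma generated_by_germ: "h \<in> generated_by F g \<Longrightarrow> const (germ_fract a) * h \<in> generated_by F g"
  by (rule generated_by_diffop[OF diffops.germ])

lemma generated_by_0: "0 \<in> generated_by F g"
proof -
  have "(\<lambda>h. const (germ_fract 0) * h) \<in> diffops F" by (rule diffops.germ)
  moreover have "germ_fract (0 :: 'b germ) = 0" by (simp add: germ_fract_def Zero_fract_def)
  ultimately have "(\<lambda>h. 0) \<in> diffops F" by simp
  then show ?thesis unfolding generated_by_def by auto
qed

lemma generated_by_uminus: "h \<in> generated_by F g \<Longrightarrow> - h \<in> generated_by F g"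
proof -
  assume "h \<in> generated_by F g"
  then have "const (germ_fract (- 1)) * h \<in> generated_by F g" by (rule generated_by_germ)
  moreover have "const (germ_fract (- 1)) = (- 1 :: ('b, 'a) FS)"
  proof -
    have "germ_fract (- 1) = (- 1 :: 'b germ fract)"
      by (simp add: germ_fract_def One_fract_def)
    then have "const (germ_fract (- 1)) = (const (0 - 1) :: ('b, 'a) FS)" by simp
    then show ?thesis by (simp only: const_diff) simp
  qed
  ultimately show ?thesis by simp
qed

lemma generated_by_self: "g \<in> generated_by F g"
proof -
  have "(\<lambda>h. const (germ_fract 1) * h) \<in> diffops F" by (rule diffops.germ)
  then have "(\<lambda>h. h) \<in> diffops F" by (simp add: germ_fract_def flip: One_fract_def)
  then show ?thesis unfolding generated_by_def by auto
qed

lemma generated_by_S_minus: "h \<in> generated_by F g \<Longrightarrow> (var k - scalar c) * h \<in> generated_by F g"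
  unfolding scalar_def mpoly_fract_def diff_conv_add_uminus distrib_right mult_minus_left
  by (intro generated_by_add generated_by_uminus generated_by_germ
      generated_by_diffop[OF diffops.var])

lemma S_minusI:
  "(\<And>k. m k \<in> M) \<Longrightarrow> h = (\<Sum>k\<in>UNIV. (var k - scalar (A $ k)) * m k) \<Longrightarrow> h \<in> S_minus A M"
  unfolding S_minus_def by blast

lemma S_minusE:
  assumes "h \<in> S_minus A M"
  obtains m where "h = (\<Sum>k\<in>UNIV. (var k - scalar (A $ k)) * m k)" "\<And>k. m k \<in> M"
  using assms unfolding S_minus_def by blast

lemma S_minus_subset: "S_minus A (generated_by F g) \<subseteq> generated_by F g"
proof
  fix h assume "h \<in> S_minus A (generated_by F g)"
  then obtain m where m: "h = (\<Sum>k\<in>UNIV. (var k - scalar (A $ k)) * m k)" "\<And>k. m k \<in> generated_by F g"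
    unfolding S_minus_def by blast
  have "(\<Sum>k\<in>B. (var k - scalar (A $ k)) * m k) \<in> generated_by F g" for B
    using m(2)
    by (induction B rule: infinite_finite_induct)
      (auto intro: generated_by_0 generated_by_add generated_by_S_minus)
  then show "h \<in> generated_by F g" by (simp add: m)
qed

lemma S_minus_add:
  assumes "u \<in> S_minus A (generated_by F g)" "v \<in> S_minus A (generated_by F g)"
  shows "u + v \<in> S_minus A (generated_by F g)"
  using assms
  by (elim S_minusE, intro S_minusI[where m = "\<lambda>k. _ k + _ k"])
    (auto simp: distrib_left sum.distrib intro: generated_by_add)

lemma S_minus_diffop:
  assumes "P \<in> diffops F" "u \<in> S_minus A (generated_by F g)"
  shows "P u \<in> S_minus A (generated_by F g)"
proof -
  obtain m where m: "u = (\<Sum>k\<in>UNIV. (var k - scalar (A $ k)) * m k)" "\<And>k. m k \<in> generated_by F g"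
    using assms(2) unfolding S_minus_def by blast
  have P0: "P 0 = 0"
    using diffops_add[OF assms(1), of 0 0] by simp
  have "P (\<Sum>k\<in>B. (var k - scalar (A $ k)) * m k) = (\<Sum>k\<in>B. (var k - scalar (A $ k)) * P (m k))" for B
    by (induction B rule: infinite_finite_induct)
      (simp_all add: P0 diffops_add[OF assms(1)] diffops_mult[OF assms(1) partial_coeffs_var_diff])
  then show ?thesis
    unfolding S_minus_def m(1) using generated_by_diffop[OF assms(1) m(2)]
    by (auto intro!: exI[of _ "\<lambda>k. P (m k)"])
qed

lemma S_minus_uminus:
  "u \<in> S_minus A (generated_by F g) \<Longrightarrow> - u \<in> S_minus A (generated_by F g)"
  by (elim S_minusE, rule S_minusI[where m = "\<lambda>k. - _ k"])
    (auto simp: sum_negf intro: generated_by_uminus)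

lemma S_minus_0: "0 \<in> S_minus A (generated_by F g)"
  unfolding S_minus_def by (auto intro!: exI[of _ "\<lambda>_. 0"] generated_by_0)

lemma equiv_cong_S_minus: "equiv (DFS F) (cong_S_minus A (DFS F))"
proof (rule equivI)
  show "cong_S_minus A (DFS F) \<subseteq> DFS F \<times> DFS F" by (auto simp: cong_S_minus_def)
  show "refl_on (DFS F) (cong_S_minus A (DFS F))"
    by (auto simp: refl_on_def cong_S_minus_def S_minus_0)
  show "sym (cong_S_minus A (DFS F))"
    by (rule symI) (auto simp: cong_S_minus_def dest: S_minus_uminus)
  show "trans (cong_S_minus A (DFS F))"
  proof (rule transI)
    fix u v w assume "(u, v) \<in> cong_S_minus A (DFS F)" "(v, w) \<in> cong_S_minus A (DFS F)"
    then show "(u, w) \<in> cong_S_minus A (DFS F)"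
      using S_minus_add[of "u - v" A F 1 "v - w"] by (auto simp: cong_S_minus_def)
  qed
qed

lemma nabla_add: "nabla F (g + h) = nabla F g + nabla F h"
  by (simp add: nabla_def const_hom.subst_add algebra_simps)

lemma nabla_0: "nabla F 0 = 0"
  by (simp add: nabla_def const_hom.subst_0)

lemma nabla_diff: "nabla F (g - h) = nabla F g - nabla F h"
  using nabla_add[of F "g - h" h] by simp

lemma nabla_1: "nabla F 1 = f_FS F"
  by (simp add: nabla_def const_hom.subst_1)

lemma nabla_const_mult: "nabla F (const c * h) = const c * nabla F h"
  by (simp add: nabla_def const_hom.subst_mult const_hom.subst_const mult.assoc)

lemma nabla_var_mult: "nabla F (var k * h) = (var k + 1) * nabla F h"
  by (simp add: nabla_def const_hom.subst_mult const_hom.subst_var mult.assoc)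

lemma nabla_partial_FS:
  assumes "prod_F F \<noteq> 0"
  shows "nabla F (partial_FS F i h) = partial_FS F i (nabla F h)"
proof -
  define \<sigma> :: "('a, 'b) FS \<Rightarrow> ('a, 'b) FS" where "\<sigma> = mpoly_subst const (\<lambda>k. var k + 1)"
  define c where "c = (\<lambda>k. partial_fract i (mpoly_fract (F k)) / mpoly_fract (F k))"
  have "F k \<noteq> 0" for k
  proof
    assume "F k = 0"
    then have "prod_F F = 0"
      unfolding prod_F_def by (subst prod.remove[of _ k]) auto
    then show False using assms by simp
  qed
  then have "partial_fract i (mpoly_fract (prod_F F)) = mpoly_fract (prod_F F) * (\<Sum>k\<in>UNIV. c k)"
    unfolding prod_F_def mpoly_fract_prod c_def
    by (intro partial_fract_prod) (auto simp: mpoly_fract_eq_0_iff)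
  moreover have "const (\<Sum>k\<in>B. c k) = (\<Sum>k\<in>B. const (c k) :: ('a, 'b) FS)" for B
    by (induction B rule: infinite_finite_induct) (simp_all add: const_add)
  ultimately have df: "partial_coeffs i (f_FS F) = f_FS F * (\<Sum>k\<in>UNIV. const (c k))"
    by (simp add: f_FS_def partial_coeffs_const const_mult)
  have sum: "\<sigma> (\<Sum>k\<in>B. const (c k) * var k) = (\<Sum>k\<in>B. const (c k) * (var k + 1))" for B
    unfolding \<sigma>_def
    by (induction B rule: infinite_finite_induct)
      (simp_all add: const_hom.subst_0 const_hom.subst_add const_hom.subst_mult
        const_hom.subst_const const_hom.subst_var)
  have "nabla F (partial_FS F i h) =
      (partial_coeffs i (\<sigma> h) + \<sigma> h * (\<Sum>k\<in>UNIV. const (c k) * (var k + 1))) * f_FS F"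
    unfolding nabla_def partial_FS_def \<sigma>_def[symmetric] c_def[symmetric] sum[symmetric]
    by (simp add: \<sigma>_def partial_coeffs_shift const_hom.subst_add const_hom.subst_mult c_def)
  also have "\<dots> = partial_FS F i (nabla F h)"
    unfolding nabla_def partial_FS_def \<sigma>_def[symmetric] partial_coeffs_mult df
    by (simp add: c_def algebra_simps sum.distrib)
  finally show ?thesis .
qed

lemma nabla_diffop:
  assumes "prod_F F \<noteq> 0" "P \<in> diffops F"
  shows "\<exists>Q\<in>diffops F. \<forall>h. nabla F (P h) = Q (nabla F h)"
  using assms(2)
proof induction
  case (germ a)
  show ?case by (intro bexI[OF _ diffops.germ[of a]]) (simp add: nabla_const_mult)
next
  case (partial i)
  show ?case by (intro bexI[OF _ diffops.partial[of F i]]) (simp add: nabla_partial_FS assms(1))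
next
  case (var k)
  show ?case
    by (intro bexI[OF _ diffops.add[OF diffops.var[of k] diffops.germ[of 1]]])
      (simp add: nabla_var_mult distrib_right germ_fract_def flip: One_fract_def)
next
  case (add P Q)
  then obtain P' Q' where *: "P' \<in> diffops F" "\<forall>h. nabla F (P h) = P' (nabla F h)"
    "Q' \<in> diffops F" "\<forall>h. nabla F (Q h) = Q' (nabla F h)" by blast
  show ?case by (intro bexI[OF _ diffops.add[OF *(1,3)]]) (simp add: nabla_add *)
next
  case (comp P Q)
  then obtain P' Q' where *: "P' \<in> diffops F" "\<forall>h. nabla F (P h) = P' (nabla F h)"
    "Q' \<in> diffops F" "\<forall>h. nabla F (Q h) = Q' (nabla F h)" by blast
  show ?case by (intro bexI[OF _ diffops.comp[OF *(1,3)]]) (simp add: *)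
qed

lemma nabla_in_DFS:
  assumes "prod_F F \<noteq> 0" "h \<in> DFS F"
  shows "nabla F h \<in> DFS F"
proof -
  obtain P where "P \<in> diffops F" "h = P 1" using assms(2) by (auto simp: generated_by_def)
  with nabla_diffop[OF assms(1)] obtain Q where "Q \<in> diffops F" "nabla F h = Q (f_FS F)"
    by (metis nabla_1)
  moreover have "f_FS F \<in> DFS F"
    using generated_by_germ[OF generated_by_self[of 1 F], of "germ_of_mpoly (prod_F F)"]
    by (simp add: f_FS_def mpoly_fract_def)
  ultimately show ?thesis by (simp add: generated_by_diffop)
qed

lemma scalar_diff_1: "scalar (c - 1) = scalar c - 1"
proof -
  have "scalar (c - 1) + scalar 1 = scalar (c - 1 + 1)"
    unfolding scalar_def by (simp only: const_add mpoly_fract_add)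
  then show ?thesis by (simp add: scalar_def algebra_simps)
qed

lemma nabla_S_minus:
  assumes "prod_F F \<noteq> 0" "h \<in> S_minus A (DFS F)"
  shows "nabla F h \<in> S_minus (A - 1) (DFS F)"
proof -
  obtain m where m: "h = (\<Sum>k\<in>UNIV. (var k - scalar (A $ k)) * m k)" "\<And>k. m k \<in> DFS F"
    using assms(2) unfolding S_minus_def by blast
  have mult: "nabla F ((var k - scalar c) * u) = (var k - scalar (c - 1)) * nabla F u" for k c u
  proof -
    have "nabla F (scalar c * u) = scalar c * nabla F u"
      by (simp only: scalar_def nabla_const_mult)
    then show ?thesis
      by (simp only: left_diff_distrib nabla_diff nabla_var_mult scalar_diff_1) (simp add: algebra_simps)
  qed
  have "nabla F (\<Sum>k\<in>B. (var k - scalar (A $ k)) * m k) =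
      (\<Sum>k\<in>B. (var k - scalar ((A - 1) $ k)) * nabla F (m k))" for B
    by (induction B rule: infinite_finite_induct) (simp_all add: nabla_0 nabla_add mult)
  then show ?thesis
    unfolding S_minus_def m(1) using nabla_in_DFS[OF assms(1) m(2)]
    by (auto intro!: exI[of _ "\<lambda>k. nabla F (m k)"])
qed

lemma nabla_spec_class:
  assumes "prod_F F \<noteq> 0" "u \<in> DFS F"
  shows "nabla_spec F A (cong_S_minus A (DFS F) `` {u}) = cong_S_minus (A - 1) (DFS F) `` {nabla F u}"
  unfolding nabla_spec_def
proof (rule UN_equiv_class[OF equiv_cong_S_minus _ assms(2)])
  show "(\<lambda>u. cong_S_minus (A - 1) (DFS F) `` {nabla F u}) respects cong_S_minus A (DFS F)"
  proof (rule congruentI)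
    fix u v assume "(u, v) \<in> cong_S_minus A (DFS F)"
    then have "(nabla F u, nabla F v) \<in> cong_S_minus (A - 1) (DFS F)"
      using nabla_S_minus[OF assms(1), of "u - v" A] nabla_in_DFS[OF assms(1)]
      by (auto simp: cong_S_minus_def nabla_diff)
    then show "cong_S_minus (A - 1) (DFS F) `` {nabla F u} = cong_S_minus (A - 1) (DFS F) `` {nabla F v}"
      by (rule equiv_class_eq[OF equiv_cong_S_minus])
  qed
qed

lemma nabla_spec_in:
  assumes "prod_F F \<noteq> 0" "X \<in> specialization F A"
  shows "nabla_spec F A X \<in> specialization F (A - 1)"
  using assms(2) unfolding specialization_def
  by (auto elim!: quotientE simp: nabla_spec_class[OF assms(1)]
      intro!: quotientI nabla_in_DFS[OF assms(1)])

end

theory Submission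
  imports Defs "HOL-Computational_Algebra.Polynomial"
begin

text \<open>
  Write \<open>a = A - 1\<close> and \<open>M = \<D>[S]F\<^sup>S / \<D>[S]f F\<^sup>S\<close>, and suppose that \<open>M = (S - a) M\<close>. One has to find
  \<open>B\<close> with \<open>B(a) \<noteq> 0\<close> and \<open>B M = 0\<close>, which would be Nakayama's lemma if \<open>M\<close> were finitely generated
  over \<open>\<complex>[S]\<close>. By homogeneity the germs in the relation \<open>M = (S - a) M\<close> can be replaced by polynomials.
  Then one argues by induction on subspaces \<open>W\<close> of linear forms, i.e. along the flats of the
  arrangement, after inverting all forms outside of \<open>W\<close> and all \<open>B\<close> with \<open>B(a) \<noteq> 0\<close>. The hypothesis
  for proper subspaces of \<open>W\<close> says that \<open>M\<close> is supported on the flat \<open>W = 0\<close>. Hence \<open>M\<close> is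
  finitely generated over \<open>\<complex>[y, \<partial>\<^sub>w][S]\<close>, where \<open>w\<close> are coordinates transversal to and \<open>y\<close> coordinates
  along the flat; this ring is commutative, so Nakayama's lemma applies. The annihilator obtained in
  this way is stable under differentiation with respect to \<open>y\<close> and \<open>\<partial>\<^sub>w\<close>, as these derivations are
  commutators with \<open>\<partial>\<^sub>y\<close> and \<open>- w\<close>, and therefore contains some \<open>B \<in> \<complex>[S]\<close> with \<open>B(a) \<noteq> 0\<close>.
\<close>

section \<open>Formal derivatives\<close>

text \<open>The natural finite generation of \<open>M\<close> is over the noncommutative ring
  \<open>\<D>[S]\<close>. Near a generic point of the flat a partial Fourier transform helps:
  coordinates along the flat and derivatives across it commute, and their partners satisfy the Weyl
  relations. Support on the flat bounds the powers of the transversal coordinates, which leaves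
  finitely many monomials as generators. Derivatives along the flat add no generators, because the
  logarithmic derivatives of the \<open>F k\<close> in these directions have poles only along
  inverted forms. Nakayama's lemma is used at the prime ideal of polynomials all of whose
  coefficients vanish at \<open>a\<close>, so that no point has to be chosen in the variables
  \<open>y\<close> and \<open>\<partial>\<^sub>w\<close>. It yields an annihilator with some
  coefficient \<open>B\<close> satisfying \<open>B(a) \<noteq> 0\<close>. Lowering its degree to
  zero requires it to be a polynomial; this is why germs are replaced by polynomials at the outset.
  For the space of all linear forms nothing but the \<open>B\<close> is inverted, and the
  localization no longer hides a denominator in the coordinates.\<close>

lemma exponent_induct [case_names add single]:
  fixes \<beta> :: "'v::finite \<Rightarrow>\<^sub>0 nat"
  assumes "\<And>\<alpha> \<beta>. P \<alpha> \<Longrightarrow> P \<beta> \<Longrightarrow> P (\<alpha> + \<beta>)" and "\<And>i k. P (Poly_Mapping.single i k)"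
  shows "P \<beta>"
proof -
  have *: "P (\<Sum>i\<in>A. Poly_Mapping.single i (Poly_Mapping.lookup \<beta> i))" if "finite A" for A
    using that
  proof (induction A)
    case empty
    show ?case using assms(2)[of undefined 0] by simp
  qed (auto intro: assms)
  have "\<beta> = (\<Sum>i\<in>UNIV. Poly_Mapping.single i (Poly_Mapping.lookup \<beta> i))"
    by (rule poly_mapping_eqI) (auto simp: lookup_sum lookup_single when_def)
  then show ?thesis using *[of UNIV] by simp
qed

lemma var_power: "var i ^ k = Poly_Mapping.single (Poly_Mapping.single i k) (1::'a::comm_semiring_1)"
  by (induction k) (simp_all add: var_def mult_single flip: single_add)

lemma single_eq_prod: "Poly_Mapping.single \<beta> c =
    const (c::'a::comm_semiring_1) * (\<Prod>k\<in>UNIV. var k ^ Poly_Mapping.lookup \<beta> (k::'v::finite))"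
proof -
  have "(\<Prod>k\<in>A. var k ^ Poly_Mapping.lookup \<beta> k) =
      Poly_Mapping.single (\<Sum>k\<in>A. Poly_Mapping.single k (Poly_Mapping.lookup \<beta> k)) (1::'a)" for A :: "'v set"
    by (induction A rule: infinite_finite_induct) (simp_all add: mult_single var_power)
  moreover have "(\<Sum>k\<in>UNIV. Poly_Mapping.single k (Poly_Mapping.lookup \<beta> k)) = \<beta>"
    by (rule poly_mapping_eqI) (auto simp: lookup_sum lookup_single when_def)
  ultimately show ?thesis by (simp add: const_def mult_single)
qed

lemma mpoly_induct [case_names const var add mult]:
  fixes p :: "('v::finite, 'a::comm_semiring_1) mpoly"
  assumes const: "\<And>c. P (const c)" and "\<And>i. P (var i)" and "\<And>p q. P p \<Longrightarrow> P q \<Longrightarrow> P (p + q)"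
    and mult: "\<And>p q. P p \<Longrightarrow> P q \<Longrightarrow> P (p * q)"
  shows "P p"
proof (induction p rule: monomial_induct)
  case (monom \<beta> c)
  have pow: "P (var i ^ k)" for i k
    using const[of 1] by (induction k) (auto intro: assms)
  have "P (\<Prod>k\<in>A. var k ^ Poly_Mapping.lookup \<beta> k)" for A
    using const[of 1] by (induction A rule: infinite_finite_induct) (auto intro: mult pow)
  then show ?case unfolding single_eq_prod by (intro mult const)
qed (rule assms)

lemma germ_of_mpoly_power: "germ_of_mpoly (p ^ k) = germ_of_mpoly p ^ k"
  by (induction k) (simp_all add: germ_of_mpoly_1 germ_of_mpoly_mult)

lemma germ_of_mpoly_prod: "germ_of_mpoly (\<Prod>k\<in>A. h k) = (\<Prod>k\<in>A. germ_of_mpoly (h k))"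
  by (induction A rule: infinite_finite_induct) (simp_all add: germ_of_mpoly_1 germ_of_mpoly_mult)

text \<open>The coefficient ring is left general because it will be \<complex> as well as
  \<complex>[S]. Truncated subtraction of exponents is harmless: where it truncates, the factor
  \<open>of_nat\<close> is zero.\<close>

definition mder :: "'v \<Rightarrow> ('v, 'a::comm_semiring_1) mpoly \<Rightarrow> ('v, 'a) mpoly" where
  "mder i p = (\<Sum>\<beta>\<in>Poly_Mapping.keys p. Poly_Mapping.single (\<beta> - Poly_Mapping.single i 1)
     (of_nat (Poly_Mapping.lookup \<beta> i) * Poly_Mapping.lookup p \<beta>))"

lemma lookup_mder: "Poly_Mapping.lookup (mder i p) \<alpha> =
    of_nat (Poly_Mapping.lookup \<alpha> i + 1) * Poly_Mapping.lookup p (\<alpha> + Poly_Mapping.single i 1)"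
proof -
  let ?e = "Poly_Mapping.single i (1::nat)"
  have "\<beta> = \<alpha> + ?e" if "\<beta> - ?e = \<alpha>" "Poly_Mapping.lookup \<beta> i \<noteq> 0" for \<beta>
  proof (rule poly_mapping_eqI)
    fix k show "Poly_Mapping.lookup \<beta> k = Poly_Mapping.lookup (\<alpha> + ?e) k"
      unfolding that(1)[symmetric] using that(2)
      by (auto simp: lookup_add lookup_minus lookup_single when_def)
  qed
  then have eq: "(of_nat (Poly_Mapping.lookup \<beta> i) * Poly_Mapping.lookup p \<beta> when \<beta> - ?e = \<alpha>) =
      (if \<beta> = \<alpha> + ?e then of_nat (Poly_Mapping.lookup \<beta> i) * Poly_Mapping.lookup p \<beta> else 0)" for \<beta>
    by (cases "Poly_Mapping.lookup \<beta> i = 0") (auto simp: when_def)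
  show ?thesis
    unfolding mder_def lookup_sum lookup_single eq
    by (auto simp: sum.delta lookup_add not_in_keys_iff_lookup_eq_zero)
qed

lemma mder_add: "mder i (p + q) = mder i p + mder i q"
  by (rule poly_mapping_eqI) (simp add: lookup_mder lookup_add algebra_simps)

lemma mder_0 [simp]: "mder i 0 = 0"
  by (rule poly_mapping_eqI) (simp add: lookup_mder)

lemma mder_single: "mder i (Poly_Mapping.single \<beta> c) =
    Poly_Mapping.single (\<beta> - Poly_Mapping.single i 1) (of_nat (Poly_Mapping.lookup \<beta> i) * c)"
  unfolding mder_def by simp

lemma lookup_var_mult: "Poly_Mapping.lookup (var i * p :: (_, 'a::comm_semiring_1) mpoly) \<alpha> =
    (if Poly_Mapping.lookup \<alpha> i = 0 then 0 else Poly_Mapping.lookup p (\<alpha> - Poly_Mapping.single i 1))"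
proof (induction p rule: monomial_induct)
  case (add p q)
  then show ?case by (simp add: distrib_left lookup_add)
next
  case (monom \<beta> c)
  let ?e = "Poly_Mapping.single i (1::nat)"
  have "?e + \<beta> = \<alpha> \<longleftrightarrow> Poly_Mapping.lookup \<alpha> i \<noteq> 0 \<and> \<beta> = \<alpha> - ?e"
  proof
    assume "?e + \<beta> = \<alpha>"
    then show "Poly_Mapping.lookup \<alpha> i \<noteq> 0 \<and> \<beta> = \<alpha> - ?e" by (auto simp: lookup_add)
  next
    assume *: "Poly_Mapping.lookup \<alpha> i \<noteq> 0 \<and> \<beta> = \<alpha> - ?e"
    show "?e + \<beta> = \<alpha>"
      by (rule poly_mapping_eqI) (use * in \<open>auto simp: lookup_add lookup_minus lookup_single when_def\<close>)
  qed
  then show ?case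
    by (auto simp: var_def mult_single lookup_single when_def)
qed


text \<open>Monomials are eigenvectors of \<open>var i * mder i\<close>. The combination therefore
  removes exactly the terms of degree \<open>k\<close> in the \<open>i\<close>-th variable and
  creates no new exponents.\<close>

lemma lookup_euler_shift:
  fixes p :: "('v, 'a::comm_ring_1) mpoly"
  shows "Poly_Mapping.lookup (of_nat k * p - var i * mder i p) \<beta> =
    (of_nat k - of_nat (Poly_Mapping.lookup \<beta> i)) * Poly_Mapping.lookup p \<beta>"
proof -
  have cm: "Poly_Mapping.lookup (of_nat m * p) \<beta> = of_nat m * Poly_Mapping.lookup p \<beta>" for m
    by (induction m) (simp_all add: lookup_add distrib_right)
  have "\<beta> - Poly_Mapping.single i 1 + Poly_Mapping.single i 1 = \<beta>" if "Poly_Mapping.lookup \<beta> i \<noteq> 0"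
    using that by (intro poly_mapping_eqI) (auto simp: lookup_add lookup_minus lookup_single when_def)
  then show ?thesis
    unfolding lookup_minus cm lookup_var_mult lookup_mder
    by (auto simp: lookup_minus left_diff_distrib simp del: of_nat_Suc)
qed


section \<open>Modules over Weyl algebras\<close>

text \<open>
  The operators \<open>z i\<close> and \<open>d i\<close> satisfy the relations of coordinates and partial derivatives; only
  the \<open>z i\<close> are required to commute among themselves.
\<close>

locale weyl_action = module sc
  for sc :: "'c::comm_ring_1 \<Rightarrow> 'm::ab_group_add \<Rightarrow> 'm" +
  fixes z d :: "'n::finite \<Rightarrow> 'm \<Rightarrow> 'm" and ev :: "'c \<Rightarrow> complex"
  assumes z_add: "z i (v + w) = z i v + z i w" and z_sc: "z i (sc c v) = sc c (z i v)"
    and z_commute: "z i (z j v) = z j (z i v)"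
    and d_add: "d i (v + w) = d i v + d i w" and d_sc: "d i (sc c v) = sc c (d i v)"
    and d_z: "d i (z j v) = z j (d i v) + (if i = j then v else 0)"
    and ev_add: "ev (a + b) = ev a + ev b" and ev_mult: "ev (a * b) = ev a * ev b"
    and ev_1: "ev 1 = 1"
begin

lemma ev_0: "ev 0 = 0"
  using ev_add[of 0 0] by simp

lemma ev_of_nat: "ev (of_nat k) = of_nat k"
  by (induction k) (simp_all add: ev_0 ev_add ev_1)

text \<open>An arbitrary fixed order in which the operators of a monomial are composed; by
  \<open>z_commute\<close> the choice does not matter.\<close>

definition all_vars :: "'n list" where
  "all_vars = (SOME ys. distinct ys \<and> set ys = UNIV)"

lemma all_vars: "distinct all_vars" "set all_vars = UNIV"
proof -
  have "\<exists>ys. distinct ys \<and> set ys = (UNIV :: 'n set)"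
    using finite_distinct_list[of "UNIV :: 'n set"] by auto
  then have "distinct all_vars \<and> set all_vars = UNIV" unfolding all_vars_def by (rule someI_ex)
  then show "distinct all_vars" "set all_vars = UNIV" by auto
qed

definition zpow :: "('n \<Rightarrow>\<^sub>0 nat) \<Rightarrow> 'm \<Rightarrow> 'm" where
  "zpow \<beta> = foldr (\<lambda>i. z i ^^ Poly_Mapping.lookup \<beta> i) all_vars"

lemma z_0: "z i 0 = 0"
  using z_add[of i 0 0] by simp

lemma d_0: "d i 0 = 0"
  using d_add[of i 0 0] by simp

lemma z_pow_commute: "(z i ^^ k) (z j v) = z j ((z i ^^ k) v)"
  by (induction k) (simp_all add: z_commute)

lemma z_pow_pow_commute: "(z i ^^ k) ((z j ^^ l) v) = (z j ^^ l) ((z i ^^ k) v)"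
  by (induction l) (simp_all add: z_pow_commute)

lemma z_pow_add: "(z i ^^ k) (v + w) = (z i ^^ k) v + (z i ^^ k) w"
  by (induction k) (simp_all add: z_add)

lemma z_pow_sc: "(z i ^^ k) (sc c v) = sc c ((z i ^^ k) v)"
  by (induction k) (simp_all add: z_sc)

lemma zpow_0: "zpow 0 v = v"
proof -
  have "foldr (\<lambda>i. z i ^^ Poly_Mapping.lookup 0 i) ys v = v" for ys
    by (induction ys) simp_all
  then show ?thesis by (simp add: zpow_def)
qed

lemma zpow_exponent_add: "zpow (\<alpha> + \<beta>) v = zpow \<alpha> (zpow \<beta> v)"
proof -
  have comm: "(z i ^^ k) (foldr (\<lambda>i. z i ^^ Poly_Mapping.lookup \<alpha> i) ys v) =
      foldr (\<lambda>i. z i ^^ Poly_Mapping.lookup \<alpha> i) ys ((z i ^^ k) v)" for ys i k v \<alpha>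
  proof (induction ys)
    case (Cons j ys)
    show ?case unfolding foldr_Cons o_apply by (subst z_pow_pow_commute) (simp only: Cons)
  qed simp
  have "foldr (\<lambda>i. z i ^^ Poly_Mapping.lookup (\<alpha> + \<beta>) i) ys v =
     foldr (\<lambda>i. z i ^^ Poly_Mapping.lookup \<alpha> i) ys (foldr (\<lambda>i. z i ^^ Poly_Mapping.lookup \<beta> i) ys v)" for ys
    by (induction ys) (simp_all add: lookup_add funpow_add comm)
  then show ?thesis by (simp add: zpow_def)
qed

lemma zpow_single: "zpow (Poly_Mapping.single i k) v = (z i ^^ k) v"
proof -
  have "foldr (\<lambda>j. z j ^^ Poly_Mapping.lookup (Poly_Mapping.single i k) j) ys v =
      (if i \<in> set ys then (z i ^^ k) v else v)" if "distinct ys" for ys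
    using that by (induction ys) (auto simp: lookup_single when_def)
  then show ?thesis using all_vars by (simp add: zpow_def)
qed

lemma zpow_add: "zpow \<beta> (v + w) = zpow \<beta> v + zpow \<beta> w"
  by (induction \<beta> arbitrary: v w rule: exponent_induct)
    (simp_all add: zpow_exponent_add zpow_single z_pow_add)

lemma zpow_sc: "zpow \<beta> (sc c v) = sc c (zpow \<beta> v)"
  by (induction \<beta> arbitrary: v rule: exponent_induct)
    (simp_all add: zpow_exponent_add zpow_single z_pow_sc)

lemma d_zpow: "d i (zpow \<beta> v) =
    sc (of_nat (Poly_Mapping.lookup \<beta> i)) (zpow (\<beta> - Poly_Mapping.single i 1) v) + zpow \<beta> (d i v)"
proof (induction \<beta> arbitrary: v rule: exponent_induct)
  case (add \<alpha> \<beta>)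
  let ?e = "Poly_Mapping.single i (1::nat)"
  have l: "sc (of_nat (Poly_Mapping.lookup \<alpha> i)) (zpow (\<alpha> - ?e) (zpow \<beta> v)) =
      sc (of_nat (Poly_Mapping.lookup \<alpha> i)) (zpow (\<alpha> + \<beta> - ?e) v)" for \<alpha> \<beta> v
  proof (cases "Poly_Mapping.lookup \<alpha> i = 0")
    case False
    then have "\<alpha> - ?e + \<beta> = \<alpha> + \<beta> - ?e"
      by (intro poly_mapping_eqI) (auto simp: lookup_add lookup_minus lookup_single when_def)
    then show ?thesis by (simp flip: zpow_exponent_add)
  qed simp
  have c: "zpow \<alpha> (zpow \<beta> v) = zpow \<beta> (zpow \<alpha> v)" for \<alpha> \<beta> v
    by (simp add: add.commute flip: zpow_exponent_add)
  have "d i (zpow (\<alpha> + \<beta>) v) = sc (of_nat (Poly_Mapping.lookup \<alpha> i)) (zpow (\<alpha> - ?e) (zpow \<beta> v)) +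
      (sc (of_nat (Poly_Mapping.lookup \<beta> i)) (zpow (\<beta> - ?e) (zpow \<alpha> v)) + zpow \<alpha> (zpow \<beta> (d i v)))"
    by (simp add: zpow_exponent_add add zpow_add zpow_sc c[of \<alpha> "\<beta> - ?e"] del: One_nat_def)
  then show ?case unfolding l
    by (simp add: add.commute[of \<beta> \<alpha>] scale_left_distrib lookup_add zpow_exponent_add add.assoc)
next
  case (single j k)
  have *: "d i ((z j ^^ k) v) = (if i = j then sc (of_nat k) ((z j ^^ (k - 1)) v) else 0) + (z j ^^ k) (d i v)"
  proof (induction k)
    case (Suc k)
    have "z j ((z j ^^ (k - 1)) v) = (z j ^^ k) v" if "k \<noteq> 0"
      using that by (cases k) simp_all
    then show ?case
      by (cases "k = 0") (auto simp: Suc d_z z_add z_sc scale_left_distrib z_0)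
  qed simp
  show ?case
    by (auto simp: zpow_single * lookup_single when_def simp flip: single_diff)
qed

section \<open>Polynomials in the commuting operators \<open>z\<close>\<close>

definition act :: "('n, 'c) mpoly \<Rightarrow> 'm \<Rightarrow> 'm" where
  "act p v = (\<Sum>\<beta>\<in>Poly_Mapping.keys p. sc (Poly_Mapping.lookup p \<beta>) (zpow \<beta> v))"

lemma act_superset:
  assumes "finite A" "Poly_Mapping.keys p \<subseteq> A"
  shows "act p v = (\<Sum>\<beta>\<in>A. sc (Poly_Mapping.lookup p \<beta>) (zpow \<beta> v))"
  unfolding act_def using assms by (intro sum.mono_neutral_left) (auto simp: in_keys_iff)

lemma act_add_left: "act (p + q) v = act p v + act q v"
proof -
  let ?A = "Poly_Mapping.keys p \<union> Poly_Mapping.keys q"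
  have "Poly_Mapping.keys (p + q) \<subseteq> ?A" by (rule Poly_Mapping.keys_add)
  then show ?thesis
    by (simp add: act_superset[where A = ?A] lookup_add scale_left_distrib sum.distrib)
qed

lemma act_single: "act (Poly_Mapping.single \<beta> c) v = sc c (zpow \<beta> v)"
  using act_superset[of "{\<beta>}" "Poly_Mapping.single \<beta> c"] by simp

lemma act_0_left: "act 0 v = 0"
  by (simp add: act_def)

lemma act_add: "act p (v + w) = act p v + act p w"
  by (simp add: act_def zpow_add scale_right_distrib sum.distrib)

lemma act_0: "act p 0 = 0"
  using act_add[of p 0 0] by simp

lemma act_const: "act (const c) v = sc c v"
  by (simp add: const_def act_single zpow_0)

lemma act_1: "act 1 v = v"
  using act_const[of 1 v] by simp

lemma act_var: "act (var i) v = z i v"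
  by (simp add: var_def act_single zpow_single)

lemma act_mult: "act (p * q) v = act p (act q v)"
proof (induction p rule: monomial_induct)
  case (add p p')
  then show ?case by (simp add: distrib_right act_add_left)
next
  case (monom \<alpha> c)
  show ?case
  proof (induction q rule: monomial_induct)
    case (add q q')
    then show ?case by (simp add: distrib_left act_add_left act_add)
  next
    case (monom \<beta> b)
    show ?case by (simp add: mult_single act_single zpow_exponent_add zpow_sc)
  qed
qed

lemma act_uminus_left: "act (- p) v = - act p v"
  using act_add_left[of "- p" p v] by (simp add: act_0_left eq_neg_iff_add_eq_0)

lemma act_diff_left: "act (p - q) v = act p v - act q v"
  using act_add_left[of "p - q" q v] by simp

lemma act_uminus: "act p (- v) = - act p v"
  using act_add[of p "- v" v] by (simp add: act_0 eq_neg_iff_add_eq_0)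

lemma act_diff: "act p (v - w) = act p v - act p w"
  using act_add[of p "v - w" w] by simp

lemma act_sum: "act p (\<Sum>t\<in>G. h t) = (\<Sum>t\<in>G. act p (h t))"
  by (induction G rule: infinite_finite_induct) (simp_all add: act_0 act_add)

text \<open>The commutator of \<open>d i\<close> with a polynomial in the \<open>z\<close> is its
  formal derivative. This is what makes annihilators stable under differentiation.\<close>

lemma d_act: "d i (act p v) = act (mder i p) v + act p (d i v)"
proof (induction p rule: monomial_induct)
  case (add p q)
  then show ?case by (simp add: act_add_left mder_add d_add)
next
  case (monom \<beta> c)
  show ?case by (simp add: act_single mder_single d_sc d_zpow scale_right_distrib mult.commute)
qed

text \<open>The values of \<open>red\<close> are polynomials, taken as germs because these are known to form an integral domain.\<close>

definition red :: "('n, 'c) mpoly \<Rightarrow> 'n germ" where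
  "red = mpoly_subst (\<lambda>c. germ_of_mpoly (const (ev c))) (\<lambda>i. germ_of_mpoly (var i))"

sublocale red_hom: coeff_hom "\<lambda>c. germ_of_mpoly (const (ev c)) :: 'n germ"
  by unfold_locales
    (simp_all add: ev_0 ev_1 ev_add ev_mult const_add const_mult germ_of_mpoly_0 germ_of_mpoly_1
      germ_of_mpoly_add germ_of_mpoly_mult)

lemma red_add: "red (p + q) = red p + red q"
  unfolding red_def by (rule red_hom.subst_add)

lemma red_mult: "red (p * q) = red p * red q"
  unfolding red_def by (rule red_hom.subst_mult)

lemma red_1: "red 1 = 1"
  unfolding red_def by (rule red_hom.subst_1)

lemma red_diff: "red (p - q) = red p - red q"
  using red_add[of "p - q" q] by simp

lemma red_0: "red 0 = 0"
  using red_diff[of 0 0] by simp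

lemma gcoeff_red: "gcoeff (red p) \<alpha> = ev (Poly_Mapping.lookup p \<alpha>)"
proof (induction p rule: monomial_induct)
  case (add p q)
  then show ?case by (simp add: red_add plus_germ.rep_eq lookup_add ev_add)
next
  case (monom \<beta> c)
  have "red (Poly_Mapping.single \<beta> c) = germ_of_mpoly (Poly_Mapping.single \<beta> (ev c))"
    unfolding red_def mpoly_subst_single[where \<phi> = "\<lambda>c. germ_of_mpoly (const (ev c)) :: 'n germ", OF red_hom.hom_0]
    by (simp add: germ_of_mpoly_power germ_of_mpoly_prod germ_of_mpoly_mult single_eq_prod[of \<beta> "ev c"])
  then show ?case
    by (simp add: lookup_single when_def ev_0)
qed

text \<open>Since germs form a domain, the polynomials all of whose coefficients vanish under
  \<open>ev\<close> thus form a prime ideal.\<close>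

lemma red_eq_0_iff: "red p = 0 \<longleftrightarrow> (\<forall>\<alpha>. ev (Poly_Mapping.lookup p \<alpha>) = 0)"
proof -
  have "red p = 0 \<longleftrightarrow> (\<forall>\<alpha>. gcoeff (red p) \<alpha> = gcoeff 0 \<alpha>)" by (auto intro: gcoeff_eqI)
  then show ?thesis by (simp add: gcoeff_red zero_germ.rep_eq)
qed

text \<open>
  Nakayama's lemma over the localization of the polynomial ring at the prime ideal \<open>red p = 0\<close>, by
  eliminating one generator after the other.
\<close>

lemma nakayama:
  assumes T_add: "\<And>v w. v \<in> T \<Longrightarrow> w \<in> T \<Longrightarrow> v + w \<in> T" and T_act: "\<And>p v. v \<in> T \<Longrightarrow> act p v \<in> T"
    and "finite G"
    and "\<And>t. t \<in> G \<Longrightarrow> \<exists>p q. red p \<noteq> 0 \<and> (\<forall>s. red (q s) = 0) \<and> act p t - (\<Sum>s\<in>G. act (q s) s) \<in> T"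
  shows "\<exists>p. red p \<noteq> 0 \<and> (\<forall>t\<in>G. act p t \<in> T)"
  using assms(3,4)
proof (induction G)
  case empty
  show ?case using red_1 by (intro exI[of _ 1]) auto
next
  case (insert x G)
  obtain p q where pq: "red p \<noteq> 0" "\<forall>s. red (q s) = 0"
    "act p x - (\<Sum>s\<in>insert x G. act (q s) s) \<in> T"
    using insert.prems by blast
  \<comment> \<open>Absorbing the term of \<open>x\<close> on the left changes \<open>p\<close> only
    by an element of the prime ideal, so \<open>r\<close> is still invertible in the
    localization.\<close>
  define r where "r = p - q x"
  have r: "red r \<noteq> 0" using pq by (simp add: r_def red_diff)
  have rx: "act r x - (\<Sum>s\<in>G. act (q s) s) \<in> T"
    using pq(3) insert.hyps by (simp add: r_def act_diff_left algebra_simps)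
  have "\<exists>p q. red p \<noteq> 0 \<and> (\<forall>s. red (q s) = 0) \<and> act p t - (\<Sum>s\<in>G. act (q s) s) \<in> T" if t: "t \<in> G" for t
  proof -
    obtain p' q' where pq': "red p' \<noteq> 0" "\<forall>s. red (q' s) = 0"
      "act p' t - (\<Sum>s\<in>insert x G. act (q' s) s) \<in> T"
      using insert.prems t by blast
    \<comment> \<open>The relation for \<open>t\<close> is multiplied by \<open>r\<close>, and
      \<open>r x\<close> is then replaced by its expression in the other generators. The new
      coefficients still reduce to zero.\<close>
    have "act r (act p' t - (\<Sum>s\<in>insert x G. act (q' s) s)) +
        act (q' x) (act r x - (\<Sum>s\<in>G. act (q s) s)) \<in> T"
      by (intro T_add T_act pq'(3) rx)
    also have "act r (act p' t - (\<Sum>s\<in>insert x G. act (q' s) s)) +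
        act (q' x) (act r x - (\<Sum>s\<in>G. act (q s) s)) =
        act (r * p') t - (\<Sum>s\<in>G. act (r * q' s + q' x * q s) s)"
      using insert.hyps
      by (simp add: act_diff act_add act_sum act_add_left sum.distrib algebra_simps flip: act_mult)
    finally show ?thesis
      using r pq pq' by (intro exI[of _ "r * p'"] exI[of _ "\<lambda>s. r * q' s + q' x * q s"])
        (simp add: red_mult red_add)
  qed
  then obtain p' where p': "red p' \<noteq> 0" "\<forall>t\<in>G. act p' t \<in> T" using insert.IH by blast
  have sumT: "(\<Sum>s\<in>B. act (q s) (act p' s)) \<in> T" if "B \<subseteq> G" for B
  proof -
    have "0 \<in> T" using T_act[OF rx, of 0] by (simp add: act_0_left)
    then show ?thesis using that
      by (induction B rule: infinite_finite_induct) (auto intro!: T_add T_act p'(2)[rule_format])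
  qed
  \<comment> \<open>Back substitution: \<open>p'\<close> sends the other generators into
    \<open>T\<close>, hence \<open>p' * r\<close> sends \<open>x\<close> there.\<close>
  have "act p' (act r x - (\<Sum>s\<in>G. act (q s) s)) + (\<Sum>s\<in>G. act (q s) (act p' s)) \<in> T"
    by (intro T_add T_act rx sumT) auto
  then have "act (p' * r) x \<in> T"
    by (simp add: act_diff act_sum mult.commute[of p'] flip: act_mult)
  moreover have "act (p' * r) t \<in> T" if "t \<in> G" for t
    using T_act[of "act p' t" r] p'(2) that by (simp add: mult.commute flip: act_mult)
  ultimately show ?case using p'(1) r by (intro exI[of _ "p' * r"]) (auto simp: red_mult)
qed

text \<open>
  If the \<open>z\<^sub>i\<close>-degree of \<open>p\<close> is at most \<open>k + 1\<close>, then \<open>(k + 1) p - z\<^sub>i \<partial>p/\<partial>z\<^sub>i\<close> and \<open>\<partial>p/\<partial>z\<^sub>i\<close> have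
  smaller degree, and they do not both reduce to zero unless \<open>p\<close> does.
\<close>

lemma eliminate_variable:
  assumes J: "\<And>p. p \<in> J \<Longrightarrow> mder i p \<in> J"
      "\<And>p k. p \<in> J \<Longrightarrow> of_nat k * p - var i * mder i p \<in> J"
    and "p \<in> J" "red p \<noteq> 0" "\<forall>j\<in>X. \<forall>\<beta>. Poly_Mapping.lookup p \<beta> \<noteq> 0 \<longrightarrow> Poly_Mapping.lookup \<beta> j = 0"
      "\<forall>\<beta>. Poly_Mapping.lookup p \<beta> \<noteq> 0 \<longrightarrow> Poly_Mapping.lookup \<beta> i \<le> k"
  shows "\<exists>p\<in>J. red p \<noteq> 0 \<and>
    (\<forall>j\<in>insert i X. \<forall>\<beta>. Poly_Mapping.lookup p \<beta> \<noteq> 0 \<longrightarrow> Poly_Mapping.lookup \<beta> j = 0)"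
  using assms(3-)
proof (induction k arbitrary: p)
  case 0
  then show ?case by auto
next
  case (Suc k)
  let ?e = "Poly_Mapping.single i (1::nat)"
  define p' where "p' = of_nat (Suc k) * p - var i * mder i p"
  have p': "Poly_Mapping.lookup p' \<beta> =
      (of_nat (Suc k) - of_nat (Poly_Mapping.lookup \<beta> i)) * Poly_Mapping.lookup p \<beta>" for \<beta>
    unfolding p'_def by (rule lookup_euler_shift)
  \<comment> \<open>Exponents of \<open>q\<close> dominated by exponents of \<open>p\<close> keep
    the variables in \<open>X\<close> absent while the degree in the variable \<open>i\<close>
    drops.\<close>
  have elim: ?case if "q \<in> J" "red q \<noteq> 0" and q: "\<And>\<beta>. Poly_Mapping.lookup q \<beta> \<noteq> 0 \<Longrightarrow>
      (\<exists>\<gamma>. Poly_Mapping.lookup p \<gamma> \<noteq> 0 \<and> (\<forall>j. Poly_Mapping.lookup \<beta> j \<le> Poly_Mapping.lookup \<gamma> j)) \<and>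
      Poly_Mapping.lookup \<beta> i \<le> k" for q
  proof (rule Suc.IH[OF that(1,2)])
    show "\<forall>j\<in>X. \<forall>\<beta>. Poly_Mapping.lookup q \<beta> \<noteq> 0 \<longrightarrow> Poly_Mapping.lookup \<beta> j = 0"
      using q Suc.prems(3) by (metis le_zero_eq)
  qed (use q in blast)
  show ?case
  proof (cases "red p' = 0")
    case False
    show ?thesis
    proof (rule elim[of p'])
      show "p' \<in> J" unfolding p'_def by (rule J(2)[OF Suc.prems(1)])
      fix \<beta> assume "Poly_Mapping.lookup p' \<beta> \<noteq> 0"
      then have nz: "Poly_Mapping.lookup p \<beta> \<noteq> 0" "Poly_Mapping.lookup \<beta> i \<noteq> Suc k"
        unfolding p' by (auto simp del: of_nat_Suc)
      moreover have "Poly_Mapping.lookup \<beta> i \<le> Suc k" using Suc.prems(4) nz by blast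
      ultimately show "(\<exists>\<gamma>. Poly_Mapping.lookup p \<gamma> \<noteq> 0 \<and>
          (\<forall>j. Poly_Mapping.lookup \<beta> j \<le> Poly_Mapping.lookup \<gamma> j)) \<and> Poly_Mapping.lookup \<beta> i \<le> k"
        by auto
    qed (fact False)
  next
    case True
    \<comment> \<open>A coefficient with nonzero value survives in \<open>p'\<close> unless its
      exponent at \<open>i\<close> is exactly \<open>Suc k\<close>. Here none survives, so such a
      coefficient sits in top degree and is not lost by differentiation.\<close>
    obtain \<alpha> where \<alpha>: "ev (Poly_Mapping.lookup p \<alpha>) \<noteq> 0" using Suc.prems(2) by (auto simp: red_eq_0_iff)
    have "ev (Poly_Mapping.lookup p' \<alpha>) = 0" using True by (auto simp: red_eq_0_iff)
    moreover have "ev (of_nat (Suc k) - of_nat m) = of_nat (Suc k) - of_nat m" for m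
      using ev_add[of "of_nat (Suc k) - of_nat m" "of_nat m"] by (simp add: ev_of_nat ev_add ev_1 algebra_simps)
    ultimately have "of_nat (Suc k) = (of_nat (Poly_Mapping.lookup \<alpha> i) :: complex)"
      using \<alpha> unfolding p' ev_mult by simp
    then have \<alpha>i: "Poly_Mapping.lookup \<alpha> i = Suc k" using of_nat_eq_iff by metis
    then have e: "\<alpha> - ?e + ?e = \<alpha>"
      by (intro poly_mapping_eqI) (auto simp: lookup_add lookup_minus lookup_single when_def)
    show ?thesis
    proof (rule elim[of "mder i p"])
      show "mder i p \<in> J" by (rule J(1)[OF Suc.prems(1)])
      have "ev (Poly_Mapping.lookup (mder i p) (\<alpha> - ?e)) \<noteq> 0"
        unfolding lookup_mder e ev_mult ev_of_nat using \<alpha> by (simp add: lookup_minus \<alpha>i del: of_nat_Suc of_nat_add)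
      then show "red (mder i p) \<noteq> 0" by (auto simp: red_eq_0_iff)
      fix \<beta> assume "Poly_Mapping.lookup (mder i p) \<beta> \<noteq> 0"
      then have nz: "Poly_Mapping.lookup p (\<beta> + ?e) \<noteq> 0" unfolding lookup_mder by auto
      have "Poly_Mapping.lookup (\<beta> + ?e) i \<le> Suc k" using Suc.prems(4) nz by blast
      then show "(\<exists>\<gamma>. Poly_Mapping.lookup p \<gamma> \<noteq> 0 \<and>
          (\<forall>j. Poly_Mapping.lookup \<beta> j \<le> Poly_Mapping.lookup \<gamma> j)) \<and> Poly_Mapping.lookup \<beta> i \<le> k"
        using nz by (auto simp: lookup_add intro!: exI[of _ "\<beta> + ?e"])
    qed
  qed
qed

lemma eliminate_variables:
  assumes "finite Y"
    and J: "\<And>i p. i \<in> Y \<Longrightarrow> p \<in> J \<Longrightarrow> mder i p \<in> J"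
      "\<And>i p k. i \<in> Y \<Longrightarrow> p \<in> J \<Longrightarrow> of_nat k * p - var i * mder i p \<in> J"
    and "p \<in> J" "red p \<noteq> 0"
  shows "\<exists>p\<in>J. red p \<noteq> 0 \<and>
    (\<forall>j\<in>Y. \<forall>\<beta>. Poly_Mapping.lookup p \<beta> \<noteq> 0 \<longrightarrow> Poly_Mapping.lookup \<beta> j = 0)"
  using assms
proof (induction Y)
  case (insert i Y)
  then obtain q where q: "q \<in> J" "red q \<noteq> 0"
    "\<forall>j\<in>Y. \<forall>\<beta>. Poly_Mapping.lookup q \<beta> \<noteq> 0 \<longrightarrow> Poly_Mapping.lookup \<beta> j = 0"
    by blast
  obtain k where k: "\<forall>\<beta>. Poly_Mapping.lookup q \<beta> \<noteq> 0 \<longrightarrow> Poly_Mapping.lookup \<beta> i \<le> k"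
  proof
    show "\<forall>\<beta>. Poly_Mapping.lookup q \<beta> \<noteq> 0 \<longrightarrow> Poly_Mapping.lookup \<beta> i \<le>
        Max ((\<lambda>\<beta>. Poly_Mapping.lookup \<beta> i) ` Poly_Mapping.keys q)"
      by (auto simp: in_keys_iff intro!: Max_ge)
  qed
  show ?case by (rule eliminate_variable[OF _ _ q k]) (use insert.prems in auto)
qed auto

end

section \<open>Factors of products of linear forms\<close>

lemma mpoly_mult_eq_0_iff:
  fixes p q :: "('n::finite, complex) mpoly"
  shows "p * q = 0 \<longleftrightarrow> p = 0 \<or> q = 0"
  by (metis germ_of_mpoly_eq_0_iff germ_of_mpoly_mult mult_eq_0_iff)

lemma partial_germ_of_mpoly: "partial i (germ_of_mpoly p) = germ_of_mpoly (mder i p)"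
  by (rule gcoeff_eqI) (simp add: partial.rep_eq lookup_mder)

lemma germ_of_mpoly_inject: "germ_of_mpoly p = germ_of_mpoly q \<longleftrightarrow> p = q"
  by (metis gcoeff_germ_of_mpoly lookup_inject)

lemma mder_mult:
  fixes p q :: "('n::finite, complex) mpoly"
  shows "mder i (p * q) = mder i p * q + p * mder i q"
proof -
  have "germ_of_mpoly (mder i (p * q)) = germ_of_mpoly (mder i p * q + p * mder i q)"
    by (simp add: germ_of_mpoly_add germ_of_mpoly_mult partial_mult flip: partial_germ_of_mpoly)
  then show ?thesis by (simp add: germ_of_mpoly_inject)
qed

lemma mder_const: "mder i (const c) = 0"
  by (simp add: const_def mder_single)

lemma mder_var: "mder i (var j) = (if i = j then 1 else 0)"
  by (auto simp: var_def mder_single lookup_single when_def simp flip: single_diff)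

lemma mder_sum: "mder i (\<Sum>k\<in>A. h k) = (\<Sum>k\<in>A. mder i (h k))"
  by (induction A rule: infinite_finite_induct) (simp_all add: mder_add)

lemma mder_linear_form: "mder i (linear_form v) = const (v $ i)"
proof -
  have "mder i (linear_form v) = (\<Sum>k\<in>UNIV. if i = k then const (v $ k) else 0)"
    unfolding linear_form_def mder_sum by (intro sum.cong) (auto simp: mder_mult mder_const mder_var)
  then show ?thesis by simp
qed

lemma linear_form_add: "linear_form (v + w) = linear_form v + linear_form w"
  by (simp add: linear_form_def const_add distrib_right sum.distrib)

lemma linear_form_scale: "linear_form (c *s v) = const c * linear_form v"
  by (simp add: linear_form_def const_mult sum_distrib_left mult.assoc)

lemma linear_form_0 [simp]: "linear_form 0 = 0"
  by (simp add: linear_form_def)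

lemma linear_form_sum: "linear_form (\<Sum>k\<in>A. h k) = (\<Sum>k\<in>A. linear_form (h k))"
  by (induction A rule: infinite_finite_induct) (simp_all add: linear_form_add)

lemma linear_form_axis: "linear_form (axis i 1) = var i"
proof -
  have "linear_form (axis i 1 :: complex ^ 'a) = (\<Sum>k\<in>UNIV. if i = k then var k else 0)"
    unfolding linear_form_def by (intro sum.cong) (auto simp: axis_def)
  then show ?thesis by simp
qed

lemma linear_form_eq_0_iff: "linear_form v = 0 \<longleftrightarrow> v = 0"
proof
  assume "linear_form v = 0"
  then have "const (v $ i) = (0 :: ('a, complex) mpoly)" for i by (metis mder_0 mder_linear_form)
  then show "v = 0"
    by (simp add: vec_eq_iff const_def) (metis lookup_single_eq lookup_zero)
qed simp

text \<open>The residue ring modulo a linear form is again a polynomial ring: solve for one variable.\<close>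

lemma linear_form_prime:
  assumes "v \<noteq> 0" "linear_form v dvd a * b"
  shows "linear_form v dvd a \<or> linear_form v dvd b"
proof -
  obtain j where j: "v $ j \<noteq> 0" using assms(1) by (auto simp: vec_eq_iff)
  \<comment> \<open>Projection onto the polynomials without the variable \<open>j\<close>: this
    substitution kills the linear form and is the identity modulo it, so its kernel is the ideal of
    the form.\<close>
  define x where "x i = (if i = j then var j - const (1 / v $ j) * linear_form v else var i)" for i
  have sub: "linear_form v dvd mpoly_subst const x p - p" for p
  proof (induction p rule: mpoly_induct)
    case (var i)
    then show ?case by (simp add: const_hom.subst_var x_def)
  next
    case (add p q)
    then have "linear_form v dvd (mpoly_subst const x p - p) + (mpoly_subst const x q - q)" by (rule dvd_add)
    then show ?case by (simp add: const_hom.subst_add algebra_simps)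
  next
    case (mult p q)
    then have "linear_form v dvd (mpoly_subst const x p - p) * mpoly_subst const x q + p * (mpoly_subst const x q - q)"
      by (intro dvd_add dvd_mult dvd_mult2)
    then show ?case by (simp add: const_hom.subst_mult algebra_simps)
  qed (simp add: const_hom.subst_const)
  have subst_sum: "mpoly_subst const x (\<Sum>k\<in>A. h k) = (\<Sum>k\<in>A. mpoly_subst const x (h k))" for A :: "'a set" and h
    by (induction A rule: infinite_finite_induct) (simp_all add: const_hom.subst_add const_hom.subst_0)
  have "mpoly_subst const x (linear_form v) = (\<Sum>i\<in>UNIV. const (v $ i) * x i)"
    unfolding linear_form_def subst_sum by (simp add: const_hom.subst_mult const_hom.subst_const const_hom.subst_var)
  also have "\<dots> = (\<Sum>i\<in>UNIV. const (v $ i) * var i - (if i = j then linear_form v else 0))"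
  proof (intro sum.cong refl)
    fix i
    have "const (v $ j) * const (1 / v $ j) = (1 :: ('a, complex) mpoly)"
      using j by (simp flip: const_mult)
    then show "const (v $ i) * x i = const (v $ i) * var i - (if i = j then linear_form v else 0)"
      by (simp add: x_def right_diff_distrib flip: mult.assoc)
  qed
  also have "\<dots> = 0" by (simp add: sum_subtractf) (simp add: linear_form_def)
  finally have "mpoly_subst const x (linear_form v) = 0" .
  moreover obtain k where "a * b = linear_form v * k" using assms(2) by (elim dvdE)
  ultimately have "mpoly_subst const x (a * b) = 0" by (simp only: const_hom.subst_mult mult_zero_left)
  then have "mpoly_subst const x a = 0 \<or> mpoly_subst const x b = 0"
    by (simp add: const_hom.subst_mult mpoly_mult_eq_0_iff)
  then show ?thesis using sub[of a] sub[of b] by auto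
qed

lemma prod_linear_forms_neq_0: "0 \<notin> set vs \<Longrightarrow> (\<Prod>v\<leftarrow>vs. linear_form v) \<noteq> 0"
  by (induction vs) (auto simp: mpoly_mult_eq_0_iff linear_form_eq_0_iff)

text \<open>By primality each form of the list can be split off either \<open>a\<close> or its
  cofactor. A form l in \<open>a\<close> contributes \<delta>(l)/l to \<delta>(a)/a, which is a
  polynomial if l divides \<delta>(l); the product of the remaining forms clears the other
  denominators. It is applied to the Euler derivation and to derivatives along a flat.\<close>

lemma dvd_derivation_factor:
  assumes leibniz: "\<And>a b. \<delta> (a * b) = \<delta> a * b + a * \<delta> b"
    and "a dvd (\<Prod>v\<leftarrow>vs. linear_form v)" "0 \<notin> set vs"
  shows "a dvd (\<Prod>v\<leftarrow>filter (\<lambda>v. \<not> linear_form v dvd \<delta> (linear_form v)) vs. linear_form v) * \<delta> a"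
  using assms(2,3)
proof (induction vs arbitrary: a)
  case Nil
  then show ?case by (auto intro: dvd_trans)
next
  case (Cons v vs)
  let ?l = "linear_form v"
  let ?g = "\<Prod>v\<leftarrow>filter (\<lambda>v. \<not> linear_form v dvd \<delta> (linear_form v)) vs. linear_form v"
  let ?g' = "\<Prod>v\<leftarrow>filter (\<lambda>v. \<not> linear_form v dvd \<delta> (linear_form v)) (v # vs). linear_form v"
  have g: "?g' = (if ?l dvd \<delta> ?l then ?g else ?l * ?g)" by simp
  obtain b where b: "?l * (\<Prod>v\<leftarrow>vs. linear_form v) = a * b" using Cons.prems(1) by (auto elim: dvdE)
  have l: "?l \<noteq> 0" using Cons.prems(2) by (auto simp: linear_form_eq_0_iff)
  have "?l dvd a \<or> ?l dvd b"
    using linear_form_prime[of v a b] Cons.prems(2) b by (metis dvd_triv_left list.set_intros(1))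
  then show ?case
  proof
    assume "?l dvd a"
    then obtain a' where a': "a = ?l * a'" by (elim dvdE)
    then have "?l * ((\<Prod>v\<leftarrow>vs. linear_form v) - a' * b) = 0" using b by (simp add: algebra_simps)
    then have "(\<Prod>v\<leftarrow>vs. linear_form v) = a' * b" using l by (simp add: mpoly_mult_eq_0_iff)
    then have IH: "a' dvd ?g * \<delta> a'" using Cons.IH[of a'] Cons.prems(2) by simp
    show ?thesis
    proof (cases "?l dvd \<delta> ?l")
      case True
      have "?l * a' dvd ?g * (\<delta> ?l * a')"
        by (rule dvd_mult[OF mult_dvd_mono[OF True dvd_refl]])
      moreover have "?l * a' dvd ?l * (?g * \<delta> a')" by (rule mult_dvd_mono[OF dvd_refl IH])
      ultimately have "?l * a' dvd ?g * (\<delta> ?l * a') + ?l * (?g * \<delta> a')" by (rule dvd_add)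
      then show ?thesis using True unfolding g a' leibniz by (simp add: algebra_simps)
    next
      case False
      have "?l * a' dvd ?l * a' * (?g * \<delta> ?l)" "?l * a' dvd ?l * ((?g * \<delta> a') * ?l)"
        using IH by (auto intro: mult_dvd_mono)
      then have "?l * a' dvd ?l * a' * (?g * \<delta> ?l) + ?l * ((?g * \<delta> a') * ?l)" by (rule dvd_add)
      then show ?thesis using False unfolding g a' leibniz by (simp add: algebra_simps)
    qed
  next
    assume "?l dvd b"
    then obtain b' where b': "b = ?l * b'" by (elim dvdE)
    then have "?l * ((\<Prod>v\<leftarrow>vs. linear_form v) - a * b') = 0" using b by (simp add: algebra_simps)
    then have "(\<Prod>v\<leftarrow>vs. linear_form v) = a * b'" using l by (simp add: mpoly_mult_eq_0_iff)
    then have "a dvd ?g * \<delta> a" using Cons.IH[of a] Cons.prems(2) by simp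
    then show ?thesis unfolding g by (auto simp: mult.assoc)
  qed
qed

section \<open>Homogeneity through the Euler derivation\<close>

definition euler :: "('n::finite, complex) mpoly \<Rightarrow> ('n, complex) mpoly" where
  "euler p = (\<Sum>i\<in>UNIV. var i * mder i p)"

lemma euler_mult: "euler (p * q) = euler p * q + p * euler q"
  by (simp add: euler_def mder_mult sum.distrib algebra_simps sum_distrib_left)

lemma lookup_const_mult: "Poly_Mapping.lookup (const c * p) \<alpha> = c * Poly_Mapping.lookup p \<alpha>"
  for c :: "'a::comm_semiring_1"
  by (induction p rule: monomial_induct)
    (simp_all add: distrib_left lookup_add const_def mult_single lookup_single when_def)

lemma lookup_euler: "Poly_Mapping.lookup (euler p) \<alpha> = of_nat (mdeg \<alpha>) * Poly_Mapping.lookup p \<alpha>"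
proof -
  have e: "\<alpha> - Poly_Mapping.single i 1 + Poly_Mapping.single i 1 = \<alpha>" if "Poly_Mapping.lookup \<alpha> i \<noteq> 0" for i
    using that by (intro poly_mapping_eqI) (auto simp: lookup_add lookup_minus lookup_single when_def)
  have "Poly_Mapping.lookup (var i * mder i p) \<alpha> =
      of_nat (Poly_Mapping.lookup \<alpha> i) * Poly_Mapping.lookup p \<alpha>" for i
    unfolding lookup_var_mult lookup_mder using e[of i] by (auto simp: lookup_minus)
  then show ?thesis by (simp add: euler_def lookup_sum mdeg_def sum_distrib_right)
qed

text \<open>This is \<open>p(T x)\<close> as a polynomial in \<open>T\<close>, whose coefficient at
  \<open>T^k\<close> is the part of \<open>p\<close> of degree \<open>k\<close>. The total degree
  becomes \<open>degree\<close> over a domain and is therefore additive on products.\<close>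

definition homogenize :: "('n::finite, complex) mpoly \<Rightarrow> 'n germ poly" where
  "homogenize = mpoly_subst (\<lambda>c. [:germ_of_mpoly (const c):]) (\<lambda>i. monom (germ_of_mpoly (var i)) 1)"

interpretation homogenize_hom: coeff_hom "\<lambda>c. [:germ_of_mpoly (const c):] :: 'n::finite germ poly"
  by unfold_locales
    (simp_all add: const_add const_mult germ_of_mpoly_0 germ_of_mpoly_1 germ_of_mpoly_add
      germ_of_mpoly_mult one_pCons)

lemma gcoeff_coeff_homogenize:
  "gcoeff (coeff (homogenize p) k) \<alpha> = (if mdeg \<alpha> = k then Poly_Mapping.lookup p \<alpha> else 0)"
proof (induction p rule: monomial_induct)
  case (add p q)
  then show ?case
    by (simp add: homogenize_def homogenize_hom.subst_add plus_germ.rep_eq lookup_add)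
next
  case (monom \<beta> c)
  have pow: "monom (x :: 'a germ) (Suc 0) ^ m = monom (x ^ m) m" for x m
    by (induction m) (simp_all add: mult_monom monom_0)
  have "(\<Prod>i\<in>A. monom (y i) (m i)) = monom (\<Prod>i\<in>A. y i) (\<Sum>i\<in>A. m i)"
    for A :: "'a set" and y :: "'a \<Rightarrow> 'a germ" and m
    by (induction A rule: infinite_finite_induct) (simp_all add: mult_monom monom_0)
  then have "homogenize (Poly_Mapping.single \<beta> c) =
      [:germ_of_mpoly (const c):] * monom (\<Prod>i\<in>UNIV. germ_of_mpoly (var i) ^ Poly_Mapping.lookup \<beta> i) (mdeg \<beta>)"
    unfolding homogenize_def
    by (subst mpoly_subst_single) (simp_all add: pow germ_of_mpoly_0 mdeg_def)
  also have "\<dots> = monom (germ_of_mpoly (Poly_Mapping.single \<beta> c)) (mdeg \<beta>)"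
    unfolding single_eq_prod[of \<beta> c]
    by (simp add: smult_monom germ_of_mpoly_mult germ_of_mpoly_prod germ_of_mpoly_power)
  finally show ?case by (auto simp: lookup_single when_def zero_germ.rep_eq)
qed

lemma homogenize_mult: "homogenize (p * q) = homogenize p * homogenize q"
  unfolding homogenize_def by (rule homogenize_hom.subst_mult)

lemma homogenize_eq_0: "homogenize p = 0 \<Longrightarrow> p = 0"
proof (rule poly_mapping_eqI)
  fix \<alpha> assume "homogenize p = 0"
  then show "Poly_Mapping.lookup p \<alpha> = Poly_Mapping.lookup 0 \<alpha>"
    using gcoeff_coeff_homogenize[of p "mdeg \<alpha>" \<alpha>] by (simp add: zero_germ.rep_eq)
qed

lemma gcoeff_germ_const_mult:
  fixes a :: "'a::finite germ"
  shows "gcoeff (germ_of_mpoly (const c) * a) \<alpha> = c * gcoeff a \<alpha>"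
proof -
  have "gcoeff (germ_of_mpoly (const c) * a) \<alpha> =
      (\<Sum>(\<beta>, \<gamma>)\<in>{(0, \<alpha>)}. Poly_Mapping.lookup (const c :: ('a, complex) mpoly) \<beta> * gcoeff a \<gamma>)"
    unfolding times_germ.rep_eq gcoeff_germ_of_mpoly
    by (rule sum.mono_neutral_right[OF finite_splits]) (auto simp: splits_def const_def lookup_single when_def split: if_splits)
  then show ?thesis by (simp add: const_def)
qed

text \<open>If \<open>a\<close> divides its Euler derivative, the quotient has degree \<open>0\<close>, so \<open>a\<close> is homogeneous.\<close>

lemma dvd_euler:
  assumes "a dvd euler a"
  shows "\<exists>m. euler a = const (of_nat m) * a"
proof (cases "euler a = 0")
  case True
  then show ?thesis by (intro exI[of _ 0]) simp
next
  case False
  obtain c where c: "euler a = a * c" using assms by (elim dvdE)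
  have "a \<noteq> 0" "c \<noteq> 0" using False c by auto
  then have nz: "homogenize a \<noteq> 0" "homogenize c \<noteq> 0" using homogenize_eq_0 by auto
  have k: "coeff (homogenize (euler a)) k = germ_of_mpoly (const (of_nat k)) * coeff (homogenize a) k" for k
    by (rule gcoeff_eqI) (simp add: gcoeff_germ_const_mult gcoeff_coeff_homogenize lookup_euler)
  \<comment> \<open>The Euler derivation multiplies the part of degree \<open>k\<close> by
    \<open>k\<close>, so it cannot raise the degree, and the quotient \<open>c\<close> must have
    degree 0.\<close>
  have "degree (homogenize (euler a)) \<le> degree (homogenize a)"
    by (rule degree_le) (simp add: k coeff_eq_0)
  moreover have "degree (homogenize (euler a)) = degree (homogenize a) + degree (homogenize c)"
    using nz by (simp add: c homogenize_mult degree_mult_eq)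
  ultimately have "degree (homogenize c) = 0" by simp
  then obtain b where b: "homogenize c = [:b:]" by (rule degree_eq_zeroE)
  define m where "m = degree (homogenize a)"
  have bk: "germ_of_mpoly (const (of_nat k)) * coeff (homogenize a) k = b * coeff (homogenize a) k" for k
    unfolding k[symmetric] by (simp add: c homogenize_mult b)
  \<comment> \<open>The leading part has degree \<open>m\<close> and is nonzero, so it determines
    the eigenvalue; parts of any other degree must then vanish.\<close>
  have bm: "b = germ_of_mpoly (const (of_nat m))"
    using bk[of m] nz by (simp add: m_def)
  have "Poly_Mapping.lookup a \<alpha> = 0" if "mdeg \<alpha> \<noteq> m" for \<alpha>
    using arg_cong[OF bk[of "mdeg \<alpha>", unfolded bm], of "\<lambda>g. gcoeff g \<alpha>"] that
    by (simp add: gcoeff_germ_const_mult gcoeff_coeff_homogenize)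
  then have "euler a = const (of_nat m) * a"
    by (intro poly_mapping_eqI) (auto simp: lookup_euler lookup_const_mult)
  then show ?thesis by blast
qed

lemma euler_linear_form: "euler (linear_form v) = linear_form v"
  by (simp add: euler_def mder_linear_form) (simp add: linear_form_def mult.commute)

text \<open>The Euler derivation fixes every linear form, so no denominators remain in
  \<open>dvd_derivation_factor\<close>. This gives homogeneity of the \<open>F k\<close>, which are
  products of several forms in general.\<close>

lemma euler_factor:
  assumes "a dvd (\<Prod>v\<leftarrow>vs. linear_form v)" "0 \<notin> set vs"
  shows "\<exists>m. euler a = const (of_nat m) * a"
  using dvd_derivation_factor[of euler, OF euler_mult assms] by (intro dvd_euler) (simp add: euler_linear_form)

section \<open>Algebraic generators of the module\<close>

definition poly_FS :: "('n::finite, complex) mpoly \<Rightarrow> ('n, 'r) FS" where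
  "poly_FS p = const (mpoly_fract p)"

lemma poly_FS_0 [simp]: "poly_FS 0 = 0" and poly_FS_1 [simp]: "poly_FS 1 = 1"
  and poly_FS_add: "poly_FS (p + q) = poly_FS p + poly_FS q"
  and poly_FS_mult: "poly_FS (p * q) = poly_FS p * poly_FS q"
  by (simp_all add: poly_FS_def mpoly_fract_add mpoly_fract_mult const_add const_mult)

lemma poly_FS_uminus: "poly_FS (- p) = - poly_FS p"
  by (simp add: eq_neg_iff_add_eq_0 flip: poly_FS_add)

lemma poly_FS_sum: "poly_FS (\<Sum>k\<in>A. h k) = (\<Sum>k\<in>A. poly_FS (h k))"
  by (induction A rule: infinite_finite_induct) (simp_all add: poly_FS_add)

lemma scalar_poly_FS: "scalar c = poly_FS (const c)"
  by (simp add: scalar_def poly_FS_def)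

lemma scalar_add: "scalar (a + b) = scalar a + scalar b"
  and scalar_mult: "scalar (a * b) = scalar a * scalar b"
  and scalar_0 [simp]: "scalar 0 = 0" and scalar_1 [simp]: "scalar 1 = 1"
  by (simp_all add: scalar_poly_FS const_add const_mult poly_FS_add poly_FS_mult)

lemma poly_FS_cancel:
  fixes g h :: "('n::finite, 'r) FS"
  assumes "poly_FS p * g = poly_FS p * h" "p \<noteq> 0"
  shows "g = h"
proof -
  have "const (inverse (mpoly_fract p)) * (poly_FS p * g) = const (inverse (mpoly_fract p)) * (poly_FS p * h)"
    using assms(1) by simp
  moreover have "const (inverse (mpoly_fract p)) * poly_FS p = (1 :: ('n, 'r) FS)"
    using assms(2) by (simp add: poly_FS_def mpoly_fract_eq_0_iff flip: const_mult)
  ultimately show ?thesis by (simp flip: mult.assoc)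
qed

lemma partial_1_germ: "partial i 1 = 0"
  by (metis add_cancel_right_right mult.left_neutral mult.right_neutral partial_mult)

lemma mder_1 [simp]: "mder i 1 = 0"
  using mder_const[of i 1] by simp

lemma partial_fract_germ: "partial_fract i (germ_fract a) = germ_fract (partial i a)"
  by (simp add: germ_fract_def partial_fract_Fract partial_1_germ)

lemma partial_fract_mpoly: "partial_fract i (mpoly_fract p) = mpoly_fract (mder i p)"
  by (simp add: mpoly_fract_def partial_fract_germ partial_germ_of_mpoly)

lemma partial_coeffs_poly_FS: "partial_coeffs i (poly_FS p) = poly_FS (mder i p)"
  by (simp add: poly_FS_def partial_coeffs_const partial_fract_mpoly)

lemma partial_coeffs_sum: "partial_coeffs i (\<Sum>k\<in>A. h k) = (\<Sum>k\<in>A. partial_coeffs i (h k))"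
  by (induction A rule: infinite_finite_induct) (simp_all add: partial_coeffs_add partial_coeffs_0)

definition log_der :: "('r \<Rightarrow> ('n::finite, complex) mpoly) \<Rightarrow> 'n \<Rightarrow> 'r \<Rightarrow> ('n, 'r) FS" where
  "log_der F i k = const (partial_fract i (mpoly_fract (F k)) / mpoly_fract (F k))"

definition log_der_sum :: "('r::finite \<Rightarrow> ('n::finite, complex) mpoly) \<Rightarrow> 'n \<Rightarrow> ('n, 'r) FS" where
  "log_der_sum F i = (\<Sum>k\<in>UNIV. log_der F i k * var k)"

lemma partial_FS_log_der: "partial_FS F i h = partial_coeffs i h + h * log_der_sum F i"
  by (simp add: partial_FS_def log_der_sum_def log_der_def)

lemma partial_FS_leibniz: "partial_FS F i (g * h) = partial_coeffs i g * h + g * partial_FS F i h"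
  by (simp add: partial_FS_log_der partial_coeffs_mult algebra_simps)

lemma log_der_mult: "F k \<noteq> 0 \<Longrightarrow> poly_FS (F k) * log_der F i k = poly_FS (mder i (F k))"
  by (simp add: log_der_def poly_FS_def partial_fract_mpoly mpoly_fract_eq_0_iff flip: const_mult)

lemma partial_commute: "partial i (partial j a) = partial j (partial i a)"
  by transfer (auto simp: fun_eq_iff lookup_add lookup_single when_def add_ac)

lemma partial_fract_commute: "partial_fract i (partial_fract j p) = partial_fract j (partial_fract i p)"
proof -
  obtain a b where ab: "p = Fract a b" "b \<noteq> 0" by (cases p) auto
  then have nz: "germ_fract b \<noteq> 0" and e: "germ_fract a = p * germ_fract b"
    by (simp_all add: germ_fract_def Zero_fract_def eq_fract)
  have "partial_fract i (partial_fract j (germ_fract a)) = partial_fract j (partial_fract i (germ_fract a))"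
    "partial_fract i (partial_fract j (germ_fract b)) = partial_fract j (partial_fract i (germ_fract b))"
    by (simp_all add: partial_fract_germ partial_commute)
  then have "partial_fract i (partial_fract j p) * germ_fract b = partial_fract j (partial_fract i p) * germ_fract b"
    unfolding e by (simp add: partial_fract_mult partial_fract_add algebra_simps)
  then show ?thesis using nz by simp
qed

lemma partial_coeffs_commute: "partial_coeffs i (partial_coeffs j h) = partial_coeffs j (partial_coeffs i h)"
  by (rule poly_mapping_eqI) (simp add: partial_coeffs_lookup partial_fract_commute)

text \<open>The logarithmic differential of \<open>F k\<close> is closed: \<open>F k\<close> times
  the derivative is the second derivative of \<open>F k\<close> minus a product of two logarithmic
  derivatives, and both are symmetric in \<open>i\<close> and \<open>j\<close>. Hence the operators
  \<open>partial_FS\<close> commute.\<close>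

lemma partial_log_der: "partial_coeffs i (log_der F j k) = partial_coeffs j (log_der F i k)"
proof (cases "F k = 0")
  case True
  then show ?thesis by (simp add: log_der_def partial_coeffs_0)
next
  case False
  have "poly_FS (F k) * partial_coeffs i (log_der F j k) =
      poly_FS (mder i (mder j (F k))) - poly_FS (F k) * (log_der F i k * log_der F j k)" for i j
  proof -
    have "partial_coeffs i (poly_FS (F k) * log_der F j k) = poly_FS (mder i (mder j (F k)))"
      by (simp only: log_der_mult[where F = F, OF False] partial_coeffs_poly_FS)
    then show ?thesis
      by (simp add: partial_coeffs_mult partial_coeffs_poly_FS algebra_simps flip: log_der_mult[where F = F, OF False])
  qed
  moreover have "mder i (mder j (F k)) = mder j (mder i (F k))"
    by (rule germ_of_mpoly_inject[THEN iffD1])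
      (simp add: partial_commute[of i j] flip: partial_germ_of_mpoly)
  ultimately show ?thesis using poly_FS_cancel False by (metis mult.commute)
qed

lemma partial_FS_commute: "partial_FS F i (partial_FS F j h) = partial_FS F j (partial_FS F i h)"
proof -
  have "partial_coeffs i (log_der_sum F j) = partial_coeffs j (log_der_sum F i)"
    by (simp add: log_der_sum_def partial_coeffs_sum partial_coeffs_mult partial_coeffs_var partial_log_der[of i])
  then show ?thesis
    by (simp add: partial_FS_log_der partial_coeffs_add partial_coeffs_mult algebra_simps partial_coeffs_commute[of i])
qed

text \<open>The counterpart of \<open>generated_by\<close> for differential operators with
  polynomial coefficients.\<close>

inductive_set alg_generated ::
    "('r::finite \<Rightarrow> ('n::finite, complex) mpoly) \<Rightarrow> ('n, 'r) FS \<Rightarrow> ('n, 'r) FS set"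
  for F g where
  gen: "g \<in> alg_generated F g"
| poly: "h \<in> alg_generated F g \<Longrightarrow> poly_FS p * h \<in> alg_generated F g"
| partial: "h \<in> alg_generated F g \<Longrightarrow> partial_FS F i h \<in> alg_generated F g"
| var: "h \<in> alg_generated F g \<Longrightarrow> var k * h \<in> alg_generated F g"
| add: "u \<in> alg_generated F g \<Longrightarrow> v \<in> alg_generated F g \<Longrightarrow> u + v \<in> alg_generated F g"

lemma alg_generated_subset: "alg_generated F g \<subseteq> generated_by F g"
proof
  fix h assume "h \<in> alg_generated F g"
  then show "h \<in> generated_by F g"
  proof induction
    case (poly h p)
    then show ?case unfolding poly_FS_def mpoly_fract_def by (intro generated_by_germ)
  qed (auto intro: generated_by_self generated_by_diffop[OF diffops.partial]
      generated_by_diffop[OF diffops.var] generated_by_add)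
qed

text \<open>Coordinates have weight 1, derivatives weight -1 and the \<open>s\<^sub>k\<close> weight
  0; \<open>w\<close> is the weight given to \<open>g\<close>. There is no rule for sums, so every
  element is homogeneous.\<close>

inductive_set weighted ::
    "('r::finite \<Rightarrow> ('n::finite, complex) mpoly) \<Rightarrow> int \<Rightarrow> ('n, 'r) FS \<Rightarrow> (int \<times> ('n, 'r) FS) set"
  for F w g where
  gen: "(w, g) \<in> weighted F w g"
| coord: "(m, h) \<in> weighted F w g \<Longrightarrow> (m + 1, poly_FS (var i) * h) \<in> weighted F w g"
| partial: "(m, h) \<in> weighted F w g \<Longrightarrow> (m - 1, partial_FS F i h) \<in> weighted F w g"
| var: "(m, h) \<in> weighted F w g \<Longrightarrow> (m, var k * h) \<in> weighted F w g"

lemma weighted_alg_generated: "(m, h) \<in> weighted F w g \<Longrightarrow> h \<in> alg_generated F g"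
  by (induction m h rule: weighted.induct) (auto intro: alg_generated.intros)

text \<open>The Euler derivation of the coefficient \<open>h\<close> alone. Built from
  \<open>partial_FS\<close> it would also produce the factors deg(F k) \<open>s\<^sub>k\<close>
  coming from the symbol, and the eigenvalues would not be numbers.\<close>

definition euler_FS :: "('n::finite, 'r) FS \<Rightarrow> ('n, 'r) FS" where
  "euler_FS h = (\<Sum>i\<in>UNIV. poly_FS (var i) * partial_coeffs i h)"

lemma euler_FS_add: "euler_FS (g + h) = euler_FS g + euler_FS h"
  by (simp add: euler_FS_def partial_coeffs_add distrib_left sum.distrib)

lemma euler_FS_mult: "euler_FS (g * h) = euler_FS g * h + g * euler_FS h"
  by (simp add: euler_FS_def partial_coeffs_mult distrib_left sum.distrib sum_distrib_left
      sum_distrib_right mult_ac)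

lemma euler_FS_poly_FS: "euler_FS (poly_FS p) = poly_FS (euler p)"
  by (simp add: euler_FS_def partial_coeffs_poly_FS euler_def poly_FS_sum poly_FS_mult)

lemma euler_FS_var: "euler_FS (var k) = 0"
  by (simp add: euler_FS_def partial_coeffs_var)

lemma euler_FS_sum: "euler_FS (\<Sum>k\<in>A. h k) = (\<Sum>k\<in>A. euler_FS (h k))"
  by (induction A rule: infinite_finite_induct)
    (simp_all add: euler_FS_add, simp_all add: euler_FS_def partial_coeffs_0)

lemma partial_euler_FS: "partial_coeffs i (euler_FS h) = partial_coeffs i h + euler_FS (partial_coeffs i h)"
proof -
  have "partial_coeffs i (euler_FS h) = (\<Sum>j\<in>UNIV. (if i = j then partial_coeffs j h else 0) +
      poly_FS (var j) * partial_coeffs j (partial_coeffs i h))"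
    unfolding euler_FS_def partial_coeffs_sum
    by (intro sum.cong) (auto simp: partial_coeffs_mult partial_coeffs_poly_FS mder_var partial_coeffs_commute[of i])
  then show ?thesis by (simp add: sum.distrib euler_FS_def)
qed

lemma euler_FS_log_der:
  fixes F :: "'r \<Rightarrow> ('n::finite, complex) mpoly"
  assumes "euler (F k) = const c * F k"
  shows "euler_FS (log_der F i k) = - log_der F i k"
proof (cases "F k = 0")
  case True
  then show ?thesis by (simp add: log_der_def euler_FS_def partial_coeffs_0)
next
  case False
  let ?\<phi> = "poly_FS (F k) :: ('n, 'r) FS" and ?\<omega> = "log_der F i k"
  have m: "?\<phi> * ?\<omega> = partial_coeffs i ?\<phi>" using log_der_mult False by (simp add: partial_coeffs_poly_FS)
  have E: "euler_FS ?\<phi> = scalar c * ?\<phi>" by (simp add: euler_FS_poly_FS assms scalar_poly_FS poly_FS_mult)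
  have "partial_coeffs i (scalar c * ?\<phi>) = scalar c * (?\<phi> * ?\<omega>)"
    by (simp add: partial_coeffs_mult partial_coeffs_scalar m)
  then have "scalar c * (?\<phi> * ?\<omega>) = ?\<phi> * ?\<omega> + euler_FS (?\<phi> * ?\<omega>)"
    using partial_euler_FS[of i ?\<phi>] by (simp add: E m)
  then have "?\<phi> * euler_FS ?\<omega> = ?\<phi> * (- ?\<omega>)"
    by (simp add: euler_FS_mult E algebra_simps eq_neg_iff_add_eq_0)
  then show ?thesis by (rule poly_FS_cancel) (fact False)
qed

text \<open>Weights are Euler eigenvalues: the commutator of a partial derivative with the Euler
  derivation is that partial derivative, and logarithmic derivatives of the homogeneous
  \<open>F k\<close> have weight -1.\<close>

lemma weighted_euler:
  assumes F: "\<And>k. \<exists>c. euler (F k) = const c * F k" and "euler_FS g = scalar (of_int w) * g"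
    and "(m, h) \<in> weighted F w g"
  shows "euler_FS h = scalar (of_int m) * h"
  using assms(3)
proof (induction m h rule: weighted.induct)
  case gen
  show ?case by fact
next
  case (coord m h i)
  have "euler (var i) = var i"
    using euler_linear_form[of "axis i 1"] by (simp add: linear_form_axis)
  then show ?case by (simp add: euler_FS_mult euler_FS_poly_FS coord scalar_add algebra_simps)
next
  case (partial m h i)
  have "euler_FS (log_der F i k) = - log_der F i k" for k
  proof -
    obtain c where "euler (F k) = const c * F k" using F[of k] by blast
    then show ?thesis by (rule euler_FS_log_der)
  qed
  then have e1: "euler_FS (log_der_sum F i) = - log_der_sum F i"
    by (simp add: log_der_sum_def euler_FS_sum euler_FS_mult euler_FS_var sum_negf)
  have e2: "euler_FS (partial_coeffs i h) = scalar (of_int m) * partial_coeffs i h - partial_coeffs i h"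
    using partial_euler_FS[of i h] by (simp add: partial partial_coeffs_mult partial_coeffs_scalar algebra_simps)
  have e3: "scalar (of_int (m - 1)) = (scalar (of_int m) - 1 :: ('b, 'a) FS)"
    by (simp add: scalar_diff_1)
  show ?case
    unfolding partial_FS_log_der euler_FS_add euler_FS_mult partial e1 e2 e3 by (simp add: algebra_simps)
next
  case (var m h k)
  then show ?case by (simp add: euler_FS_mult euler_FS_var)
qed

section \<open>Denominators of weighted elements\<close>

definition integral_FS :: "('n::finite, 'r) FS \<Rightarrow> bool" where
  "integral_FS h \<longleftrightarrow> (\<forall>\<beta>. \<exists>a. Poly_Mapping.lookup h \<beta> = germ_fract a)"

lemma germ_fract_0 [simp]: "germ_fract 0 = 0"
  by (simp add: germ_fract_def Zero_fract_def)

lemma germ_fract_diff: "germ_fract (a - b) = germ_fract a - germ_fract b"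
  by (simp add: germ_fract_def)

lemma integral_FS_add: "integral_FS g \<Longrightarrow> integral_FS h \<Longrightarrow> integral_FS (g + h)"
  unfolding integral_FS_def lookup_add by (metis germ_fract_add)

lemma integral_FS_diff: "integral_FS g \<Longrightarrow> integral_FS h \<Longrightarrow> integral_FS (g - h)"
  unfolding integral_FS_def lookup_minus by (metis germ_fract_diff)

lemma integral_FS_germ_mult: "integral_FS h \<Longrightarrow> integral_FS (const (germ_fract a) * h)"
  unfolding integral_FS_def lookup_const_mult by (metis germ_fract_mult)

lemma integral_FS_poly_mult: "integral_FS h \<Longrightarrow> integral_FS (poly_FS p * h)"
  unfolding poly_FS_def mpoly_fract_def by (rule integral_FS_germ_mult)

lemma integral_FS_var_mult: "integral_FS h \<Longrightarrow> integral_FS (var k * h)"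
  unfolding integral_FS_def lookup_var_mult by (metis germ_fract_0)

lemma integral_FS_partial: "integral_FS h \<Longrightarrow> integral_FS (partial_coeffs i h)"
  unfolding integral_FS_def partial_coeffs_lookup by (metis partial_fract_germ)

lemma integral_FS_sum: "(\<And>k. k \<in> A \<Longrightarrow> integral_FS (h k)) \<Longrightarrow> integral_FS (\<Sum>k\<in>A. h k)"
proof (induction A rule: infinite_finite_induct)
  case empty
  show ?case by (auto simp: integral_FS_def intro: exI[of _ 0])
next
  case (infinite A)
  then show ?case by (auto simp: integral_FS_def intro: exI[of _ 0])
qed (auto intro: integral_FS_add)

lemma integral_FS_poly: "integral_FS (poly_FS p)"
  unfolding integral_FS_def poly_FS_def mpoly_fract_def const_def lookup_single when_def
  by (metis germ_fract_0)

text \<open>Each \<open>partial_FS\<close> costs at most one further factor \<open>f\<close>,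
  because \<open>F k\<close> divides \<open>f\<close> and so
  \<open>poly_FS f * log_der F i k\<close> is a polynomial.\<close>

lemma weighted_integral:
  assumes f: "f \<noteq> 0" "\<And>k. F k dvd f" and g: "integral_FS g" and "(m, h) \<in> weighted F w g"
  shows "\<exists>K. integral_FS (poly_FS (f ^ K) * h)"
  using assms(4)
proof (induction m h rule: weighted.induct)
  case gen
  show ?case using g by (intro exI[of _ 0]) simp
next
  case (coord m h i)
  then obtain K where "integral_FS (poly_FS (f ^ K) * h)" by blast
  from integral_FS_poly_mult[OF this, of "var i"] show ?case
    by (auto simp: mult_ac)
next
  case (var m h k)
  then obtain K where "integral_FS (poly_FS (f ^ K) * h)" by blast
  from integral_FS_var_mult[OF this, of k] show ?case
    by (auto simp: mult_ac)
next
  case (partial m h i)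
  then obtain K where K: "integral_FS (poly_FS (f ^ K) * h)" by blast
  have "integral_FS (poly_FS (f ^ K) * h * (poly_FS f * (log_der F i k * var k)))" for k
  proof -
    obtain c where c: "f = F k * c" using f(2)[of k] by (elim dvdE)
    then have "F k \<noteq> 0" using f(1) by auto
    then have "poly_FS f * log_der F i k = poly_FS (c * mder i (F k))"
      by (simp add: c poly_FS_mult mult_ac flip: log_der_mult)
    have "poly_FS (f ^ K) * h * (poly_FS f * (log_der F i k * var k)) =
        (poly_FS f * log_der F i k) * (var k * (poly_FS (f ^ K) * h))"
      by (simp only: mult_ac)
    also have "\<dots> = poly_FS (c * mder i (F k)) * (var k * (poly_FS (f ^ K) * h))"
      using \<open>poly_FS f * log_der F i k = _\<close> by simp
    finally have "poly_FS (f ^ K) * h * (poly_FS f * (log_der F i k * var k)) = \<dots>" .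
    then show ?thesis using integral_FS_poly_mult[OF integral_FS_var_mult[OF K]] by simp
  qed
  then have 1: "integral_FS (poly_FS (f ^ K) * h * (poly_FS f * log_der_sum F i))"
    unfolding log_der_sum_def sum_distrib_left by (intro integral_FS_sum)
  have 2: "integral_FS (poly_FS f * partial_coeffs i (poly_FS (f ^ K) * h))"
    by (intro integral_FS_poly_mult integral_FS_partial K)
  have mf: "f * mder i (f ^ K) = of_nat K * mder i f * f ^ K"
    by (induction K) (simp_all add: mder_mult algebra_simps)
  have 3: "integral_FS (poly_FS (of_nat K * mder i f) * (poly_FS (f ^ K) * h))"
    by (intro integral_FS_poly_mult K)
  have "poly_FS (f ^ Suc K) * partial_FS F i h =
      poly_FS f * partial_coeffs i (poly_FS (f ^ K) * h) -
      poly_FS (of_nat K * mder i f) * (poly_FS (f ^ K) * h) +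
      poly_FS (f ^ K) * h * (poly_FS f * log_der_sum F i)"
    unfolding partial_FS_log_der partial_coeffs_mult partial_coeffs_poly_FS
    using arg_cong[OF mf, of "poly_FS :: _ \<Rightarrow> ('a, 'b) FS"] by (simp add: poly_FS_mult algebra_simps)
  moreover have "integral_FS \<dots>" by (intro integral_FS_add integral_FS_diff 1 2 3)
  ultimately show ?case by metis
qed

text \<open>The degree is an integer because the complementary weight may be negative; the part is
  then 0. Only finitely many exponents have a given degree, so the part of a germ is a
  polynomial.\<close>

definition homogeneous_part :: "int \<Rightarrow> 'n::finite germ \<Rightarrow> ('n, complex) mpoly" where
  "homogeneous_part e a = (\<Sum>\<alpha> | int (mdeg \<alpha>) = e. Poly_Mapping.single \<alpha> (gcoeff a \<alpha>))"

lemma lookup_homogeneous_part: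
  fixes a :: "'n::finite germ"
  shows "Poly_Mapping.lookup (homogeneous_part e a) \<alpha> = (if int (mdeg \<alpha>) = e then gcoeff a \<alpha> else 0)"
proof -
  have "finite {\<alpha> :: 'n \<Rightarrow>\<^sub>0 nat. int (mdeg \<alpha>) = e}"
    by (rule finite_subset[OF _ finite_mdeg_le[of "nat e"]]) auto
  then show ?thesis
    by (simp add: homogeneous_part_def lookup_sum lookup_single when_def sum.delta)
qed

lemma homogeneous_part_mult:
  assumes b: "\<And>\<gamma>. gcoeff b \<gamma> \<noteq> 0 \<Longrightarrow> int (mdeg \<gamma>) = m"
  shows "germ_of_mpoly (homogeneous_part e (a * b)) = germ_of_mpoly (homogeneous_part (e - m) a) * b"
proof (rule gcoeff_eqI)
  fix \<alpha>
  have "(if int (mdeg \<alpha>) = e then \<Sum>(\<beta>, \<gamma>)\<in>splits \<alpha>. gcoeff a \<beta> * gcoeff b \<gamma> else 0) =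
      (\<Sum>(\<beta>, \<gamma>)\<in>splits \<alpha>. if int (mdeg \<alpha>) = e then gcoeff a \<beta> * gcoeff b \<gamma> else 0)"
    by (simp add: case_prod_unfold)
  also have "\<dots> = (\<Sum>(\<beta>, \<gamma>)\<in>splits \<alpha>. (if int (mdeg \<beta>) = e - m then gcoeff a \<beta> else 0) * gcoeff b \<gamma>)"
  proof (intro sum.cong refl, clarify)
    fix \<beta> \<gamma> assume "(\<beta>, \<gamma>) \<in> splits \<alpha>"
    then have "mdeg \<alpha> = mdeg \<beta> + mdeg \<gamma>" by (auto simp: splits_def mdeg_add)
    then show "(if int (mdeg \<alpha>) = e then gcoeff a \<beta> * gcoeff b \<gamma> else 0) =
        (if int (mdeg \<beta>) = e - m then gcoeff a \<beta> else 0) * gcoeff b \<gamma>"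
      using b[of \<gamma>] by (cases "gcoeff b \<gamma> = 0") auto
  qed
  finally show "gcoeff (germ_of_mpoly (homogeneous_part e (a * b))) \<alpha> =
      gcoeff (germ_of_mpoly (homogeneous_part (e - m) a) * b) \<alpha>"
    by (simp only: gcoeff_germ_of_mpoly lookup_homogeneous_part times_germ.rep_eq)
qed

lemma homogeneous_part_add: "homogeneous_part e (a + b) = homogeneous_part e a + homogeneous_part e b"
  by (rule poly_mapping_eqI) (simp add: lookup_homogeneous_part lookup_add plus_germ.rep_eq)

lemma homogeneous_part_0: "homogeneous_part e 0 = 0"
  by (rule poly_mapping_eqI) (simp add: lookup_homogeneous_part zero_germ.rep_eq)

lemma gcoeff_germ_var_mult:
  fixes a :: "'n::finite germ"
  shows "gcoeff (germ_of_mpoly (var i) * a) \<alpha> =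
    (if Poly_Mapping.lookup \<alpha> i = 0 then 0 else gcoeff a (\<alpha> - Poly_Mapping.single i 1))"
proof -
  let ?e = "Poly_Mapping.single i (1::nat)"
  have "(\<Sum>(\<beta>, \<gamma>)\<in>splits \<alpha>. Poly_Mapping.lookup (var i :: ('n, complex) mpoly) \<beta> * gcoeff a \<gamma>) =
      (\<Sum>(\<beta>, \<gamma>)\<in>splits \<alpha> \<inter> {(?e, \<alpha> - ?e)}. Poly_Mapping.lookup (var i :: ('n, complex) mpoly) \<beta> * gcoeff a \<gamma>)"
    by (rule sum.mono_neutral_right[OF finite_splits])
      (auto simp: splits_def var_def lookup_single when_def split: if_splits)
  moreover have "splits \<alpha> \<inter> {(?e, \<alpha> - ?e)} = (if Poly_Mapping.lookup \<alpha> i = 0 then {} else {(?e, \<alpha> - ?e)})"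
  proof -
    have "?e + (\<alpha> - ?e) = \<alpha> \<longleftrightarrow> Poly_Mapping.lookup \<alpha> i \<noteq> 0"
    proof
      assume "?e + (\<alpha> - ?e) = \<alpha>"
      then have "Poly_Mapping.lookup (?e + (\<alpha> - ?e)) i = Poly_Mapping.lookup \<alpha> i" by simp
      then show "Poly_Mapping.lookup \<alpha> i \<noteq> 0" by (simp add: lookup_add)
    qed (auto intro!: poly_mapping_eqI simp: lookup_add lookup_minus lookup_single when_def)
    then show ?thesis by (auto simp: splits_def)
  qed
  ultimately show ?thesis
    by (simp add: times_germ.rep_eq var_def)
qed

lemma germ_homogeneous:
  fixes b :: "'n::finite germ"
  assumes "(\<Sum>i\<in>UNIV. mpoly_fract (var i) * partial_fract i (germ_fract b)) =
      mpoly_fract (const (of_int m)) * germ_fract b"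
    and "gcoeff b \<alpha> \<noteq> 0"
  shows "int (mdeg \<alpha>) = m"
proof -
  have inj: "a = c" if "germ_fract a = germ_fract c" for a c :: "'n germ"
    using that by (simp add: germ_fract_def eq_fract)
  have "germ_fract (\<Sum>i\<in>B. germ_of_mpoly (var i) * partial i b) =
      (\<Sum>i\<in>B. mpoly_fract (var i) * partial_fract i (germ_fract b))" for B
    by (induction B rule: infinite_finite_induct)
      (simp_all add: germ_fract_add germ_fract_mult partial_fract_germ mpoly_fract_def)
  then have "germ_fract (\<Sum>i\<in>UNIV. germ_of_mpoly (var i) * partial i b) =
      germ_fract (germ_of_mpoly (const (of_int m)) * b)"
    using assms(1) by (simp add: germ_fract_mult mpoly_fract_def)
  then have "(\<Sum>i\<in>UNIV. germ_of_mpoly (var i) * partial i b) = germ_of_mpoly (const (of_int m)) * b"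
    by (rule inj)
  then have "gcoeff (\<Sum>i\<in>UNIV. germ_of_mpoly (var i) * partial i b) \<alpha> = of_int m * gcoeff b \<alpha>"
    by (simp add: gcoeff_germ_const_mult)
  moreover have "gcoeff (\<Sum>i\<in>B. g i) \<alpha> = (\<Sum>i\<in>B. gcoeff (g i) \<alpha>)" for B and g :: "'n \<Rightarrow> 'n germ"
    by (induction B rule: infinite_finite_induct) (simp_all add: zero_germ.rep_eq plus_germ.rep_eq)
  moreover have "gcoeff (germ_of_mpoly (var i) * partial i b) \<alpha> = of_nat (Poly_Mapping.lookup \<alpha> i) * gcoeff b \<alpha>" for i
  proof -
    have "\<alpha> - Poly_Mapping.single i 1 + Poly_Mapping.single i 1 = \<alpha>" if "Poly_Mapping.lookup \<alpha> i \<noteq> 0"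
      using that by (intro poly_mapping_eqI) (auto simp: lookup_add lookup_minus lookup_single when_def)
    then show ?thesis unfolding gcoeff_germ_var_mult partial.rep_eq by (auto simp: lookup_minus)
  qed
  ultimately have "of_nat (mdeg \<alpha>) * gcoeff b \<alpha> = of_int m * gcoeff b \<alpha>"
    by (simp add: mdeg_def sum_distrib_right)
  then have "of_int (int (mdeg \<alpha>)) = (of_int m :: complex)" using assms(2) by simp
  then show ?thesis by (simp only: of_int_eq_iff)
qed

text \<open>
  In a representation of \<open>1\<close> by homogeneous elements the coefficients may be replaced by their
  homogeneous parts of complementary weight, which are polynomials: clear the denominators and
  compare Taylor coefficients.
\<close>

lemma one_homogeneous_coeffs:
  fixes js :: "('n::finite germ \<times> int \<times> ('n, 'r) FS) list"
  assumes f: "f \<noteq> 0" "euler f = const (of_nat d) * f"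
    and one: "(\<Sum>(a, m, q)\<leftarrow>js. const (germ_fract a) * q) = 1"
    and js: "\<And>a m q. (a, m, q) \<in> set js \<Longrightarrow> euler_FS q = scalar (of_int m) * q \<and> (\<exists>K. integral_FS (poly_FS (f ^ K) * q))"
  shows "(\<Sum>(a, m, q)\<leftarrow>js. poly_FS (homogeneous_part (- m) a) * q) = 1"
proof -
  have "\<exists>K. \<forall>(a, m, q)\<in>set js'. integral_FS (poly_FS (f ^ K) * q)" if "set js' \<subseteq> set js" for js'
    using that
  proof (induction js')
    case (Cons j js')
    obtain a m q where j: "j = (a, m, q)" by (cases j)
    obtain K where K: "\<forall>(a, m, q)\<in>set js'. integral_FS (poly_FS (f ^ K) * q)" using Cons by auto
    obtain L where L: "integral_FS (poly_FS (f ^ L) * q)" using js[of a m q] Cons.prems j by auto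
    have mono: "integral_FS (poly_FS (f ^ (M + N)) * q)" if "integral_FS (poly_FS (f ^ N) * q)" for M N and q :: "('n, 'r) FS"
      using integral_FS_poly_mult[OF that, of "f ^ M"] by (simp add: power_add poly_FS_mult mult.assoc)
    show ?case
      using K L mono[where M = L and N = K] mono[where M = K and N = L]
      by (intro exI[of _ "K + L"]) (auto simp: j add.commute)
  qed auto
  from this[of js] obtain K where "\<forall>(a, m, q)\<in>set js. integral_FS (poly_FS (f ^ K) * q)" by auto
  then have K: "integral_FS (poly_FS (f ^ K) * q)" if "(a, m, q) \<in> set js" for a m q using that by auto
  have eulerf: "euler (f ^ N) = const (of_nat (d * N)) * f ^ N" for N
  proof (induction N)
    case 0
    show ?case by (simp add: euler_def)
  qed (simp add: euler_mult f const_add algebra_simps)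
  have coeff: "\<exists>b. Poly_Mapping.lookup (poly_FS (f ^ K) * q) \<beta> = germ_fract b \<and>
      (\<forall>\<gamma>. gcoeff b \<gamma> \<noteq> 0 \<longrightarrow> int (mdeg \<gamma>) = m + int (d * K))" if j: "(a, m, q) \<in> set js" for a m q \<beta>
  proof -
    obtain b where b: "Poly_Mapping.lookup (poly_FS (f ^ K) * q) \<beta> = germ_fract b"
      using K[OF j] by (auto simp: integral_FS_def)
    have "euler_FS (poly_FS (f ^ K) * q) = scalar (of_int (m + int (d * K))) * (poly_FS (f ^ K) * q)"
      using js[OF j] by (simp add: euler_FS_mult euler_FS_poly_FS eulerf poly_FS_mult scalar_add
          flip: scalar_poly_FS) (simp add: algebra_simps)
    from arg_cong[OF this, of "\<lambda>h. Poly_Mapping.lookup h \<beta>"]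
    have "(\<Sum>i\<in>UNIV. mpoly_fract (var i) * partial_fract i (germ_fract b)) =
        mpoly_fract (const (of_int (m + int (d * K)))) * germ_fract b"
      unfolding scalar_def lookup_const_mult b
      by (simp add: euler_FS_def lookup_sum lookup_const_mult partial_coeffs_lookup b
          poly_FS_def[of "var _"])
    from germ_homogeneous[OF this] b show ?thesis by blast
  qed
  have inj: "a = c" if "germ_fract a = germ_fract c" for a c :: "'n germ"
    using that by (simp add: germ_fract_def eq_fract)
  \<comment> \<open>After multiplication by \<open>f ^ K\<close> the coefficients of
    \<open>q\<close> are homogeneous germs of degree \<open>m + d * K\<close>. Taking parts of
    degree \<open>d * K\<close> in the products thus amounts to taking the part of degree
    \<open>- m\<close> of each \<open>a\<close>.\<close>
  have hom: "\<exists>u. Poly_Mapping.lookup (poly_FS (f ^ K) * (\<Sum>(a, m, q)\<leftarrow>js'. const (germ_fract a) * q)) \<beta> = germ_fract u \<and>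
      Poly_Mapping.lookup (poly_FS (f ^ K) * (\<Sum>(a, m, q)\<leftarrow>js'. poly_FS (homogeneous_part (- m) a) * q)) \<beta> =
      mpoly_fract (homogeneous_part (int (d * K)) u)" if "set js' \<subseteq> set js" for js' \<beta>
    using that
  proof (induction js')
    case Nil
    show ?case by (intro exI[of _ 0]) (simp add: homogeneous_part_0)
  next
    case (Cons j js')
    obtain a m q where j: "j = (a, m, q)" by (cases j)
    obtain b where b: "Poly_Mapping.lookup (poly_FS (f ^ K) * q) \<beta> = germ_fract b"
      "\<forall>\<gamma>. gcoeff b \<gamma> \<noteq> 0 \<longrightarrow> int (mdeg \<gamma>) = m + int (d * K)"
      using coeff[of a m q \<beta>] Cons.prems j by auto
    obtain u where u: "Poly_Mapping.lookup (poly_FS (f ^ K) * (\<Sum>(a, m, q)\<leftarrow>js'. const (germ_fract a) * q)) \<beta> = germ_fract u"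
      "Poly_Mapping.lookup (poly_FS (f ^ K) * (\<Sum>(a, m, q)\<leftarrow>js'. poly_FS (homogeneous_part (- m) a) * q)) \<beta> =
      mpoly_fract (homogeneous_part (int (d * K)) u)"
      using Cons by auto
    have "Poly_Mapping.lookup (poly_FS (f ^ K) * (const c * q)) \<beta> = c * germ_fract b" for c
      unfolding mult.left_commute[of _ "const c"] lookup_const_mult b ..
    moreover have "germ_of_mpoly (homogeneous_part (int (d * K)) (a * b)) = germ_of_mpoly (homogeneous_part (- m) a) * b"
      using homogeneous_part_mult[of b "m + int (d * K)" "int (d * K)" a] b(2) by simp
    ultimately show ?case
      using u by (intro exI[of _ "a * b + u"])
        (simp add: j distrib_left lookup_add homogeneous_part_add mpoly_fract_add germ_fract_add
          germ_fract_mult poly_FS_def[of "homogeneous_part _ _"], simp add: mpoly_fract_def germ_fract_mult)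
  qed
  have "poly_FS (f ^ K) * (\<Sum>(a, m, q)\<leftarrow>js. poly_FS (homogeneous_part (- m) a) * q) = poly_FS (f ^ K) * 1"
  proof (rule poly_mapping_eqI)
    fix \<beta>
    obtain u where u: "Poly_Mapping.lookup (poly_FS (f ^ K)) \<beta> = germ_fract u"
      "Poly_Mapping.lookup (poly_FS (f ^ K) * (\<Sum>(a, m, q)\<leftarrow>js. poly_FS (homogeneous_part (- m) a) * q)) \<beta> =
      mpoly_fract (homogeneous_part (int (d * K)) u)"
      using hom[of js \<beta>] one by auto
    have "u = (if \<beta> = 0 then germ_of_mpoly (f ^ K) else 0)"
      by (rule inj) (use u(1) in \<open>auto simp: poly_FS_def const_def lookup_single when_def mpoly_fract_def\<close>)
    \<comment> \<open>The right-hand side \<open>f ^ K\<close> is itself homogeneous of degree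
      \<open>d * K\<close> and so is not changed.\<close>
    moreover have "homogeneous_part (int (d * K)) (germ_of_mpoly (f ^ K)) = f ^ K"
    proof (rule poly_mapping_eqI)
      fix \<alpha>
      have "of_nat (mdeg \<alpha>) * Poly_Mapping.lookup (f ^ K) \<alpha> = of_nat (d * K) * Poly_Mapping.lookup (f ^ K) \<alpha>"
        unfolding lookup_euler[symmetric] eulerf by (rule lookup_const_mult)
      then have "mdeg \<alpha> = d * K \<or> Poly_Mapping.lookup (f ^ K) \<alpha> = 0"
        using of_nat_eq_iff[where 'a = complex] by (metis mult_right_cancel)
      then show "Poly_Mapping.lookup (homogeneous_part (int (d * K)) (germ_of_mpoly (f ^ K))) \<alpha> = Poly_Mapping.lookup (f ^ K) \<alpha>"
        by (auto simp: lookup_homogeneous_part)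
    qed
    ultimately show "Poly_Mapping.lookup (poly_FS (f ^ K) * (\<Sum>(a, m, q)\<leftarrow>js. poly_FS (homogeneous_part (- m) a) * q)) \<beta> =
        Poly_Mapping.lookup (poly_FS (f ^ K) * 1) \<beta>"
      unfolding u(2) by (auto simp: poly_FS_def const_def lookup_single when_def homogeneous_part_0)
  qed
  then show ?thesis
  proof (rule poly_FS_cancel)
    show "f ^ K \<noteq> 0" by (induction K) (use f(1) in \<open>auto simp: mpoly_mult_eq_0_iff\<close>)
  qed
qed

text \<open>The weights do not enter the sum; they are carried along so that
  \<open>one_homogeneous_coeffs\<close> can be applied to the list.\<close>

definition germ_span :: "(int \<times> ('n::finite, 'r) FS) set \<Rightarrow> ('n, 'r) FS set" where
  "germ_span M = {\<Sum>(a, m, q)\<leftarrow>js. const (germ_fract a) * q |js. \<forall>(a, m, q)\<in>set js. (m, q) \<in> M}"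

lemma germ_span_0: "0 \<in> germ_span M"
  unfolding germ_span_def by (auto intro!: exI[of _ "[]"])

lemma germ_span_add: "x \<in> germ_span M \<Longrightarrow> y \<in> germ_span M \<Longrightarrow> x + y \<in> germ_span M"
  unfolding germ_span_def
proof (clarify, goal_cases)
  case (1 js ks)
  then show ?case by (intro exI[of _ "js @ ks"]) auto
qed

lemma germ_span_sum: "(\<And>k. k \<in> A \<Longrightarrow> h k \<in> germ_span M) \<Longrightarrow> (\<Sum>k\<in>A. h k) \<in> germ_span M"
  by (induction A rule: infinite_finite_induct) (auto intro: germ_span_add germ_span_0)

lemma germ_span_gen: "(m, q) \<in> M \<Longrightarrow> const (germ_fract a) * q \<in> germ_span M"
  unfolding germ_span_def by (auto intro!: exI[of _ "[(a, m, q)]"])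

lemma germ_span_map:
  assumes P: "\<And>x y. P (x + y) = P x + P y"
    and gen: "\<And>a m q. (m, q) \<in> M \<Longrightarrow> P (const (germ_fract a) * q) \<in> germ_span M'"
    and x: "x \<in> germ_span M"
  shows "P x \<in> germ_span M'"
proof -
  have P0: "P 0 = 0" using P[of 0 0] by simp
  obtain js where js: "x = (\<Sum>(a, m, q)\<leftarrow>js. const (germ_fract a) * q)" "\<forall>(a, m, q)\<in>set js. (m, q) \<in> M"
    using x unfolding germ_span_def by blast
  from js(2) have "P (\<Sum>(a, m, q)\<leftarrow>js. const (germ_fract a) * q) \<in> germ_span M'"
    by (induction js) (auto simp: P0 P germ_span_0 intro!: germ_span_add gen)
  then show ?thesis by (simp add: js(1))
qed

text \<open>By the Leibniz rule germs can be moved to the left of all other operators, and what then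
  acts on \<open>g\<close> is built from monomials in derivatives and the
  \<open>s\<^sub>k\<close>.\<close>

lemma generated_by_germ_span: "generated_by F g \<subseteq> germ_span (weighted F w g)"
proof
  let ?M = "germ_span (weighted F w g)"
  fix h assume "h \<in> generated_by F g"
  then obtain P where P: "P \<in> diffops F" "h = P g" by (auto simp: generated_by_def)
  have "P x \<in> ?M" if "x \<in> ?M" for x
    using P(1) that
  proof (induction arbitrary: x)
    case (germ a)
    show ?case
    proof (rule germ_span_map[OF _ _ germ])
      fix b m q assume "(m, q) \<in> weighted F w g"
      then have "const (germ_fract (a * b)) * q \<in> ?M" by (rule germ_span_gen)
      then show "const (germ_fract a) * (const (germ_fract b) * q) \<in> ?M"
        by (simp add: germ_fract_mult const_mult mult.assoc)
    qed (simp add: distrib_left)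
  next
    case (partial i)
    show ?case
    proof (rule germ_span_map[OF partial_FS_add _ partial])
      fix a m q assume *: "(m, q) \<in> weighted F w g"
      have "partial_FS F i (const (germ_fract a) * q) =
          const (germ_fract (Defs.partial i a)) * q + const (germ_fract a) * partial_FS F i q"
        by (simp add: partial_FS_leibniz partial_coeffs_const partial_fract_germ)
      also have "\<dots> \<in> ?M" by (intro germ_span_add germ_span_gen[OF *] germ_span_gen[OF weighted.partial[OF *]])
      finally show "partial_FS F i (const (germ_fract a) * q) \<in> ?M" .
    qed
  next
    case (var k)
    show ?case
    proof (rule germ_span_map[OF _ _ var])
      fix a m q assume *: "(m, q) \<in> weighted F w g"
      show "var k * (const (germ_fract a) * q) \<in> ?M"
        unfolding mult.left_commute[of "var k"] by (rule germ_span_gen[OF weighted.var[OF *]])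
    qed (simp add: distrib_left)
  qed (auto intro: germ_span_add)
  moreover have "g \<in> ?M"
  proof -
    have "const (germ_fract 1) * g \<in> ?M" by (rule germ_span_gen[OF weighted.gen])
    then show ?thesis by (simp add: germ_fract_def flip: One_fract_def)
  qed
  ultimately show "h \<in> ?M" by (simp add: P(2))
qed

lemma alg_generated_0: "0 \<in> alg_generated F g"
  using alg_generated.poly[OF alg_generated.gen, of 0] by simp

lemma f_FS_poly: "f_FS F = poly_FS (prod_F F)"
  by (simp add: f_FS_def poly_FS_def)

lemma factor_dvd_prod_F: "F k dvd prod_F F"
  by (simp add: prod_F_def dvd_prodI)

text \<open>Both summands of the relation are germ combinations of homogeneous elements of
  \<open>R\<close>, the set of its admissible algebraic right-hand sides; the factors
  \<open>var k - scalar (A $ k)\<close> have weight 0 and preserve homogeneity. Replacing the germs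
  by polynomials does not leave \<open>R\<close>, which is closed under sums and polynomial
  multiples.\<close>

lemma generated_one_algebraic:
  fixes F :: "'r::finite \<Rightarrow> ('n::finite, complex) mpoly"
  assumes F: "prod_F F \<noteq> 0" "\<And>k. \<exists>m. euler (F k) = const (of_nat m) * F k"
      "euler (prod_F F) = const (of_nat d) * prod_F F"
    and one: "1 = n + (\<Sum>k\<in>UNIV. (var k - scalar (A $ k)) * m k)"
      "n \<in> generated_by F (f_FS F)" "\<And>k. m k \<in> DFS F"
  obtains n' m' where "1 = n' + (\<Sum>k\<in>UNIV. (var k - scalar (A $ k)) * m' k)"
    "n' \<in> alg_generated F (f_FS F)" "\<And>k. m' k \<in> alg_generated F 1"
proof -
  define R where "R = {n' + (\<Sum>k\<in>UNIV. (var k - scalar (A $ k)) * m' k) |n' m'.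
    n' \<in> alg_generated F (f_FS F) \<and> (\<forall>k. m' k \<in> alg_generated F 1)}"
  define M where "M = {(w, q). q \<in> R \<and> euler_FS q = scalar (of_int w) * q \<and>
    (\<exists>K. integral_FS (poly_FS (prod_F F ^ K) * q))}"
  have RI: "n' + (\<Sum>k\<in>UNIV. (var k - scalar (A $ k)) * m' k) \<in> R"
    if "n' \<in> alg_generated F (f_FS F)" "\<And>k. m' k \<in> alg_generated F 1" for n' m'
    unfolding R_def using that by blast
  have R_add: "u + v \<in> R" if uv: "u \<in> R" "v \<in> R" for u v
  proof -
    obtain n1 m1 n2 m2 where
      1: "u = n1 + (\<Sum>k\<in>UNIV. (var k - scalar (A $ k)) * m1 k)" "n1 \<in> alg_generated F (f_FS F)" "\<forall>k. m1 k \<in> alg_generated F 1" and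
      2: "v = n2 + (\<Sum>k\<in>UNIV. (var k - scalar (A $ k)) * m2 k)" "n2 \<in> alg_generated F (f_FS F)" "\<forall>k. m2 k \<in> alg_generated F 1"
      using uv unfolding R_def by blast
    have "u + v = (n1 + n2) + (\<Sum>k\<in>UNIV. (var k - scalar (A $ k)) * (m1 k + m2 k))"
      by (simp add: 1 2 distrib_left sum.distrib)
    also have "\<dots> \<in> R" by (intro RI alg_generated.add) (use 1 2 in auto)
    finally show ?thesis .
  qed
  have R_poly: "poly_FS p * u \<in> R" if u: "u \<in> R" for p u
  proof -
    obtain n1 m1 where
      1: "u = n1 + (\<Sum>k\<in>UNIV. (var k - scalar (A $ k)) * m1 k)" "n1 \<in> alg_generated F (f_FS F)" "\<forall>k. m1 k \<in> alg_generated F 1"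
      using u unfolding R_def by blast
    have "poly_FS p * u = poly_FS p * n1 + (\<Sum>k\<in>UNIV. (var k - scalar (A $ k)) * (poly_FS p * m1 k))"
      by (simp add: 1 distrib_left sum_distrib_left mult.left_commute)
    also have "\<dots> \<in> R" by (intro RI alg_generated.poly) (use 1 in auto)
    finally show ?thesis .
  qed
  have R_n: "q \<in> R" if "q \<in> alg_generated F (f_FS F)" for q
    using RI[of q "\<lambda>_. 0"] that by (simp add: alg_generated_0)
  have R_m: "(var k - scalar (A $ k)) * q \<in> R" if "q \<in> alg_generated F 1" for k q
  proof -
    have "0 + (\<Sum>j\<in>UNIV. (var j - scalar (A $ j)) * (if j = k then q else 0)) \<in> R"
      by (intro RI) (auto simp: alg_generated_0 that)
    also have "(\<Sum>j\<in>UNIV. (var j - scalar (A $ j)) * (if j = k then q else 0)) = (var k - scalar (A $ k)) * q"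
      by (simp add: if_distrib cong: if_cong)
    finally show ?thesis by simp
  qed
  have e1: "euler_FS 1 = scalar (of_int 0) * (1 :: ('n, 'r) FS)"
    using euler_FS_poly_FS[of 1] by (simp add: euler_def)
  have ef: "euler_FS (f_FS F) = scalar (of_int (int d)) * f_FS F"
    by (simp add: f_FS_poly euler_FS_poly_FS F(3) poly_FS_mult scalar_poly_FS)
  have Fk: "\<exists>c. euler (F k) = const c * F k" for k using F(2) by blast
  have int1: "integral_FS (1 :: ('n, 'r) FS)" using integral_FS_poly[of 1] by simp
  have intf: "integral_FS (f_FS F)" by (simp add: f_FS_poly integral_FS_poly)
  have M_n: "weighted F (int d) (f_FS F) \<subseteq> M"
    unfolding M_def
    using weighted_euler[OF Fk ef] weighted_integral[OF F(1) factor_dvd_prod_F intf]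
    by (auto intro: R_n weighted_alg_generated)
  have n: "n \<in> germ_span M"
    using generated_by_germ_span[of F "f_FS F" "int d"] one(2) M_n
    unfolding germ_span_def by blast
  have m: "(var k - scalar (A $ k)) * m k \<in> germ_span M" for k
  proof (rule germ_span_map[where P = "\<lambda>h. (var k - scalar (A $ k)) * h"])
    show "m k \<in> germ_span (weighted F 0 1)" using generated_by_germ_span one(3) by blast
    fix a w q assume *: "(w, q) \<in> weighted F 0 1"
    obtain K where K: "integral_FS (poly_FS (prod_F F ^ K) * q)"
      using weighted_integral[OF F(1) factor_dvd_prod_F int1 *] by blast
    have "integral_FS (var k * (poly_FS (prod_F F ^ K) * q) - scalar (A $ k) * (poly_FS (prod_F F ^ K) * q))"
      unfolding scalar_poly_FS by (intro integral_FS_diff integral_FS_var_mult integral_FS_poly_mult K)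
    then have "integral_FS (poly_FS (prod_F F ^ K) * ((var k - scalar (A $ k)) * q))"
      by (simp add: algebra_simps)
    moreover have "euler_FS ((var k - scalar (A $ k)) * q) = scalar (of_int w) * ((var k - scalar (A $ k)) * q)"
    proof -
      have "euler_FS (scalar (A $ k)) = (0 :: ('n, 'r) FS)"
        by (simp add: euler_FS_def partial_coeffs_scalar)
      then have "euler_FS (var k - scalar (A $ k)) = (0 :: ('n, 'r) FS)"
        using euler_FS_add[of "var k - scalar (A $ k) :: ('n, 'r) FS" "scalar (A $ k)"] by (simp add: euler_FS_var)
      moreover have "euler_FS q = scalar (of_int w) * q" by (rule weighted_euler[OF Fk e1 *])
      ultimately show ?thesis by (simp add: euler_FS_mult mult.left_commute)
    qed
    ultimately have "(w, (var k - scalar (A $ k)) * q) \<in> M"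
      unfolding M_def using R_m[OF weighted_alg_generated[OF *]] by blast
    then have "const (germ_fract a) * ((var k - scalar (A $ k)) * q) \<in> germ_span M" by (rule germ_span_gen)
    then show "(var k - scalar (A $ k)) * (const (germ_fract a) * q) \<in> germ_span M"
      by (simp add: mult.left_commute)
  qed (simp add: distrib_left)
  have "1 \<in> germ_span M"
    unfolding one(1) by (intro germ_span_add germ_span_sum n m)
  then obtain js where js: "(\<Sum>(a, m, q)\<leftarrow>js. const (germ_fract a) * q) = 1" "\<forall>(a, m, q)\<in>set js. (m, q) \<in> M"
    unfolding germ_span_def by auto
  have "(\<Sum>(a, m, q)\<leftarrow>js. poly_FS (homogeneous_part (- m) a) * q) = 1"
    by (rule one_homogeneous_coeffs[OF F(1,3) js(1)]) (use js(2) in \<open>auto simp: M_def\<close>)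
  moreover have "(\<Sum>(a, m, q)\<leftarrow>js. poly_FS (homogeneous_part (- m) a) * q) \<in> R"
    using js(2)
  proof (induction js)
    case Nil
    show ?case using R_n[OF alg_generated_0] by simp
  next
    case (Cons j js)
    then show ?case by (auto simp: M_def intro!: R_add R_poly)
  qed
  ultimately have "1 \<in> R" by simp
  then show ?thesis unfolding R_def using that by blast
qed

section \<open>Nakayama's lemma along a flat\<close>

text \<open>Bilinear, without conjugation: the value of the linear form \<open>v\<close> at
  \<open>w\<close>, or its derivative in the direction \<open>w\<close>.\<close>

definition pairing :: "complex ^ 'n::finite \<Rightarrow> complex ^ 'n \<Rightarrow> complex" where
  "pairing v w = (\<Sum>k\<in>UNIV. v $ k * w $ k)"

lemma pairing_add: "pairing (u + v) w = pairing u w + pairing v w"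
  by (simp add: pairing_def distrib_right sum.distrib)

lemma pairing_scale: "pairing (c *s v) w = c * pairing v w"
  by (simp add: pairing_def sum_distrib_left mult.assoc)

lemma pairing_sum: "pairing (\<Sum>k\<in>A. h k) w = (\<Sum>k\<in>A. pairing (h k) w)"
  by (induction A rule: infinite_finite_induct) (simp_all add: pairing_add, simp_all add: pairing_def)

definition dirder ::
    "('r::finite \<Rightarrow> ('n::finite, complex) mpoly) \<Rightarrow> complex ^ 'n \<Rightarrow> ('n, 'r) FS \<Rightarrow> ('n, 'r) FS" where
  "dirder F e h = (\<Sum>k\<in>UNIV. scalar (e $ k) * partial_FS F k h)"

lemma partial_FS_poly: "partial_FS F i (poly_FS p * h) = poly_FS (mder i p) * h + poly_FS p * partial_FS F i h"
  by (simp add: partial_FS_leibniz partial_coeffs_poly_FS)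

lemma dirder_add: "dirder F e (g + h) = dirder F e g + dirder F e h"
  by (simp add: dirder_def partial_FS_add distrib_left sum.distrib)

lemma dirder_mult: "(\<And>i. partial_coeffs i c = 0) \<Longrightarrow> dirder F e (c * h) = c * dirder F e h"
  by (simp add: dirder_def partial_FS_mult sum_distrib_left mult.left_commute)

lemma dirder_uminus: "dirder F e (- h) = - dirder F e h"
  using dirder_add[of F e h "- h"] dirder_mult[of 0 F e 0]
  by (simp add: partial_coeffs_0 eq_neg_iff_add_eq_0 add.commute)

lemma partial_FS_sum: "partial_FS F i (\<Sum>k\<in>A. h k) = (\<Sum>k\<in>A. partial_FS F i (h k))"
proof -
  have "partial_FS F i 0 = 0" by (simp add: partial_FS_log_der partial_coeffs_0)
  then show ?thesis by (induction A rule: infinite_finite_induct) (simp_all add: partial_FS_add)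
qed

lemma dirder_commute: "dirder F e (dirder F e' h) = dirder F e' (dirder F e h)"
proof -
  have "dirder F e (dirder F e' h) =
      (\<Sum>k\<in>UNIV. \<Sum>l\<in>UNIV. scalar (e $ k) * (scalar (e' $ l) * partial_FS F k (partial_FS F l h)))" for e e'
    unfolding dirder_def partial_FS_sum by (simp add: partial_FS_mult partial_coeffs_scalar sum_distrib_left)
  note eq = this
  show ?thesis
    unfolding eq[of e e'] eq[of e' e] partial_FS_commute[of F _ _ h]
    by (subst sum.swap) (simp add: mult.left_commute partial_FS_commute[of F _ _ h])
qed

lemma scalar_sum: "scalar (\<Sum>k\<in>A. c k) = (\<Sum>k\<in>A. scalar (c k))"
  by (induction A rule: infinite_finite_induct) (simp_all add: scalar_add)

lemma dirder_linear_form: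
  "dirder F e (poly_FS (linear_form v) * h) = scalar (pairing v e) * h + poly_FS (linear_form v) * dirder F e h"
  unfolding dirder_def pairing_def scalar_sum
  by (simp add: partial_FS_poly mder_linear_form scalar_mult distrib_left sum.distrib sum_distrib_left
      sum_distrib_right flip: scalar_poly_FS) (simp add: mult_ac)

lemma scalar_uminus_1: "scalar (- 1) = - 1"
  using scalar_diff_1[of 0] by simp

interpretation scalar_hom: coeff_hom "scalar :: complex \<Rightarrow> ('n::finite, 'r::finite) FS"
  by unfold_locales (simp_all add: scalar_add scalar_mult)

interpretation ev_hom: coeff_hom "\<lambda>c::complex. c"
  by unfold_locales simp_all

definition coeff_FS :: "('r::finite, complex) mpoly \<Rightarrow> ('n::finite, 'r) FS" where
  "coeff_FS = mpoly_subst scalar var"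

lemma coeff_FS_add: "coeff_FS (B + C) = coeff_FS B + coeff_FS C"
  and coeff_FS_mult: "coeff_FS (B * C) = coeff_FS B * coeff_FS C"
  and coeff_FS_1 [simp]: "coeff_FS 1 = 1" and coeff_FS_0 [simp]: "coeff_FS 0 = 0"
  and coeff_FS_const: "coeff_FS (const c) = scalar c"
  and coeff_FS_var: "coeff_FS (var k) = var k"
  unfolding coeff_FS_def
  by (fact scalar_hom.subst_add scalar_hom.subst_mult scalar_hom.subst_1 scalar_hom.subst_0
      scalar_hom.subst_const scalar_hom.subst_var)+

lemma coeff_FS_diff: "coeff_FS (B - C) = coeff_FS B - coeff_FS C"
  by (simp add: eq_diff_eq flip: coeff_FS_add)

lemma partial_coeffs_coeff_FS: "partial_coeffs i (coeff_FS B) = 0"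
  by (induction B rule: mpoly_induct)
    (simp_all add: coeff_FS_add coeff_FS_mult coeff_FS_const coeff_FS_var partial_coeffs_add
      partial_coeffs_mult partial_coeffs_scalar partial_coeffs_var)

definition coeff_scale :: "('r::finite, complex) mpoly \<Rightarrow> ('n::finite, 'r) FS \<Rightarrow> ('n, 'r) FS" where
  "coeff_scale B h = coeff_FS B * h"

definition eval_at :: "complex ^ 'r::finite \<Rightarrow> ('r, complex) mpoly \<Rightarrow> complex" where
  "eval_at a = mpoly_subst (\<lambda>c. c) (\<lambda>k. a $ k)"

lemma eval_at_add: "eval_at a (B + C) = eval_at a B + eval_at a C"
  and eval_at_mult: "eval_at a (B * C) = eval_at a B * eval_at a C"
  and eval_at_1: "eval_at a 1 = 1" and eval_at_const: "eval_at a (const c) = c"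
  and eval_at_var: "eval_at a (var k) = a $ k"
  unfolding eval_at_def
  by (fact ev_hom.subst_add ev_hom.subst_mult ev_hom.subst_1 ev_hom.subst_const ev_hom.subst_var)+

lemma eval_at_diff: "eval_at a (B - C) = eval_at a B - eval_at a C"
  by (simp add: eq_diff_eq flip: eval_at_add)

definition FS_submodule :: "('r::finite \<Rightarrow> ('n::finite, complex) mpoly) \<Rightarrow> ('n, 'r) FS set \<Rightarrow> bool" where
  "FS_submodule F T \<longleftrightarrow> (\<forall>g\<in>T. \<forall>h\<in>T. g + h \<in> T) \<and> (\<forall>p. \<forall>h\<in>T. poly_FS p * h \<in> T) \<and>
     (\<forall>i. \<forall>h\<in>T. partial_FS F i h \<in> T) \<and> (\<forall>k. \<forall>h\<in>T. var k * h \<in> T)"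

text \<open>
  The linear forms \<open>\<xi> i\<close> with \<open>i \<in> I\<close> span the space of forms vanishing on the flat, and every form
  outside of this space is invertible modulo \<open>T\<close>, because of \<open>T_sat\<close>.
\<close>

locale flat_step =
  fixes F :: "'r::finite \<Rightarrow> ('n::finite, complex) mpoly" and a :: "complex ^ 'r"
    and \<xi> e :: "'n \<Rightarrow> complex ^ 'n" and I :: "'n set" and T :: "('n, 'r) FS set" and N :: nat
    and n :: "('n, 'r) FS" and m :: "'r \<Rightarrow> ('n, 'r) FS"
  assumes dual: "pairing (\<xi> i) (e j) = (if i = j then 1 else 0)"
    and expand: "v = (\<Sum>j\<in>UNIV. pairing v (e j) *s \<xi> j)"
    and T: "FS_submodule F T"
    and T_sat: "poly_FS (linear_form v) * h \<in> T \<Longrightarrow> \<exists>j\<in>-I. pairing v (e j) \<noteq> 0 \<Longrightarrow> h \<in> T"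
    and log: "j \<notin> I \<Longrightarrow> \<exists>l c. (\<forall>v\<in>set l. \<exists>j\<in>-I. pairing v (e j) \<noteq> 0) \<and>
      poly_FS (\<Prod>v\<leftarrow>l. linear_form v) * dirder F (e j) 1 = (\<Sum>k\<in>UNIV. poly_FS (c k) * var k)"
    and nil: "\<forall>j\<in>-I. pairing v (e j) = 0 \<Longrightarrow> \<exists>K. poly_FS (linear_form v ^ K) \<in> T"
    and N: "0 < N" "i \<in> I \<Longrightarrow> poly_FS (linear_form (\<xi> i) ^ N) \<in> T"
    and one: "1 = n + (\<Sum>k\<in>UNIV. (var k - scalar (a $ k)) * m k)" "n \<in> T" "m k \<in> alg_generated F 1"
begin

lemma T_add: "g \<in> T \<Longrightarrow> h \<in> T \<Longrightarrow> g + h \<in> T" and T_poly: "h \<in> T \<Longrightarrow> poly_FS p * h \<in> T"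
  and T_partial: "h \<in> T \<Longrightarrow> partial_FS F k h \<in> T" and T_var: "h \<in> T \<Longrightarrow> var l * h \<in> T"
  using T by (auto simp: FS_submodule_def)

lemma T_0: "0 \<in> T"
  using T_poly[OF one(2), of 0] by simp

lemma T_uminus: "h \<in> T \<Longrightarrow> - h \<in> T"
  using T_poly[of h "- 1"] by (simp add: poly_FS_uminus)

lemma T_diff: "g \<in> T \<Longrightarrow> h \<in> T \<Longrightarrow> g - h \<in> T"
  using T_add[of g "- h"] T_uminus by simp

lemma T_sum: "(\<And>k. k \<in> A \<Longrightarrow> h k \<in> T) \<Longrightarrow> (\<Sum>k\<in>A. h k) \<in> T"
  by (induction A rule: infinite_finite_induct) (auto intro: T_add T_0)

lemma T_coeff: "h \<in> T \<Longrightarrow> coeff_FS B * h \<in> T"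
  by (induction B arbitrary: h rule: mpoly_induct)
    (auto simp: coeff_FS_const coeff_FS_var coeff_FS_add coeff_FS_mult scalar_poly_FS distrib_right mult.assoc
      intro: T_poly T_var T_add)

lemma T_dirder: "h \<in> T \<Longrightarrow> dirder F w h \<in> T"
  unfolding dirder_def scalar_poly_FS by (intro T_sum T_poly T_partial)

text \<open>A partial Fourier transform: across the flat the roles of coordinates and derivatives
  are exchanged. Duality of \<open>\<xi>\<close> and \<open>e\<close> makes the \<open>z\<close>
  commute, and the minus sign in \<open>d\<close> makes the commutator of \<open>d i\<close> with
  \<open>z i\<close> equal to 1 also for \<open>i \<in> I\<close>.\<close>

definition z :: "'n \<Rightarrow> ('n, 'r) FS \<Rightarrow> ('n, 'r) FS" where
  "z i = (if i \<in> I then dirder F (e i) else (\<lambda>h. poly_FS (linear_form (\<xi> i)) * h))"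

definition d :: "'n \<Rightarrow> ('n, 'r) FS \<Rightarrow> ('n, 'r) FS" where
  "d i = (if i \<in> I then (\<lambda>h. - (poly_FS (linear_form (\<xi> i)) * h)) else dirder F (e i))"

sublocale W: weyl_action coeff_scale z d "eval_at a"
proof unfold_locales
  fix i j h
  show "z i (z j h) = z j (z i h)"
    by (auto simp: z_def dirder_commute[of F "e i"] dirder_linear_form dual mult.left_commute)
  show "d i (z j h) = z j (d i h) + (if i = j then h else 0)"
    by (auto simp: z_def d_def dirder_commute[of F "e i"] dirder_linear_form dual mult.left_commute dirder_uminus
        add.commute)
qed (auto simp: coeff_scale_def z_def d_def coeff_FS_add coeff_FS_mult distrib_left distrib_right mult.assoc mult.left_commute
    dirder_add dirder_mult partial_coeffs_coeff_FS eval_at_add eval_at_mult eval_at_1)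

lemma T_z: "h \<in> T \<Longrightarrow> z i h \<in> T"
  by (auto simp: z_def intro: T_dirder T_poly)

lemma T_d: "h \<in> T \<Longrightarrow> d i h \<in> T"
  by (auto simp: d_def intro: T_dirder T_poly T_uminus)

lemma T_act: "h \<in> T \<Longrightarrow> W.act p h \<in> T"
  by (induction p arbitrary: h rule: mpoly_induct)
    (auto simp: W.act_const coeff_scale_def W.act_var W.act_add_left W.act_mult intro: T_coeff T_z T_add)

section \<open>A finite set of generators over the operators \<open>z\<close>\<close>

definition monomial :: "('n \<Rightarrow> nat) \<Rightarrow> ('n, complex) mpoly" where
  "monomial b = (\<Prod>i\<in>I. linear_form (\<xi> i) ^ b i)"

definition G :: "('n, 'r) FS set" where
  "G = (\<lambda>b. poly_FS (monomial b)) ` {b. \<forall>i. b i < N}"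

lemma finite_G: "finite G"
proof -
  have "{b :: 'n \<Rightarrow> nat. \<forall>i. b i < N} = (UNIV :: 'n set) \<rightarrow>\<^sub>E {..<N}" by (auto simp: PiE_def Pi_def)
  then have "finite {b :: 'n \<Rightarrow> nat. \<forall>i. b i < N}" by (simp add: finite_PiE)
  then show ?thesis unfolding G_def by (rule finite_imageI)
qed

lemma one_in_G: "1 \<in> G"
  unfolding G_def monomial_def using N(1) by (intro image_eqI[of _ _ "\<lambda>_. 0"]) simp_all

text \<open>Multiplication by a transversal coordinate raises one exponent, and a monomial that
  reaches exponent \<open>N\<close> falls into \<open>T\<close>.\<close>

lemma d_G:
  assumes "i \<in> I" "t \<in> G"
  shows "- d i t \<in> G \<union> T"
proof -
  obtain b where b: "t = poly_FS (monomial b)" "\<forall>i. b i < N" using assms(2) unfolding G_def by blast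
  have m: "monomial b = linear_form (\<xi> i) ^ b i * (\<Prod>j\<in>I - {i}. linear_form (\<xi> j) ^ b j)" for b
    unfolding monomial_def using assms(1) by (subst prod.remove[of _ i]) auto
  have "linear_form (\<xi> i) * monomial b = monomial (b(i := Suc (b i)))"
    unfolding m by simp
  then have d: "- d i t = poly_FS (monomial (b(i := Suc (b i))))"
    using assms(1) by (simp add: d_def b(1) flip: poly_FS_mult)
  show ?thesis
  proof (cases "Suc (b i) = N")
    case True
    have "poly_FS (\<Prod>j\<in>I - {i}. linear_form (\<xi> j) ^ b j) * poly_FS (linear_form (\<xi> i) ^ N) \<in> T"
      by (intro T_poly N(2) assms(1))
    then show ?thesis unfolding d m using True by (simp add: poly_FS_mult mult.commute)
  next
    case False
    have "b i < N" using b(2) by blast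
    then have "Suc (b i) < N" using False by simp
    then have "\<forall>j. (b(i := Suc (b i))) j < N" using b(2) by simp
    then show ?thesis unfolding d G_def by blast
  qed
qed

definition L :: "('n, 'r) FS set" where
  "L = {h. \<exists>q. h - (\<Sum>t\<in>G. W.act (q t) t) \<in> T}"

text \<open>The elements that lie in \<open>L\<close>, the span of \<open>G\<close> modulo
  \<open>T\<close>, after localization at the prime ideal of \<open>nakayama\<close>.\<close>

definition Q :: "('n, 'r) FS set" where
  "Q = {h. \<exists>p. W.red p \<noteq> 0 \<and> W.act p h \<in> L}"

lemma L_add: "g \<in> L \<Longrightarrow> h \<in> L \<Longrightarrow> g + h \<in> L"
  unfolding L_def
proof (clarify, goal_cases)
  case (1 q q')
  from T_add[OF this] show ?case
    by (intro exI[of _ "\<lambda>t. q t + q' t"]) (simp add: W.act_add_left sum.distrib algebra_simps)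
qed

lemma L_act: "h \<in> L \<Longrightarrow> W.act p h \<in> L"
  unfolding L_def
proof (clarify, goal_cases)
  case (1 q)
  from T_act[OF this, of p] show ?case
    by (intro exI[of _ "\<lambda>t. p * q t"]) (simp add: W.act_diff W.act_sum W.act_mult)
qed

lemma L_T: "h \<in> T \<Longrightarrow> h \<in> L"
  unfolding L_def by (auto intro!: exI[of _ "\<lambda>_. 0"] simp: W.act_0_left)

lemma L_G: "t \<in> G \<Longrightarrow> t \<in> L"
proof -
  assume t: "t \<in> G"
  have "(\<Sum>s\<in>G. W.act (if s = t then 1 else 0) s) = (\<Sum>s\<in>G. if s = t then s else 0)"
    by (intro sum.cong) (auto simp: W.act_1 W.act_0_left)
  also have "\<dots> = t" using t finite_G by simp
  finally show "t \<in> L" unfolding L_def by (auto intro!: exI[of _ "\<lambda>s. if s = t then 1 else 0"] simp: T_0)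
qed

lemma L_uminus: "h \<in> L \<Longrightarrow> - h \<in> L"
  using L_act[of h "- 1"] by (simp add: W.act_uminus_left W.act_1)

lemma L_sum: "(\<And>k. k \<in> A \<Longrightarrow> h k \<in> L) \<Longrightarrow> (\<Sum>k\<in>A. h k) \<in> L"
  by (induction A rule: infinite_finite_induct) (auto intro: L_add L_T T_0)

lemma Q_L: "h \<in> L \<Longrightarrow> h \<in> Q"
  unfolding Q_def using W.red_1 W.act_1 by (auto intro!: exI[of _ 1])

lemma Q_act: "h \<in> Q \<Longrightarrow> W.act p h \<in> Q"
  unfolding Q_def using L_act[of "W.act _ h" p] by (auto simp: mult.commute[of p] simp flip: W.act_mult)

lemma Q_add:
  assumes "g \<in> Q" "h \<in> Q"
  shows "g + h \<in> Q"
proof -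
  obtain p q where "W.red p \<noteq> 0" "W.act p g \<in> L" "W.red q \<noteq> 0" "W.act q h \<in> L"
    using assms unfolding Q_def by blast
  then have "W.act q (W.act p g) + W.act p (W.act q h) \<in> L" "W.red (p * q) \<noteq> 0"
    by (auto intro!: L_add L_act simp: W.red_mult)
  then show ?thesis unfolding Q_def
    by (auto intro!: exI[of _ "p * q"] simp: W.act_add mult.commute[of q] simp flip: W.act_mult)
qed

lemma Q_sum: "(\<And>k. k \<in> A \<Longrightarrow> h k \<in> Q) \<Longrightarrow> (\<Sum>k\<in>A. h k) \<in> Q"
  by (induction A rule: infinite_finite_induct) (auto intro: Q_add Q_L L_T T_0)

lemma Q_uminus: "h \<in> Q \<Longrightarrow> - h \<in> Q"
  using Q_act[of h "- 1"] by (simp add: W.act_uminus_left W.act_1)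

lemma Q_cancel: "W.act p h \<in> Q \<Longrightarrow> W.red p \<noteq> 0 \<Longrightarrow> h \<in> Q"
  unfolding Q_def by (auto simp: W.red_mult simp flip: W.act_mult intro: exI[of _ "_ * p"])

text \<open>By \<open>d_act\<close> the commutator of \<open>d i\<close> with a coefficient is again
  a coefficient, so only the generators have to be tested. The set \<open>K\<close> will be
  \<open>L\<close> for \<open>i \<in> I\<close>; along the flat denominators arise and
  \<open>K\<close> is \<open>Q\<close>.\<close>

lemma d_closed:
  assumes K: "\<And>h. h \<in> L \<Longrightarrow> h \<in> K" "\<And>g h. g \<in> K \<Longrightarrow> h \<in> K \<Longrightarrow> g + h \<in> K" "\<And>p h. h \<in> K \<Longrightarrow> W.act p h \<in> K"
    and "\<And>t. t \<in> G \<Longrightarrow> d i t \<in> K" "h \<in> L"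
  shows "d i h \<in> K"
proof -
  have K_sum: "(\<Sum>t\<in>A. g t) \<in> K" if "\<And>t. t \<in> A \<Longrightarrow> g t \<in> K" for A and g :: "('n, 'r) FS \<Rightarrow> ('n, 'r) FS"
    using that by (induction A rule: infinite_finite_induct) (auto intro: K L_T T_0)
  obtain q where q: "h - (\<Sum>t\<in>G. W.act (q t) t) \<in> T" using assms(5) unfolding L_def by blast
  have d_sum: "d i (\<Sum>t\<in>A. g t) = (\<Sum>t\<in>A. d i (g t))" for A and g :: "('n, 'r) FS \<Rightarrow> ('n, 'r) FS"
    by (induction A rule: infinite_finite_induct) (simp_all add: W.d_0 W.d_add)
  have "d i (h - (\<Sum>t\<in>G. W.act (q t) t)) + (\<Sum>t\<in>G. W.act (mder i (q t)) t + W.act (q t) (d i t)) \<in> K"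
    by (intro K(2)[OF K(1)[OF L_T[OF T_d[OF q]]]] K_sum K(2)[OF K(3)[OF K(1)[OF L_G]] K(3)[OF assms(4)]])
  also have "(\<Sum>t\<in>G. W.act (mder i (q t)) t + W.act (q t) (d i t)) = d i (\<Sum>t\<in>G. W.act (q t) t)"
    by (simp add: d_sum W.d_act)
  also have "d i (h - (\<Sum>t\<in>G. W.act (q t) t)) + d i (\<Sum>t\<in>G. W.act (q t) t) = d i h"
    by (simp flip: W.d_add)
  finally show ?thesis .
qed

lemma d_G_L: "i \<in> I \<Longrightarrow> t \<in> G \<Longrightarrow> d i t \<in> L"
  using d_G[of i t] L_uminus[of "- d i t"] L_G L_T by auto

text \<open>The quotient rule: \<open>p\<close> applied to \<open>d i h\<close> is
  \<open>d i\<close> of \<open>p h\<close> minus \<open>mder i p\<close> applied to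
  \<open>h\<close>.\<close>

lemma Q_d:
  assumes "\<And>t. t \<in> G \<Longrightarrow> d i t \<in> Q" "h \<in> Q"
  shows "d i h \<in> Q"
proof -
  obtain p where p: "W.red p \<noteq> 0" "W.act p h \<in> L" using assms(2) unfolding Q_def by blast
  have "d i (W.act p h) \<in> Q"
    by (rule d_closed[OF Q_L Q_add Q_act assms(1) p(2)])
  then have "d i (W.act p h) + - W.act (mder i p) h \<in> Q" by (intro Q_add Q_uminus Q_act assms(2))
  then have "W.act p (d i h) \<in> Q" by (simp add: W.d_act)
  then show ?thesis using p(1) by (rule Q_cancel)
qed

text \<open>By \<open>expand\<close> every polynomial is a polynomial in the forms
  \<open>\<xi> i\<close>, which act as \<open>z i\<close> along the flat and as \<open>- d i\<close>
  across it.\<close>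

lemma linear_form_closed:
  assumes K: "\<And>g h. g \<in> K \<Longrightarrow> h \<in> K \<Longrightarrow> g + h \<in> K" "\<And>p h. h \<in> K \<Longrightarrow> W.act p h \<in> K"
    "\<And>i h. i \<in> I \<Longrightarrow> h \<in> K \<Longrightarrow> d i h \<in> K" and h: "h \<in> K"
  shows "poly_FS p * h \<in> K"
proof -
  have scal: "scalar c * g \<in> K" if "g \<in> K" for c g
    using K(2)[OF that, of "const (const c)"] by (simp add: W.act_const coeff_scale_def coeff_FS_const)
  have l: "poly_FS (linear_form (\<xi> i)) * g \<in> K" if "g \<in> K" for i g
  proof (cases "i \<in> I")
    case True
    from scal[OF K(3)[OF True that], of "- 1"] show ?thesis
      using True by (simp add: d_def scalar_uminus_1)
  next
    case False
    with K(2)[OF that, of "var i"] show ?thesis by (simp add: W.act_var z_def)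
  qed
  have lin: "poly_FS (linear_form v) * g \<in> K" if "g \<in> K" for v g
  proof -
    have "poly_FS (\<Sum>j\<in>A. linear_form (pairing v (e j) *s \<xi> j)) * g \<in> K" for A
    proof (induction A rule: infinite_finite_induct)
      case (insert j A)
      have "scalar (pairing v (e j)) * (poly_FS (linear_form (\<xi> j)) * g) \<in> K" by (intro scal l that)
      with insert show ?case
        by (auto simp: poly_FS_add distrib_right linear_form_scale poly_FS_mult scalar_poly_FS mult.assoc intro: K)
    qed (use scal[OF that, of 0] in simp_all)
    from this[of UNIV] expand[of v] show ?thesis by (simp flip: linear_form_sum)
  qed
  show ?thesis using h
  proof (induction p arbitrary: h rule: mpoly_induct)
    case (const c)
    then show ?case using scal by (simp add: scalar_poly_FS)
  next
    case (var i)
    then show ?case using lin[of h "axis i 1"] by (simp add: linear_form_axis)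
  qed (auto simp: poly_FS_add poly_FS_mult distrib_right mult.assoc intro: K)
qed

lemma L_poly: "h \<in> L \<Longrightarrow> poly_FS p * h \<in> L"
  by (rule linear_form_closed[OF L_add L_act]) (auto intro: d_closed L_add L_act d_G_L)

lemma Q_poly: "h \<in> Q \<Longrightarrow> poly_FS p * h \<in> Q"
  by (rule linear_form_closed[OF Q_add Q_act]) (auto intro: Q_d Q_L d_G_L)

lemma L_var: "h \<in> L \<Longrightarrow> var k * h \<in> L"
  using L_act[of h "const (var k)"] by (simp add: W.act_const coeff_scale_def coeff_FS_var)

lemma Q_var: "h \<in> Q \<Longrightarrow> var k * h \<in> Q"
  using Q_act[of h "const (var k)"] by (simp add: W.act_const coeff_scale_def coeff_FS_var)

text \<open>
  A linear form outside of the span of \<open>\<xi> i\<close>, \<open>i \<in> I\<close>, differs from an invertible element of the ring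
  of coordinates by a form in this span, and the latter is nilpotent on \<open>h\<close>.
\<close>

lemma Q_cancel_linear_form:
  assumes "poly_FS (linear_form v * q) * h \<in> Q" "\<exists>j\<in>-I. pairing v (e j) \<noteq> 0"
    and nilp: "\<And>w. \<forall>j\<in>-I. pairing w (e j) = 0 \<Longrightarrow> \<exists>K. poly_FS (linear_form w ^ K) * h \<in> Q"
  shows "poly_FS q * h \<in> Q"
proof -
  define v0 v1 where "v0 = (\<Sum>j\<in>-I. pairing v (e j) *s \<xi> j)" and "v1 = (\<Sum>j\<in>I. pairing v (e j) *s \<xi> j)"
  have v: "v = v0 + v1"
  proof -
    have "(\<Sum>j\<in>-I \<union> I. pairing v (e j) *s \<xi> j) = v0 + v1"
      unfolding v0_def v1_def by (intro sum.union_disjoint) auto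
    then show ?thesis using expand[of v] by simp
  qed
  have "\<forall>j\<in>-I. pairing v1 (e j) = 0"
    unfolding v1_def pairing_sum pairing_scale dual by (auto intro!: sum.neutral)
  then obtain K where K: "poly_FS (linear_form v1 ^ K) * h \<in> Q" using nilp by blast
  \<comment> \<open>The component of \<open>v\<close> along the flat as a polynomial in the
    \<open>z\<close>. It has a nonzero constant among its coefficients, so it is invertible in the
    localization.\<close>
  define V0 :: "('n, ('r, complex) mpoly) mpoly" where
    "V0 = (\<Sum>j\<in>-I. const (const (pairing v (e j))) * var j)"
  have act_sum_left: "W.act (\<Sum>j\<in>A. p j) g = (\<Sum>j\<in>A. W.act (p j) g)" for A and p :: "'n \<Rightarrow> _" and g
    by (induction A rule: infinite_finite_induct) (simp_all add: W.act_0_left W.act_add_left)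
  have V0: "W.act V0 g = poly_FS (linear_form v0) * g" for g
    unfolding V0_def act_sum_left v0_def linear_form_sum poly_FS_sum sum_distrib_right
    by (intro sum.cong)
      (auto simp: W.act_mult W.act_const coeff_scale_def W.act_var coeff_FS_const z_def linear_form_scale poly_FS_mult
        scalar_poly_FS mult.assoc)
  have V0K: "W.act (V0 ^ K) g = poly_FS (linear_form v0 ^ K) * g" for g K
    by (induction K) (simp_all add: W.act_1 W.act_mult V0 poly_FS_mult mult.assoc)
  obtain j where j: "j \<in> -I" "pairing v (e j) \<noteq> 0" using assms(2) by blast
  have "Poly_Mapping.lookup V0 (Poly_Mapping.single j 1) =
      (\<Sum>i\<in>-I. if i = j then const (pairing v (e i)) else 0)"
  proof -
    have "Poly_Mapping.single i (1::nat) = Poly_Mapping.single j 1 \<longleftrightarrow> i = j" for i :: 'n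
      by (metis lookup_single_eq lookup_single_not_eq zero_neq_one)
    then show ?thesis
      unfolding V0_def lookup_sum lookup_const_mult var_def lookup_single when_def
      by (intro sum.cong) auto
  qed
  then have "eval_at a (Poly_Mapping.lookup V0 (Poly_Mapping.single j 1)) \<noteq> 0"
    using j by (simp add: eval_at_const)
  then have "W.red V0 \<noteq> 0" by (auto simp: W.red_eq_0_iff)
  then have red: "W.red (V0 ^ K) \<noteq> 0" by (induction K) (simp_all add: W.red_1 W.red_mult)
  \<comment> \<open>Modulo \<open>v\<close> the form \<open>v0\<close> is \<open>- v1\<close>. Hence
    \<open>v0 ^ K\<close> is a combination of \<open>v\<close> and \<open>v1 ^ K\<close>, and both
    bring \<open>q h\<close> into \<open>Q\<close>.\<close>
  have "linear_form v dvd linear_form v0 ^ K - (- linear_form v1) ^ K"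
    by (simp add: v linear_form_add power_diff_sumr2)
  then obtain s where "linear_form v0 ^ K - (- linear_form v1) ^ K = linear_form v * s" by (elim dvdE)
  then have s: "linear_form v0 ^ K = s * linear_form v + (- 1) ^ K * linear_form v1 ^ K"
    by (simp add: algebra_simps power_minus[of "linear_form v1"])
  have "poly_FS s * (poly_FS (linear_form v * q) * h) + poly_FS ((- 1) ^ K * q) * (poly_FS (linear_form v1 ^ K) * h) \<in> Q"
    by (intro Q_add Q_poly assms(1) K)
  then have "poly_FS (linear_form v0 ^ K) * (poly_FS q * h) \<in> Q"
    by (simp add: s poly_FS_add poly_FS_mult algebra_simps)
  then show ?thesis using red unfolding V0K[symmetric] by (rule Q_cancel)
qed

section \<open>Derivatives along the flat\<close>

lemma dirder_power:
  "pairing v w = 0 \<Longrightarrow> dirder F w (poly_FS (linear_form v ^ k) * h) = poly_FS (linear_form v ^ k) * dirder F w h"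
  by (induction k) (simp_all add: poly_FS_mult mult.assoc dirder_linear_form)

lemma dirder_monomial:
  assumes "j \<notin> I"
  shows "dirder F (e j) (poly_FS (monomial b) * h) = poly_FS (monomial b) * dirder F (e j) h"
proof -
  have "dirder F (e j) (poly_FS (\<Prod>i\<in>A. linear_form (\<xi> i) ^ b i) * h) =
      poly_FS (\<Prod>i\<in>A. linear_form (\<xi> i) ^ b i) * dirder F (e j) h" if "A \<subseteq> I" for A
    using that
  proof (induction A rule: infinite_finite_induct)
    case (insert i A)
    then have "pairing (\<xi> i) (e j) = 0" using assms by (auto simp: dual)
    then show ?case using insert by (simp add: poly_FS_mult mult.assoc dirder_power)
  qed simp_all
  then show ?thesis by (simp add: monomial_def)
qed

text \<open>The monomials in \<open>G\<close> are constant along the flat, so only the symbol is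
  differentiated. By \<open>log\<close> its derivative has a denominator made of forms outside of
  the flat's space, and these are cancelled one at a time.\<close>

lemma d_G_Q:
  assumes j: "j \<notin> I" and t: "t \<in> G"
  shows "d j t \<in> Q"
proof -
  obtain b where b: "t = poly_FS (monomial b)" using t unfolding G_def by blast
  define h where "h = poly_FS (monomial b) * dirder F (e j) 1"
  obtain l c where l: "\<forall>v\<in>set l. \<exists>j\<in>-I. pairing v (e j) \<noteq> 0"
    and c: "poly_FS (\<Prod>v\<leftarrow>l. linear_form v) * dirder F (e j) 1 = (\<Sum>k\<in>UNIV. poly_FS (c k) * var k)"
    using log[OF j] by blast
  \<comment> \<open>The form \<open>w\<close> is constant in the direction \<open>e j\<close>, so
    its power in \<open>T\<close> can be pulled through the derivative of 1.\<close>
  have nilp: "\<exists>K. poly_FS (linear_form w ^ K) * h \<in> Q" if w: "\<forall>j\<in>-I. pairing w (e j) = 0" for w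
  proof -
    obtain K where "poly_FS (linear_form w ^ K) \<in> T" using nil[OF w] by blast
    then have "poly_FS (monomial b) * dirder F (e j) (poly_FS (linear_form w ^ K) * 1) \<in> T"
      by (simp add: T_poly T_dirder)
    then have "poly_FS (linear_form w ^ K) * h \<in> T"
      using w j unfolding h_def by (subst (asm) dirder_power) (auto simp: mult.left_commute)
    then show ?thesis using Q_L L_T by blast
  qed
  have "poly_FS (monomial b) * (\<Sum>k\<in>UNIV. poly_FS (c k) * (var k * 1)) \<in> L"
    by (intro L_poly L_sum L_var L_G one_in_G)
  then have "poly_FS ((\<Prod>v\<leftarrow>l. linear_form v) * 1) * h \<in> Q"
    unfolding h_def mult.left_commute[of _ "poly_FS (monomial b)"] using c by (auto intro: Q_L)
  then have "poly_FS 1 * h \<in> Q" using l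
  proof (induction l)
    case (Cons v l)
    have "poly_FS ((\<Prod>v\<leftarrow>l. linear_form v) * 1) * h \<in> Q"
      by (rule Q_cancel_linear_form[OF _ _ nilp]) (use Cons.prems in auto)
    then show ?case using Cons by simp
  qed simp
  then show ?thesis
    using j dirder_monomial[OF j, of b 1] by (simp add: d_def b h_def)
qed

lemma partial_FS_dirder: "partial_FS F k h = (\<Sum>j\<in>UNIV. scalar (\<xi> j $ k) * dirder F (e j) h)"
proof -
  have \<delta>: "(\<Sum>j\<in>UNIV. \<xi> j $ k * e j $ l) = (if k = l then 1 else 0)" for l
  proof -
    have "pairing (axis l 1) w = w $ l" for w :: "complex ^ 'n"
    proof -
      have "pairing (axis l 1) w = (\<Sum>k\<in>UNIV. if l = k then w $ k else 0)"
        unfolding pairing_def by (intro sum.cong) (auto simp: axis_def)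
      then show ?thesis by simp
    qed
    then have "axis l 1 $ k = (\<Sum>j\<in>UNIV. e j $ l *s \<xi> j) $ k" using expand[of "axis l 1"] by simp
    then show ?thesis by (auto simp: axis_def mult.commute split: if_splits)
  qed
  have "(\<Sum>j\<in>UNIV. scalar (\<xi> j $ k) * dirder F (e j) h) =
      (\<Sum>l\<in>UNIV. \<Sum>j\<in>UNIV. scalar (\<xi> j $ k * e j $ l) * partial_FS F l h)"
    unfolding dirder_def sum_distrib_left by (subst sum.swap) (simp add: scalar_mult mult.assoc)
  also have "\<dots> = (\<Sum>l\<in>UNIV. if k = l then partial_FS F l h else 0)"
    by (intro sum.cong refl) (simp add: \<delta> flip: sum_distrib_right scalar_sum)
  finally show ?thesis by simp
qed

text \<open>Finite generation after localization. Every partial derivative is a combination of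
  derivatives across the flat, which are among the \<open>z\<close>, and along it, which are among
  the \<open>d\<close>.\<close>

lemma generated_subset_Q: "alg_generated F 1 \<subseteq> Q"
proof
  fix h assume "h \<in> alg_generated F 1"
  then show "h \<in> Q"
  proof induction
    case gen
    show ?case by (intro Q_L L_G one_in_G)
  next
    case (partial h k)
    have "dirder F (e j) h \<in> Q" for j
    proof (cases "j \<in> I")
      case True
      then show ?thesis using Q_act[OF partial.IH, of "var j"] by (simp add: W.act_var z_def)
    next
      case False
      then show ?thesis using Q_d[OF d_G_Q partial.IH, of j] by (simp add: d_def)
    qed
    then show ?case unfolding partial_FS_dirder scalar_poly_FS by (intro Q_sum Q_poly)
  qed (auto intro: Q_poly Q_var Q_add)
qed

text \<open>The relation for 1 is multiplied by a generator \<open>t\<close>. Each product with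
  \<open>m k\<close> is expressed in \<open>G\<close> over the common denominator \<open>P\<close>,
  and the factor \<open>var k - const (a $ k)\<close> makes the new coefficients reduce to
  zero.\<close>

lemma exists_annihilator: "\<exists>p. W.red p \<noteq> 0 \<and> (\<forall>t\<in>G. W.act p t \<in> T)"
proof (rule W.nakayama[OF T_add T_act finite_G])
  fix t assume "t \<in> G"
  then obtain M where M: "t = poly_FS M" unfolding G_def by blast
  have "\<exists>p. W.red p \<noteq> 0 \<and> W.act p (poly_FS M * m k) \<in> L" for k
    using Q_poly[of "m k" M] generated_subset_Q one(3)[of k] unfolding Q_def by blast
  then obtain p where p: "\<And>k. W.red (p k) \<noteq> 0" "\<And>k. W.act (p k) (poly_FS M * m k) \<in> L" by metis
  define P where "P = (\<Prod>k\<in>UNIV. p k)"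
  have "W.red (\<Prod>k\<in>A. p k) \<noteq> 0" for A
    by (induction A rule: infinite_finite_induct) (simp_all add: W.red_1 W.red_mult p)
  then have redP: "W.red P \<noteq> 0" by (simp add: P_def)
  have "W.act P (poly_FS M * m k) \<in> L" for k
  proof -
    have "P = (\<Prod>j\<in>UNIV - {k}. p j) * p k" unfolding P_def by (subst prod.remove[of _ k]) auto
    then show ?thesis by (simp add: W.act_mult L_act p)
  qed
  then have "\<forall>k. \<exists>q. W.act P (poly_FS M * m k) - (\<Sum>s\<in>G. W.act (q s) s) \<in> T" unfolding L_def by blast
  from choice[OF this] obtain q where
    q: "\<And>k. W.act P (poly_FS M * m k) - (\<Sum>s\<in>G. W.act (q k s) s) \<in> T" by blast
  define c :: "'r \<Rightarrow> ('r, complex) mpoly" where "c k = var k - const (a $ k)" for k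
  have c: "coeff_FS (c k) = var k - scalar (a $ k)" for k
    by (simp add: c_def coeff_FS_diff coeff_FS_var coeff_FS_const)
  define q' where "q' s = (\<Sum>k\<in>UNIV. const (c k) * q k s)" for s
  have act_sum_left: "W.act (\<Sum>k\<in>A. g k) s = (\<Sum>k\<in>A. W.act (g k) s)" for A and g :: "'r \<Rightarrow> _" and s
    by (induction A rule: infinite_finite_induct) (simp_all add: W.act_0_left W.act_add_left)
  have act_c: "W.act p (coeff_FS B * h) = coeff_FS B * W.act p h" for p B h
    by (metis W.act_const W.act_mult coeff_scale_def mult.commute)
  have "W.act P t = W.act P (poly_FS M * n) + (\<Sum>k\<in>UNIV. coeff_FS (c k) * W.act P (poly_FS M * m k))"
  proof -
    have "t = poly_FS M * n + (\<Sum>k\<in>UNIV. coeff_FS (c k) * (poly_FS M * m k))"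
      using arg_cong[OF one(1), of "(*) (poly_FS M)"]
      by (simp add: M c distrib_left sum_distrib_left mult.left_commute)
    then show ?thesis by (simp add: W.act_add W.act_sum act_c)
  qed
  moreover have "(\<Sum>s\<in>G. W.act (q' s) s) = (\<Sum>k\<in>UNIV. coeff_FS (c k) * (\<Sum>s\<in>G. W.act (q k s) s))"
    unfolding q'_def act_sum_left W.act_mult W.act_const coeff_scale_def sum_distrib_left by (rule sum.swap)
  ultimately have "W.act P t - (\<Sum>s\<in>G. W.act (q' s) s) = W.act P (poly_FS M * n) +
      (\<Sum>k\<in>UNIV. coeff_FS (c k) * (W.act P (poly_FS M * m k) - (\<Sum>s\<in>G. W.act (q k s) s)))"
    by (simp add: right_diff_distrib sum_subtractf)
  also have "\<dots> \<in> T" by (intro T_add T_sum T_coeff T_act T_poly q one(2))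
  finally have "W.act P t - (\<Sum>s\<in>G. W.act (q' s) s) \<in> T" .
  moreover have "W.red (q' s) = 0" for s
  proof -
    have "W.red (const (c k)) = 0" for k
      unfolding W.red_def W.red_hom.subst_const
      by (simp add: c_def eval_at_diff eval_at_var eval_at_const germ_of_mpoly_0)
    then have "W.red (\<Sum>k\<in>A. const (c k) * q k s) = 0" for A
      by (induction A rule: infinite_finite_induct) (simp_all add: W.red_0 W.red_add W.red_mult)
    then show ?thesis by (simp add: q'_def)
  qed
  ultimately show "\<exists>p q. W.red p \<noteq> 0 \<and> (\<forall>s. W.red (q s) = 0) \<and> W.act p t - (\<Sum>s\<in>G. W.act (q s) s) \<in> T"
    using redP by blast
qed

text \<open>Only coordinates along the flat occur in \<open>p\<close>, and these act by
  multiplication; such a \<open>p\<close> therefore commutes with multiplication by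
  \<open>dirder F (e i) 1\<close>.\<close>

lemma act_along:
  assumes "\<And>\<beta>. Poly_Mapping.lookup p \<beta> \<noteq> 0 \<Longrightarrow> \<forall>i\<in>I. Poly_Mapping.lookup \<beta> i = 0"
  shows "W.act p h = W.act p 1 * h"
proof -
  have zp: "W.zpow \<beta> h = W.zpow \<beta> 1 * h" if "\<forall>i\<in>I. Poly_Mapping.lookup \<beta> i = 0" for \<beta> h
    using that
  proof (induction \<beta> arbitrary: h rule: exponent_induct)
    case (add \<alpha> \<beta>)
    have "\<forall>i\<in>I. Poly_Mapping.lookup \<alpha> i = 0" "\<forall>i\<in>I. Poly_Mapping.lookup \<beta> i = 0"
      using add.prems by (simp_all add: lookup_add)
    then have *: "W.zpow \<alpha> h = W.zpow \<alpha> 1 * h \<and> W.zpow \<beta> h = W.zpow \<beta> 1 * h" for h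
      by (intro conjI add.IH)
    show ?case unfolding W.zpow_exponent_add using *[of "W.zpow \<beta> h"] *[of "W.zpow \<beta> 1"] *[of h]
      by (simp add: mult.assoc)
  next
    case (single i k)
    show ?case
    proof (cases "i \<in> I")
      case True
      then have "k = 0" using single by (auto dest: bspec[of _ _ i])
      then show ?thesis by (simp add: W.zpow_0)
    next
      case False
      then have "(z i ^^ k) h = poly_FS (linear_form (\<xi> i)) ^ k * h" for h
        by (induction k) (simp_all add: z_def mult.assoc)
      from this[of h] this[of 1] show ?thesis by (simp add: W.zpow_single)
    qed
  qed
  show ?thesis
    unfolding W.act_def sum_distrib_right coeff_scale_def
    using zp[OF assms] by (intro sum.cong refl) (metis in_keys_iff mult.assoc)
qed

text \<open>The two kinds of variables are eliminated in this order. Across the flat,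
  \<open>d i\<close> maps \<open>G\<close> into \<open>G \<union> T\<close> up to sign, so
  annihilators of all of \<open>G\<close> are stable under \<open>mder i\<close>. Afterwards
  \<open>p\<close> is a function along the flat and it suffices to control \<open>W.act p 1\<close>:
  by \<open>act_along\<close> the product with the logarithmic derivative stays in \<open>T\<close>
  up to forms cancelled by \<open>T_sat\<close>.\<close>

lemma exists_bernstein: "\<exists>B. eval_at a B \<noteq> 0 \<and> coeff_FS B \<in> T"
proof -
  have nat: "W.act (of_nat k * p - var i * mder i p) h = of_nat k * W.act p h - z i (W.act (mder i p) h)" for k p i h
  proof -
    have "W.act (of_nat k) h = of_nat k * h" for h
      by (induction k) (simp_all add: W.act_0_left W.act_add_left W.act_1 distrib_right)
    then show ?thesis by (simp add: W.act_diff_left W.act_mult W.act_var)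
  qed
  have T_nat: "of_nat k * h \<in> T" if "h \<in> T" for k h
    by (induction k) (auto simp: distrib_right T_0 intro: T_add that)
  define J1 where "J1 = {p. \<forall>t\<in>G. W.act p t \<in> T}"
  have J1_mder: "mder i p \<in> J1" if "i \<in> I" "p \<in> J1" for i p
  proof -
    have "W.act (mder i p) t \<in> T" if t: "t \<in> G" for t
    proof -
      have "W.act p (- d i t) \<in> T" using d_G[OF \<open>i \<in> I\<close> t] \<open>p \<in> J1\<close> by (auto simp: J1_def intro: T_act)
      moreover have "d i (W.act p t) \<in> T" using t \<open>p \<in> J1\<close> by (auto simp: J1_def intro: T_d)
      ultimately have "d i (W.act p t) + W.act p (- d i t) \<in> T" by (intro T_add)
      then show ?thesis by (simp add: W.d_act W.act_uminus)
    qed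
    then show ?thesis by (simp add: J1_def)
  qed
  obtain p0 where p0: "W.red p0 \<noteq> 0" "p0 \<in> J1" using exists_annihilator by (auto simp: J1_def)
  have "\<exists>p\<in>J1. W.red p \<noteq> 0 \<and> (\<forall>j\<in>I. \<forall>\<beta>. Poly_Mapping.lookup p \<beta> \<noteq> 0 \<longrightarrow> Poly_Mapping.lookup \<beta> j = 0)"
  proof (rule W.eliminate_variables[OF _ J1_mder _ p0(2,1)])
    fix i p k assume "i \<in> I" "p \<in> J1"
    then show "of_nat k * p - var i * mder i p \<in> J1"
      using J1_mder[of i p] unfolding J1_def by (auto simp: nat intro!: T_diff T_nat T_z)
  qed simp_all
  then obtain p1 where p1: "p1 \<in> J1" "W.red p1 \<noteq> 0"
    "\<forall>j\<in>I. \<forall>\<beta>. Poly_Mapping.lookup p1 \<beta> \<noteq> 0 \<longrightarrow> Poly_Mapping.lookup \<beta> j = 0" by blast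
  define J2 where "J2 = {p. W.act p 1 \<in> T \<and> (\<forall>\<beta>. Poly_Mapping.lookup p \<beta> \<noteq> 0 \<longrightarrow> (\<forall>j\<in>I. Poly_Mapping.lookup \<beta> j = 0))}"
  have J2_mder: "mder i p \<in> J2" if i: "i \<in> - I" and p: "p \<in> J2" for i p
  proof -
    obtain l c where l: "\<forall>v\<in>set l. \<exists>j\<in>-I. pairing v (e j) \<noteq> 0"
      and c: "poly_FS (\<Prod>v\<leftarrow>l. linear_form v) * dirder F (e i) 1 = (\<Sum>k\<in>UNIV. poly_FS (c k) * var k)"
      using log[of i] i by blast
    have "poly_FS (\<Prod>v\<leftarrow>l. linear_form v) * W.act p (d i 1) =
        W.act p 1 * (poly_FS (\<Prod>v\<leftarrow>l. linear_form v) * dirder F (e i) 1)"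
      using act_along[of p "d i 1"] p i by (auto simp: J2_def d_def mult_ac)
    also have "\<dots> = (\<Sum>k\<in>UNIV. poly_FS (c k) * (var k * W.act p 1))"
      unfolding c by (simp add: sum_distrib_left sum_distrib_right mult_ac)
    also have "\<dots> \<in> T" using p by (intro T_sum T_poly T_var) (auto simp: J2_def)
    finally have "W.act p (d i 1) \<in> T" using l
    proof (induction l)
      case (Cons v l)
      have "poly_FS (\<Prod>v\<leftarrow>l. linear_form v) * W.act p (d i 1) \<in> T"
        by (rule T_sat[of v]) (use Cons.prems in \<open>auto simp: poly_FS_mult mult.assoc\<close>)
      then show ?case using Cons by simp
    qed simp
    then have "d i (W.act p 1) - W.act p (d i 1) \<in> T" using p by (auto simp: J2_def intro: T_diff T_d)
    then have "W.act (mder i p) 1 \<in> T" by (simp add: W.d_act)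
    moreover have "Poly_Mapping.lookup \<beta> j = 0" if "Poly_Mapping.lookup (mder i p) \<beta> \<noteq> 0" "j \<in> I" for \<beta> j
    proof -
      have "Poly_Mapping.lookup p (\<beta> + Poly_Mapping.single i 1) \<noteq> 0" using that(1) unfolding lookup_mder by auto
      then have "Poly_Mapping.lookup (\<beta> + Poly_Mapping.single i 1) j = 0" using p that(2) by (auto simp: J2_def)
      then show ?thesis by (simp add: lookup_add)
    qed
    ultimately show ?thesis by (auto simp: J2_def)
  qed
  have "p1 \<in> J2" using p1 one_in_G by (auto simp: J1_def J2_def)
  have "\<exists>p\<in>J2. W.red p \<noteq> 0 \<and> (\<forall>j\<in>-I. \<forall>\<beta>. Poly_Mapping.lookup p \<beta> \<noteq> 0 \<longrightarrow> Poly_Mapping.lookup \<beta> j = 0)"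
  proof (rule W.eliminate_variables[OF _ J2_mder _ \<open>p1 \<in> J2\<close> p1(2)])
    fix i p k assume ip: "i \<in> - I" "p \<in> J2"
    have "W.act (of_nat k * p - var i * mder i p) 1 \<in> T"
      using ip J2_mder[OF ip] by (auto simp: J2_def nat intro!: T_diff T_nat T_z)
    then show "of_nat k * p - var i * mder i p \<in> J2"
      using ip(2) unfolding J2_def mem_Collect_eq lookup_euler_shift by (metis mult_zero_right)
  qed simp_all
  then obtain p where p: "p \<in> J2" "W.red p \<noteq> 0"
    "\<forall>j\<in>-I. \<forall>\<beta>. Poly_Mapping.lookup p \<beta> \<noteq> 0 \<longrightarrow> Poly_Mapping.lookup \<beta> j = 0" by blast
  \<comment> \<open>No variables are left, so \<open>p\<close> is a single element of \<complex>[S],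
    and its value at \<open>a\<close> is nonzero.\<close>
  have 0: "\<beta> = 0" if "Poly_Mapping.lookup p \<beta> \<noteq> 0" for \<beta>
    by (rule poly_mapping_eqI) (use that p in \<open>auto simp: J2_def\<close>)
  have "p = const (Poly_Mapping.lookup p 0)"
    by (rule poly_mapping_eqI) (use 0 in \<open>auto simp: const_def lookup_single when_def\<close>)
  then have "coeff_FS (Poly_Mapping.lookup p 0) \<in> T"
    using p(1) W.act_const[of "Poly_Mapping.lookup p 0" 1] by (auto simp: J2_def coeff_scale_def)
  moreover have "eval_at a (Poly_Mapping.lookup p 0) \<noteq> 0"
    using p(2) 0 W.ev_0 by (auto simp: W.red_eq_0_iff) metis
  ultimately show ?thesis by blast
qed

end

section \<open>Induction over subspaces of linear forms\<close>

definition mpoly_ideal :: "('n, complex) mpoly set \<Rightarrow> bool" where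
  "mpoly_ideal K \<longleftrightarrow> K \<noteq> {} \<and> (\<forall>p\<in>K. \<forall>q\<in>K. p + q \<in> K) \<and> (\<forall>r. \<forall>p\<in>K. r * p \<in> K)"

lemma mpoly_idealD:
  assumes "mpoly_ideal K"
  shows "p \<in> K \<Longrightarrow> q \<in> K \<Longrightarrow> p + q \<in> K" "p \<in> K \<Longrightarrow> r * p \<in> K" "0 \<in> K"
proof -
  show *: "r * p \<in> K" if "p \<in> K" for r p using assms that by (auto simp: mpoly_ideal_def)
  obtain p where "p \<in> K" using assms by (auto simp: mpoly_ideal_def)
  from *[OF this, of 0] show "0 \<in> K" by simp
qed (use assms in \<open>auto simp: mpoly_ideal_def\<close>)

lemma mpoly_ideal_insert:
  assumes K: "mpoly_ideal K"
  shows "mpoly_ideal {k + p * b |k b. k \<in> K}"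
  unfolding mpoly_ideal_def
proof (intro conjI ballI allI)
  show "{k + p * b |k b. k \<in> K} \<noteq> {}" using mpoly_idealD(3)[OF K] by blast
next
  fix u v assume "u \<in> {k + p * b |k b. k \<in> K}" "v \<in> {k + p * b |k b. k \<in> K}"
  then obtain k b k' b' where "u = k + p * b" "v = k' + p * b'" "k \<in> K" "k' \<in> K" by blast
  then have "u + v = (k + k') + p * (b + b')" "k + k' \<in> K"
    using mpoly_idealD(1)[OF K] by (auto simp: algebra_simps)
  then show "u + v \<in> {k + p * b |k b. k \<in> K}" by blast
next
  fix r u assume "u \<in> {k + p * b |k b. k \<in> K}"
  then obtain k b where "u = k + p * b" "k \<in> K" by blast
  then have "r * u = r * k + p * (r * b)" "r * k \<in> K"
    using mpoly_idealD(2)[OF K] by (auto simp: algebra_simps)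
  then show "r * u \<in> {k + p * b |k b. k \<in> K}" by blast
qed

text \<open>
  The linear forms in a prime ideal containing \<open>J\<close> and not all of \<open>W\<close> would cut out a proper subspace
  of \<open>W\<close>, against the hypothesis; hence \<open>W\<close> lies in the radical of \<open>J\<close>.
\<close>

lemma linear_form_nilpotent:
  fixes W :: "(complex ^ 'n::finite) set"
  assumes W: "vec.subspace W" and w: "w \<in> W"
    and J: "\<And>U. vec.subspace U \<Longrightarrow> U \<subset> W \<Longrightarrow> \<exists>l. set l \<subseteq> W - U \<and> (\<Prod>v\<leftarrow>l. linear_form v) \<in> J"
    and K: "mpoly_ideal K" "J \<subseteq> K"
  shows "\<exists>N. linear_form w ^ N \<in> K"
  using K
proof (induction "vec.dim W - vec.dim {v \<in> W. linear_form v \<in> K}" arbitrary: K rule: less_induct)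
  case less
  define U where "U K = {v \<in> W. linear_form v \<in> K}" for K
  have U: "vec.subspace (U K)" if "mpoly_ideal K" for K
    unfolding U_def vec.subspace_def
    using W mpoly_idealD[OF that]
    by (auto simp: linear_form_add linear_form_scale vec.subspace_0 vec.subspace_add vec.subspace_scale)
  show ?case
  proof (cases "U K = W")
    case True
    then show ?thesis using w by (auto simp: U_def intro!: exI[of _ 1])
  next
    case False
    then have "U K \<subset> W" by (auto simp: U_def)
    then obtain l where l: "set l \<subseteq> W - U K" "(\<Prod>v\<leftarrow>l. linear_form v) \<in> J"
      using J U less.prems(1) by blast
    \<comment> \<open>Adjoining a form \<open>v\<close> of the list to \<open>K\<close> enlarges
      \<open>U K\<close>, so by induction the larger ideal contains a power of \<open>w\<close>. The
      product of these powers lies in \<open>K\<close> plus the multiples of the whole product,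
      which is in \<open>J \<subseteq> K\<close>. This takes the place of a prime ideal.\<close>
    have "\<exists>N k b. k \<in> K \<and> linear_form w ^ N = k + (\<Prod>v\<leftarrow>l. linear_form v) * b"
      using l(1)
    proof (induction l)
      case Nil
      show ?case using mpoly_idealD(3)[OF less.prems(1)] by (intro exI[of _ 0] exI[of _ 1]) simp
    next
      case (Cons v l)
      define K' where "K' = {k + linear_form v * b |k b. k \<in> K}"
      have K': "mpoly_ideal K'" unfolding K'_def by (rule mpoly_ideal_insert) (rule less.prems)
      have "k + linear_form v * 0 \<in> K'" if "k \<in> K" for k unfolding K'_def using that by blast
      then have sub: "K \<subseteq> K'" by auto
      have "0 + linear_form v * 1 \<in> K'" unfolding K'_def using mpoly_idealD(3)[OF less.prems(1)] by blast
      then have "v \<in> U K'" using Cons.prems by (auto simp: U_def)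
      moreover have "v \<notin> U K" using Cons.prems by auto
      moreover have "U K \<subseteq> U K'" using sub by (auto simp: U_def)
      ultimately have "vec.span (U K) \<subset> vec.span (U K')"
        using U less.prems(1) K' by (auto simp: vec.span_eq_iff[THEN iffD2])
      then have lt: "vec.dim (U K) < vec.dim (U K')" by (rule vec.dim_psubset)
      have "vec.dim (U K') \<le> vec.dim W" by (rule vec.dim_subset) (auto simp: U_def)
      then have "vec.dim W - vec.dim (U K') < vec.dim W - vec.dim (U K)" using lt by linarith
      then obtain N where "linear_form w ^ N \<in> K'"
        using less.hyps[of K'] K' sub less.prems(2) by (auto simp: U_def)
      then obtain k b where 1: "k \<in> K" "linear_form w ^ N = k + linear_form v * b" unfolding K'_def by blast
      obtain N' k' b' where 2: "k' \<in> K" "linear_form w ^ N' = k' + (\<Prod>v\<leftarrow>l. linear_form v) * b'"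
        using Cons by auto
      have "linear_form w ^ (N + N') = ((k' + (\<Prod>v\<leftarrow>l. linear_form v) * b') * k + linear_form v * b * k') +
          (\<Prod>v\<leftarrow>v # l. linear_form v) * (b * b')"
        by (simp add: power_add 1(2) 2(2) algebra_simps)
      moreover have "(k' + (\<Prod>v\<leftarrow>l. linear_form v) * b') * k + linear_form v * b * k' \<in> K"
        by (intro mpoly_idealD[OF less.prems(1)] 1(1) 2(1))
      ultimately show ?case by blast
    qed
    then obtain N k b where "k \<in> K" "linear_form w ^ N = k + (\<Prod>v\<leftarrow>l. linear_form v) * b" by blast
    then have "linear_form w ^ N = k + b * (\<Prod>v\<leftarrow>l. linear_form v)" by (simp add: mult.commute)
    also have "\<dots> \<in> K"
      using \<open>k \<in> K\<close> l(2) less.prems(2) by (intro mpoly_idealD[OF less.prems(1)]) auto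
    finally show ?thesis by blast
  qed
qed

text \<open>A basis of \<open>W\<close> is extended to a basis \<open>\<xi>\<close> of all forms;
  the dual basis \<open>e\<close> consists of the columns of the inverse of the matrix with rows
  \<open>\<xi> i\<close>.\<close>

lemma adapted_basis:
  fixes W :: "(complex ^ 'n::finite) set"
  assumes W: "vec.subspace W"
  obtains \<xi> e :: "'n \<Rightarrow> complex ^ 'n" and I :: "'n set" where
    "\<And>i j. pairing (\<xi> i) (e j) = (if i = j then 1 else 0)"
    "\<And>v. v = (\<Sum>j\<in>UNIV. pairing v (e j) *s \<xi> j)"
    "\<And>v. v \<in> W \<longleftrightarrow> (\<forall>j\<in>-I. pairing v (e j) = 0)"
    "\<And>i. i \<in> I \<Longrightarrow> \<xi> i \<in> W"
proof -
  obtain C where C: "C \<subseteq> W" "vec.independent C" "W \<subseteq> vec.span C"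
    by (rule vec.maximal_independent_subset)
  obtain D where D: "C \<subseteq> D" "vec.independent D" "UNIV \<subseteq> vec.span D"
    by (rule vec.maximal_independent_subset_extend[OF subset_UNIV C(2)])
  have "card D = CARD('n)"
    using vec.basis_card_eq_dim[of D UNIV] D by (simp add: vec.dim_UNIV card_cart_basis)
  moreover have "finite D" by (rule vec.finiteI_independent[OF D(2)])
  ultimately obtain \<xi> where \<xi>: "bij_betw \<xi> (UNIV :: 'n set) D"
    using finite_same_card_bij[of "UNIV :: 'n set" D] by auto
  define M :: "complex ^ 'n ^ 'n" where "M = (\<chi> i. \<xi> i)"
  have "rows M = D" using \<xi> by (auto simp: rows_def row_def M_def bij_betw_def image_def)
  then have "vec.span (rows M) = UNIV" using D(3) by auto
  then obtain N where NM: "N ** M = mat 1" using matrix_left_invertible_span_rows_gen by blast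
  then have MN: "M ** N = mat 1" by (rule matrix_left_right_inverse1)
  define e where "e j = (\<chi> k. N $ k $ j)" for j
  define I where "I = \<xi> -` C"
  have dual: "pairing (\<xi> i) (e j) = (if i = j then 1 else 0)" for i j
  proof -
    have "(M ** N) $ i $ j = pairing (\<xi> i) (e j)"
      by (simp add: matrix_matrix_mult_def pairing_def M_def e_def)
    then show ?thesis by (simp add: MN mat_def)
  qed
  have expand: "v = (\<Sum>j\<in>UNIV. pairing v (e j) *s \<xi> j)" for v
  proof -
    have "v = v v* (N ** M)" by (simp add: NM)
    also have "\<dots> = (v v* N) v* M" by (simp add: vector_matrix_mul_assoc)
    also have "\<dots> = (\<Sum>j\<in>UNIV. pairing v (e j) *s \<xi> j)"
      by (simp add: vec_eq_iff vector_matrix_mult_def pairing_def e_def M_def mult.commute)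
    finally show ?thesis .
  qed
  have C_I: "\<exists>i\<in>I. c = \<xi> i" if "c \<in> C" for c
    using that D(1) \<xi> unfolding I_def bij_betw_def by blast
  show ?thesis
  proof (rule that[OF dual expand])
    show "\<xi> i \<in> W" if "i \<in> I" for i using that C(1) by (auto simp: I_def)
    then have I_W: "\<xi> i \<in> W" if "i \<in> I" for i using that by blast
    fix v show "v \<in> W \<longleftrightarrow> (\<forall>j\<in>-I. pairing v (e j) = 0)"
    proof
      assume "v \<in> W"
      have "vec.subspace {v. \<forall>j\<in>-I. pairing v (e j) = 0}"
        unfolding vec.subspace_def by (auto simp: pairing_add pairing_scale) (simp add: pairing_def)
      moreover have "C \<subseteq> {v. \<forall>j\<in>-I. pairing v (e j) = 0}"
        using C_I by (force simp: dual dest!: C_I)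
      ultimately have "vec.span C \<subseteq> {v. \<forall>j\<in>-I. pairing v (e j) = 0}" by (rule vec.span_minimal[rotated])
      then show "\<forall>j\<in>-I. pairing v (e j) = 0" using \<open>v \<in> W\<close> C(3) by blast
    next
      assume *: "\<forall>j\<in>-I. pairing v (e j) = 0"
      have "(\<Sum>j\<in>UNIV. pairing v (e j) *s \<xi> j) \<in> W"
      proof (rule vec.subspace_sum[OF W])
        fix j show "pairing v (e j) *s \<xi> j \<in> W"
          using * I_W[of j] vec.subspace_0[OF W] by (cases "j \<in> I") (auto intro: vec.subspace_scale[OF W])
      qed
      then show "v \<in> W" using expand[of v] by simp
    qed
  qed
qed

text \<open>The elements that vanish in \<open>M\<close> after inverting the forms outside of
  \<open>W\<close> and all \<open>B\<close> with \<open>B(a) \<noteq> 0\<close>. That it contains 1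
  says that this localization of \<open>M\<close> is zero.\<close>

definition local_sat ::
    "('r::finite \<Rightarrow> ('n::finite, complex) mpoly) \<Rightarrow> complex ^ 'r \<Rightarrow> (complex ^ 'n) set \<Rightarrow> ('n, 'r) FS set" where
  "local_sat F a W = {h. \<exists>l B. set l \<inter> W = {} \<and> eval_at a B \<noteq> 0 \<and>
     poly_FS (\<Prod>v\<leftarrow>l. linear_form v) * coeff_FS B * h \<in> alg_generated F (f_FS F)}"

lemma local_satI:
  "set l \<inter> W = {} \<Longrightarrow> eval_at a B \<noteq> 0 \<Longrightarrow>
     poly_FS (\<Prod>v\<leftarrow>l. linear_form v) * coeff_FS B * h \<in> alg_generated F (f_FS F) \<Longrightarrow> h \<in> local_sat F a W"
  unfolding local_sat_def by blast

lemma local_satE: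
  assumes "h \<in> local_sat F a W"
  obtains l B where "set l \<inter> W = {}" "eval_at a B \<noteq> 0"
     "poly_FS (\<Prod>v\<leftarrow>l. linear_form v) * coeff_FS B * h \<in> alg_generated F (f_FS F)"
  using assms unfolding local_sat_def by blast

lemma alg_generated_coeff: "h \<in> alg_generated F g \<Longrightarrow> coeff_FS B * h \<in> alg_generated F g"
  by (induction B arbitrary: h rule: mpoly_induct)
    (auto simp: coeff_FS_const coeff_FS_var coeff_FS_add coeff_FS_mult scalar_poly_FS distrib_right mult.assoc
      intro: alg_generated.intros)

lemma alg_generated_diff: "u \<in> alg_generated F g \<Longrightarrow> v \<in> alg_generated F g \<Longrightarrow> u - v \<in> alg_generated F g"
  using alg_generated.add[of u F g "- v"] alg_generated.poly[of v F g "- 1"] by (simp add: poly_FS_uminus)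

lemma FS_submodule_local_sat: "FS_submodule F (local_sat F a W)"
  unfolding FS_submodule_def
proof (intro conjI ballI allI)
  fix g h assume "g \<in> local_sat F a W" "h \<in> local_sat F a W"
  then obtain l B l' B' where *: "set l \<inter> W = {}" "eval_at a B \<noteq> 0"
     "poly_FS (\<Prod>v\<leftarrow>l. linear_form v) * coeff_FS B * g \<in> alg_generated F (f_FS F)"
     "set l' \<inter> W = {}" "eval_at a B' \<noteq> 0"
     "poly_FS (\<Prod>v\<leftarrow>l'. linear_form v) * coeff_FS B' * h \<in> alg_generated F (f_FS F)"
    by (elim local_satE) blast
  have "poly_FS (\<Prod>v\<leftarrow>l'. linear_form v) * (coeff_FS B' * (poly_FS (\<Prod>v\<leftarrow>l. linear_form v) * coeff_FS B * g)) +
      poly_FS (\<Prod>v\<leftarrow>l. linear_form v) * (coeff_FS B * (poly_FS (\<Prod>v\<leftarrow>l'. linear_form v) * coeff_FS B' * h))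
      \<in> alg_generated F (f_FS F)"
    by (intro alg_generated.add alg_generated.poly alg_generated_coeff *)
  then show "g + h \<in> local_sat F a W"
    using * by (intro local_satI[of "l @ l'" W a "B * B'"])
      (auto simp: eval_at_mult poly_FS_mult coeff_FS_mult algebra_simps)
next
  fix h assume "h \<in> local_sat F a W"
  then obtain l B where *: "set l \<inter> W = {}" "eval_at a B \<noteq> 0"
     "poly_FS (\<Prod>v\<leftarrow>l. linear_form v) * coeff_FS B * h \<in> alg_generated F (f_FS F)"
    by (elim local_satE)
  show "poly_FS p * h \<in> local_sat F a W" for p
    using alg_generated.poly[OF *(3), of p] by (intro local_satI[OF *(1,2)]) (simp add: mult_ac)
  show "var k * h \<in> local_sat F a W" for k
    using alg_generated.var[OF *(3), of k] by (intro local_satI[OF *(1,2)]) (simp add: mult_ac)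
  show "partial_FS F i h \<in> local_sat F a W" for i
  proof -
    let ?l = "poly_FS (\<Prod>v\<leftarrow>l. linear_form v)" and ?B = "coeff_FS B"
    have "?l * partial_FS F i (?l * ?B * h) - poly_FS (mder i (\<Prod>v\<leftarrow>l. linear_form v)) * (?l * ?B * h)
      \<in> alg_generated F (f_FS F)"
      by (intro alg_generated_diff alg_generated.poly alg_generated.partial *)
    also have "?l * partial_FS F i (?l * ?B * h) - poly_FS (mder i (\<Prod>v\<leftarrow>l. linear_form v)) * (?l * ?B * h) =
        ?l * ?l * ?B * partial_FS F i h"
      unfolding partial_FS_leibniz[of F i "?l * ?B" h] partial_coeffs_mult partial_coeffs_poly_FS partial_coeffs_coeff_FS
      by (simp add: algebra_simps)
    finally show ?thesis
      using * by (intro local_satI[of "l @ l" W a B]) (auto simp: poly_FS_mult mult_ac)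
  qed
qed

lemma local_sat_cancel_form:
  assumes "poly_FS (linear_form v) * h \<in> local_sat F a W" "v \<notin> W"
  shows "h \<in> local_sat F a W"
proof -
  obtain l B where "set l \<inter> W = {}" "eval_at a B \<noteq> 0"
    "poly_FS (\<Prod>v\<leftarrow>l. linear_form v) * coeff_FS B * (poly_FS (linear_form v) * h) \<in> alg_generated F (f_FS F)"
    using assms(1) by (rule local_satE)
  then show ?thesis
    using assms(2) by (intro local_satI[of "v # l" W a B]) (auto simp: poly_FS_mult mult_ac)
qed

lemma local_sat_cancel_coeff:
  assumes "coeff_FS C * h \<in> local_sat F a W" "eval_at a C \<noteq> 0"
  shows "h \<in> local_sat F a W"
proof -
  obtain l B where "set l \<inter> W = {}" "eval_at a B \<noteq> 0"
    "poly_FS (\<Prod>v\<leftarrow>l. linear_form v) * coeff_FS B * (coeff_FS C * h) \<in> alg_generated F (f_FS F)"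
    using assms(1) by (rule local_satE)
  then show ?thesis
    using assms(2) by (intro local_satI[of l W a "B * C"]) (auto simp: eval_at_mult coeff_FS_mult mult_ac)
qed

lemma alg_generated_local_sat: "alg_generated F (f_FS F) \<subseteq> local_sat F a W"
  by (auto intro!: local_satI[of "[]" _ _ 1] simp: eval_at_1)

lemma local_sat_filter:
  "poly_FS (\<Prod>v\<leftarrow>l. linear_form v) * h \<in> local_sat F a W \<Longrightarrow>
     poly_FS (\<Prod>v\<leftarrow>filter (\<lambda>v. v \<in> W) l. linear_form v) * h \<in> local_sat F a W"
proof (induction l arbitrary: h)
  case (Cons v l)
  have "poly_FS (\<Prod>v\<leftarrow>l. linear_form v) * (poly_FS (linear_form v) * h) \<in> local_sat F a W"
    using Cons.prems by (simp add: poly_FS_mult mult_ac)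
  from Cons.IH[OF this] have *: "poly_FS (linear_form v) * (poly_FS (\<Prod>v\<leftarrow>filter (\<lambda>v. v \<in> W) l. linear_form v) * h)
      \<in> local_sat F a W"
    by (simp add: mult_ac)
  show ?case
  proof (cases "v \<in> W")
    case True
    then show ?thesis using * by (simp add: poly_FS_mult mult.assoc)
  next
    case False
    then show ?thesis using local_sat_cancel_form[OF * False] by simp
  qed
qed simp

text \<open>The derivative of a linear form in the direction \<open>w\<close> is the constant
  \<open>pairing v w\<close>, which is zero for \<open>v \<in> W\<close>. Forms in \<open>W\<close>
  therefore leave no denominator in \<open>dvd_derivation_factor\<close>.\<close>

lemma dirder_one:
  fixes F :: "'r::finite \<Rightarrow> ('n::finite, complex) mpoly"
  assumes F: "prod_F F = (\<Prod>v\<leftarrow>vs. linear_form v)" "0 \<notin> set vs"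
    and w: "\<And>v. v \<in> W \<Longrightarrow> pairing v w = 0"
  shows "\<exists>l c. set l \<inter> W = {} \<and>
    poly_FS (\<Prod>v\<leftarrow>l. linear_form v) * dirder F w 1 = (\<Sum>k\<in>UNIV. poly_FS (c k) * var k)"
proof -
  define D :: "('n, complex) mpoly \<Rightarrow> ('n, complex) mpoly" where
    "D p = (\<Sum>i\<in>UNIV. const (w $ i) * mder i p)" for p
  have leibniz: "D (p * q) = D p * q + p * D q" for p q
    by (simp add: D_def mder_mult sum.distrib algebra_simps sum_distrib_left)
  define l where "l = filter (\<lambda>v. \<not> linear_form v dvd D (linear_form v)) vs"
  have const_sum: "const (\<Sum>i\<in>A. h i) = (\<Sum>i\<in>A. const (h i) :: ('n, complex) mpoly)" for A :: "'n set" and h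
    by (induction A rule: infinite_finite_induct) (simp_all add: const_add)
  have "D (linear_form v) = const (pairing v w)" for v
    by (simp add: D_def mder_linear_form pairing_def const_sum const_mult mult.commute)
  then have l: "set l \<inter> W = {}" using w by (auto simp: l_def)
  have nz: "F k \<noteq> 0" for k
    using factor_dvd_prod_F[of F k] prod_linear_forms_neq_0[OF F(2)] F(1) by auto
  have "F k dvd (\<Prod>v\<leftarrow>l. linear_form v) * D (F k)" for k
    unfolding l_def using factor_dvd_prod_F[of F k] F by (intro dvd_derivation_factor leibniz) auto
  then have "\<forall>k. \<exists>c. (\<Prod>v\<leftarrow>l. linear_form v) * D (F k) = F k * c" by (auto elim: dvdE)
  then obtain c where c: "\<And>k. (\<Prod>v\<leftarrow>l. linear_form v) * D (F k) = F k * c k" by metis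
  have "poly_FS (\<Prod>v\<leftarrow>l. linear_form v) * (\<Sum>i\<in>UNIV. scalar (w $ i) * log_der F i k) = poly_FS (c k)" for k
  proof (rule poly_FS_cancel[OF _ nz])
    have "poly_FS (F k) * (\<Sum>i\<in>UNIV. scalar (w $ i) * log_der F i k) = poly_FS (D (F k))"
      by (simp add: D_def sum_distrib_left mult.left_commute[of "poly_FS (F k)"] log_der_mult[where F = F, OF nz]
          poly_FS_sum poly_FS_mult scalar_poly_FS)
    then show "poly_FS (F k) * (poly_FS (\<Prod>v\<leftarrow>l. linear_form v) * (\<Sum>i\<in>UNIV. scalar (w $ i) * log_der F i k)) =
        poly_FS (F k) * poly_FS (c k)"
      by (simp add: mult.left_commute[of "poly_FS (F k)"] c flip: poly_FS_mult)
  qed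
  note ck = this
  have "dirder F w 1 = (\<Sum>i\<in>UNIV. \<Sum>k\<in>UNIV. scalar (w $ i) * log_der F i k * var k)"
    by (simp add: dirder_def partial_FS_log_der partial_coeffs_1 log_der_sum_def sum_distrib_left mult.assoc)
  also have "\<dots> = (\<Sum>k\<in>UNIV. (\<Sum>i\<in>UNIV. scalar (w $ i) * log_der F i k) * var k)"
    by (subst sum.swap) (simp add: sum_distrib_right)
  finally have "poly_FS (\<Prod>v\<leftarrow>l. linear_form v) * dirder F w 1 =
      (\<Sum>k\<in>UNIV. poly_FS (\<Prod>v\<leftarrow>l. linear_form v) * ((\<Sum>i\<in>UNIV. scalar (w $ i) * log_der F i k) * var k))"
    by (simp only: sum_distrib_left[of _ "\<lambda>k. _ k * var k"])
  then show ?thesis using l unfolding mult.assoc[symmetric] ck by blast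
qed

text \<open>The hypothesis for proper subspaces provides the nilpotency of the forms in
  \<open>W\<close>, and \<open>flat_step\<close> then provides the \<open>B\<close>. For
  \<open>W = {0}\<close> there is no proper subspace, \<open>I\<close> is empty, and the step itself
  is the base case.\<close>

lemma one_in_local_sat:
  fixes F :: "'r::finite \<Rightarrow> ('n::finite, complex) mpoly"
  assumes F: "prod_F F = (\<Prod>v\<leftarrow>vs. linear_form v)" "0 \<notin> set vs"
    and one: "1 = n + (\<Sum>k\<in>UNIV. (var k - scalar (a $ k)) * m k)"
      "n \<in> alg_generated F (f_FS F)" "\<And>k. m k \<in> alg_generated F 1"
    and W: "vec.subspace W"
  shows "1 \<in> local_sat F a W"
  using W
proof (induction "vec.dim W" arbitrary: W rule: less_induct)
  case less
  let ?T = "local_sat F a W"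
  obtain \<xi> e :: "'n \<Rightarrow> complex ^ 'n" and I where basis:
    "\<And>i j. pairing (\<xi> i) (e j) = (if i = j then 1 else 0)"
    "\<And>v. v = (\<Sum>j\<in>UNIV. pairing v (e j) *s \<xi> j)"
    and WI: "\<And>v. v \<in> W \<longleftrightarrow> (\<forall>j\<in>-I. pairing v (e j) = 0)"
    and \<xi>: "\<And>i. i \<in> I \<Longrightarrow> \<xi> i \<in> W"
    using adapted_basis[OF less.prems] by blast
  have T: "FS_submodule F ?T" by (rule FS_submodule_local_sat)
  define J :: "('n, complex) mpoly set" where "J = {p. poly_FS p \<in> ?T}"
  have J: "mpoly_ideal J"
    using T alg_generated_0[of F "f_FS F"] alg_generated_local_sat[of F a W]
    unfolding mpoly_ideal_def J_def FS_submodule_def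
    by (auto simp: poly_FS_add poly_FS_mult intro!: exI[of _ 0])
  have nil: "\<exists>K. poly_FS (linear_form w ^ K) \<in> ?T" if "w \<in> W" for w
  proof -
    have "\<exists>l. set l \<subseteq> W - U \<and> (\<Prod>v\<leftarrow>l. linear_form v) \<in> J" if U: "vec.subspace U" "U \<subset> W" for U
    proof -
      have "vec.span U \<subset> vec.span W" using U less.prems by (simp add: vec.span_eq_iff[THEN iffD2])
      then have "vec.dim U < vec.dim W" by (rule vec.dim_psubset)
      then have "1 \<in> local_sat F a U" using U(1) by (rule less.hyps)
      then obtain l B where l: "set l \<inter> U = {}" "eval_at a B \<noteq> 0"
        "poly_FS (\<Prod>v\<leftarrow>l. linear_form v) * coeff_FS B * 1 \<in> alg_generated F (f_FS F)"
        by (rule local_satE)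
      have "coeff_FS B * (poly_FS (\<Prod>v\<leftarrow>l. linear_form v) * 1) \<in> ?T"
        using l(3) alg_generated_local_sat[of F a W] by (auto simp: mult_ac)
      then have "poly_FS (\<Prod>v\<leftarrow>l. linear_form v) * 1 \<in> ?T" using l(2) by (rule local_sat_cancel_coeff)
      then have "poly_FS (\<Prod>v\<leftarrow>filter (\<lambda>v. v \<in> W) l. linear_form v) * 1 \<in> ?T" by (rule local_sat_filter)
      then show ?thesis using l(1) by (intro exI[of _ "filter (\<lambda>v. v \<in> W) l"]) (auto simp: J_def)
    qed
    from linear_form_nilpotent[OF less.prems that this J subset_refl] show ?thesis
      by (auto simp: J_def)
  qed
  have "\<forall>i. \<exists>K. i \<in> I \<longrightarrow> poly_FS (linear_form (\<xi> i) ^ K) \<in> ?T" using nil \<xi> by blast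
  then obtain K where K: "\<And>i. i \<in> I \<Longrightarrow> poly_FS (linear_form (\<xi> i) ^ K i) \<in> ?T" by metis
  \<comment> \<open>One exponent for all \<open>i\<close>, made positive so that the monomial 1
    belongs to \<open>G\<close>.\<close>
  define N where "N = Suc (\<Sum>i\<in>UNIV. K i)"
  interpret flat_step F a \<xi> e I ?T N n m
  proof
    show "FS_submodule F ?T" by (rule T)
    show "h \<in> ?T" if "poly_FS (linear_form v) * h \<in> ?T" "\<exists>j\<in>-I. pairing v (e j) \<noteq> 0" for v h
      using local_sat_cancel_form[OF that(1)] that(2) WI by blast
    show "\<exists>l c. (\<forall>v\<in>set l. \<exists>j\<in>-I. pairing v (e j) \<noteq> 0) \<and>
        poly_FS (\<Prod>v\<leftarrow>l. linear_form v) * dirder F (e j) 1 = (\<Sum>k\<in>UNIV. poly_FS (c k) * var k)"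
      if "j \<notin> I" for j
    proof -
      have "pairing v (e j) = 0" if "v \<in> W" for v using that \<open>j \<notin> I\<close> WI by blast
      from dirder_one[OF F this] obtain l c where lc: "set l \<inter> W = {}"
        "poly_FS (\<Prod>v\<leftarrow>l. linear_form v) * dirder F (e j) 1 = (\<Sum>k\<in>UNIV. poly_FS (c k) * var k)"
        by blast
      then have "\<forall>v\<in>set l. \<exists>j\<in>-I. pairing v (e j) \<noteq> 0" using WI by blast
      with lc(2) show ?thesis by blast
    qed
    show "\<exists>K. poly_FS (linear_form v ^ K) \<in> ?T" if "\<forall>j\<in>-I. pairing v (e j) = 0" for v
      using that WI nil by blast
    show "poly_FS (linear_form (\<xi> i) ^ N) \<in> ?T" if "i \<in> I" for i
    proof -
      have "K i \<le> (\<Sum>i\<in>UNIV. K i)" by (rule member_le_sum) auto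
      then have "N = (N - K i) + K i" by (simp add: N_def)
      then have "linear_form (\<xi> i) ^ N = linear_form (\<xi> i) ^ (N - K i) * linear_form (\<xi> i) ^ K i"
        by (metis power_add)
      then show ?thesis using T K[OF that] by (simp add: poly_FS_mult FS_submodule_def)
    qed
    show "n \<in> ?T" using one(2) alg_generated_local_sat by blast
  qed (use basis one N_def in auto)
  obtain B where "eval_at a B \<noteq> 0" "coeff_FS B * 1 \<in> ?T" using exists_bernstein by auto
  then show ?case using local_sat_cancel_coeff by blast
qed

theorem propositionB1:
  fixes F :: "'r::finite \<Rightarrow> ('n::finite, complex) mpoly" and A :: "complex ^ 'r"
  assumes "central_reduced_arrangement (prod_F F)"
    and "free_arrangement (prod_F F)"
    and "A - 1 \<in> zero_locus (bernstein_sato_ideal F)"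
  shows "nabla_spec F A ` specialization F A \<noteq> specialization F (A - 1)"
proof
  assume surj: "nabla_spec F A ` specialization F A = specialization F (A - 1)"
  obtain vs where vs: "prod_F F = (\<Prod>v\<leftarrow>vs. linear_form v)" "0 \<notin> set vs"
    using assms(1) unfolding central_reduced_arrangement_def by blast
  then have nz: "prod_F F \<noteq> 0" using prod_linear_forms_neq_0 by metis
  let ?c = "cong_S_minus (A - 1) (DFS F)"
  have 1: "1 \<in> DFS F" by (rule generated_by_self)
  \<comment> \<open>Surjectivity is used only for the class of \<open>F\<^sup>S\<close>, which is
    encoded as 1.\<close>
  then have "?c `` {1} \<in> specialization F (A - 1)" unfolding specialization_def by (rule quotientI)
  then obtain X where X: "X \<in> specialization F A" "?c `` {1} = nabla_spec F A X" unfolding surj[symmetric] by blast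
  then obtain u where u: "u \<in> DFS F" "X = cong_S_minus A (DFS F) `` {u}"
    unfolding specialization_def by (auto elim: quotientE)
  have "?c `` {1} = ?c `` {nabla F u}" unfolding X(2) u(2) by (rule nabla_spec_class[OF nz u(1)])
  then have "(1, nabla F u) \<in> ?c"
    using eq_equiv_class_iff[OF equiv_cong_S_minus 1 nabla_in_DFS[OF nz u(1)]] by blast
  then have "1 - nabla F u \<in> S_minus (A - 1) (DFS F)" by (simp add: cong_S_minus_def)
  then obtain m where m: "1 - nabla F u = (\<Sum>k\<in>UNIV. (var k - scalar ((A - 1) $ k)) * m k)" "\<And>k. m k \<in> DFS F"
    by (elim S_minusE) blast
  \<comment> \<open>The map sends \<open>F\<^sup>S\<close> to \<open>f F\<^sup>S\<close> and carries
    operators to operators, so its image lies in the submodule that defines the Bernstein-Sato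
    ideal.\<close>
  have n: "nabla F u \<in> generated_by F (f_FS F)"
  proof -
    obtain P where P: "P \<in> diffops F" "u = P 1" using u(1) unfolding generated_by_def by blast
    then obtain R where "R \<in> diffops F" "nabla F u = R (f_FS F)"
      using nabla_diffop[OF nz P(1)] nabla_1[of F] by metis
    then show ?thesis unfolding generated_by_def by blast
  qed
  have 1: "1 = nabla F u + (\<Sum>k\<in>UNIV. (var k - scalar ((A - 1) $ k)) * m k)" unfolding m(1)[symmetric] by simp
  have Fk: "\<exists>m. euler (F k) = const (of_nat m) * F k" for k
    using euler_factor[of "F k" vs] vs factor_dvd_prod_F[of F k] by simp
  obtain d where d: "euler (prod_F F) = const (of_nat d) * prod_F F"
    using euler_factor[of "prod_F F" vs] vs by auto
  obtain n' m' where one: "1 = n' + (\<Sum>k\<in>UNIV. (var k - scalar ((A - 1) $ k)) * m' k)"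
    "n' \<in> alg_generated F (f_FS F)" "\<And>k. m' k \<in> alg_generated F 1"
    using generated_one_algebraic[OF nz Fk d 1 n m(2)] by blast
  \<comment> \<open>For the space of all forms the list \<open>l\<close> must be empty, so the
    resulting \<open>B\<close> itself lies in the Bernstein-Sato ideal.\<close>
  have "1 \<in> local_sat F (A - 1) UNIV" by (rule one_in_local_sat[OF vs one vec.subspace_UNIV])
  then obtain l B where B: "set l \<inter> UNIV = {}" "eval_at (A - 1) B \<noteq> 0"
    "poly_FS (\<Prod>v\<leftarrow>l. linear_form v) * coeff_FS B * 1 \<in> alg_generated F (f_FS F)"
    by (rule local_satE)
  then have "coeff_FS B \<in> generated_by F (f_FS F)" using alg_generated_subset by auto
  then have "B \<in> bernstein_sato_ideal F" by (simp add: bernstein_sato_ideal_def coeff_FS_def)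
  then show False using assms(3) B(2) unfolding zero_locus_def eval_at_def by blast
qed

end
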